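(* Let $(V,q)$ be a Lie algebra, $M$ a $(V,q)$-module, and $(\tilde V,\tilde b,\tilde q)$ the quadratic Lie algebra obtained as the double semidirect product of $V$ by $M$. Let $c\mapsto\Omega_{\tilde C}$ be the map associating to any multilinear skew-symmetric mapping $c$ from $V^k$ into $M$, with degree $2-k$, the symmetric form $\Omega_{\tilde C}$. Then this map is a complex morphism between the Chevalley cohomology for the $(V,q)$-module $M$ and the Pinczon cohomology of symmetric forms $\mathcal C(\tilde V)|_S$ on $\tilde V$.
   Context: The spaces are finite-dimensional graded vector spaces over a field of characteristic $0$, and $q$ has degree $0$. $|x|$ is the degree of $x$ before shifting; $V[1]$ is $V$ with degree $\deg(x)=|x|-1$. All formulas use Koszul's sign rule: in any relation between homogeneous objects, the first term has sign $+$ and every other term is implicitly multiplied by the sign of the permutation of the odd letters relating it to the first term. To a $k$-linear map $q$ one associates the shifted map (capital letter, also denoted $q[1]$) $Q(x_1,\dots,x_k)=(-1)^{\sum_{j}(k-j)\deg x_j}q(x_1,\dots,x_k)$, of degree $|q|+k-1$; skew-symmetric maps become symmetric. To a bilinear form $b$ one associates $B(x,y)=(-1)^{\deg x}b(x,y)$ on the shifted space. Double semidirect product. $W=V\rtimes M$ is $V\oplus M$ with the Lie bracket $q_W((x,a),(y,b))=([x,y],\,x\cdot b-y\cdot a)$, where $[x,y]=q(x,y)$. The dual $W^\star=V^\star\times M^\star$ is a $W$-module by $(w\cdot f)(w')=-f(q_W(w,w'))$; for $f=(g,h)$ write $(x,a)\cdot(g,h)=(x\cdot g+a\cdot h,\,x\cdot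 h)$. $\tilde V=W\times W^\star$ has the bracket $$\tilde q((x,a,g,h),(x',a',g',h'))=([x,x'],\,x\cdot a'-x'\cdot a,\,x\cdot g'-x'\cdot g+a\cdot h'-a'\cdot h,\,x\cdot h'-x'\cdot h)$$ and the symmetric non-degenerate form $\tilde b((x,a,g,h),(x',a',g',h'))=g(x')+h(a')+g'(x)+h'(a)$. $\tilde Q,\tilde B$ are the shifted versions. The map. For a skew-symmetric $k$-linear $c:V^k\to M$ of degree $2-k$, with shifted map $C$, $\tilde C:\tilde V[1]^k\to\tilde V[1]$ is $$\tilde C((x_1,a_1,g_1,h_1),\dots,(x_k,a_k,g_k,h_k))=\Big(0,\,C(x_1,\dots,x_k),\,\sum_{j=1}^kC_j(x_1,\dots,h_j,\dots,x_k),\,0\Big),$$ with $C_j(x_1,\dots,h_j,\dots,x_k)=h_j(C(x_{j+1},\dots,x_k,\,\cdot\,,x_1,\dots,x_{j-1}))\in V^\star$. Forms and operators. For $F:\tilde V[1]^k\to\tilde V[1]$, $\Omega_F(v_1,\dots,v_{k+1})=\tilde B(F(v_1,\dots,v_k),v_{k+1})$. For a multilinear map or form $F$, $F^{Sym}(v_1,\dots,v_n)=\sum_{\sigma\in\mathfrak S_n}F(v_{\sigma(1)},\dots,v_{\sigma(n)})$. The Pinczon bracket on the space $\mathcal C(\tilde V)$ of cyclic forms on $\tilde V[1]$ (those with $\Omega(v_{k+1},v_1,\dots,v_k)=\Omega(v_1,\dots,v_{k+1})$) is $\{\Omega,\Omega'\}=\sum_i\big(\iota_{e_i}\Omega\otimes\iota_{e'_i}\Omega'\big)^{Cycl}$,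 where $(e_i),(e'_i)$ are bases of $\tilde V$ with $\tilde b(e_i,e'_j)=\delta_{ij}$, $\iota$ is insertion in the first slot and $Cycl$ means the sum over all cyclic permutations of the variables. $\mathcal C(\tilde V)|_S$ is the quotient of $\mathcal C(\tilde V)$ formed by the restrictions $\Omega^{Sym}$ of cyclic forms to symmetric tensors, with the induced bracket $\{\Omega^{Sym},(\Omega')^{Sym}\}|=(\{\Omega,\Omega'\})^{Sym}$. On symmetric forms this reads $\{\Omega,\Omega'\}|=(k+k')\sum_i\iota_{e_i}\Omega\cdot\iota_{e'_i}\Omega'$ for $\Omega$ $(k+1)$-linear, $\Omega'$ $(k'+1)$-linear, with $\cdot$ the symmetric product. The Pinczon coboundary operator $d_P$ on symmetric forms is defined by $\{\Omega_{\tilde Q},\Omega_{\tilde C}\}|=\Omega_{d_P\tilde C}$. The Chevalley coboundary $d_{Ch}$ is given by $(d_{Ch}c)[1]=[Q,C]^{Sym}$, where $[Q,C](x_1,\dots,x_{k+1})=Q_W(C(x_1,\dots,x_k),x_{k+1})+Q_W(x_1,C(x_2,\dots,x_{k+1}))-\sum_{j=1}^kC(x_1,\dots,Q(x_j,x_{j+1}),\dots,x_{k+1})$ with Koszul signs and $Q_W$ the shifted map of $q_W$.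
   Formalization: With the unnormalized Sym and Cycl, the map c ↦ Ω_C~ intertwines the differentials only up to the factor k+2: {Ω_Q~,Ω_C~}| = (k+2)Ω of (d_Ch c)~; the exact complex morphism is c ↦ (Ω_C~)^Sym. Cochains of any degree are allowed. *)

theory Defs
  imports
    Complex_Main
    "HOL-Combinatorics.Permutations"
    "HOL-Library.Function_Algebras"
    "HOL-Library.Product_Plus"
begin

section \<open>Graded vector spaces\<close>

text \<open>
  A graded space is a scalar multiplication together with its homogeneous subspaces; its
  underlying space is their span. A \<open>k\<close>-linear map is a function on lists, considered only on
  lists of length \<open>k\<close>.
\<close>

record ('k, 'v) gspace =
  smul :: "'k \<Rightarrow> 'v \<Rightarrow> 'v"
  hcomp :: "int \<Rightarrow> 'v set"

definition gcarrier :: "('k::field, 'v::ab_group_add) gspace \<Rightarrow> 'v set" where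
  "gcarrier G = module.span (smul G) (\<Union>d. hcomp G d)"

definition decomposes :: "('k, 'v::ab_group_add) gspace \<Rightarrow> 'v \<Rightarrow> (int \<Rightarrow> 'v) \<Rightarrow> bool" where
  "decomposes G v f \<longleftrightarrow>
     (\<forall>d. f d \<in> hcomp G d) \<and> finite {d. f d \<noteq> 0} \<and> v = (\<Sum>d | f d \<noteq> 0. f d)"

definition graded_space :: "('k::field, 'v::ab_group_add) gspace \<Rightarrow> bool" where
  "graded_space G \<longleftrightarrow> vector_space (smul G) \<and> (\<forall>d. module.subspace (smul G) (hcomp G d)) \<and>
     (\<forall>v. \<exists>!f. decomposes G v f) \<and> (\<exists>B. finite B \<and> module.span (smul G) B = UNIV)"

definition gproj :: "('k, 'v::ab_group_add) gspace \<Rightarrow> int \<Rightarrow> 'v \<Rightarrow> 'v" where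
  "gproj G d v = (THE f. decomposes G v f) d"

definition degrees :: "('k, 'v::ab_group_add) gspace \<Rightarrow> int set" where
  "degrees G = {d. hcomp G d \<noteq> {0}}"

text \<open>
  Formulas containing Koszul signs are written for homogeneous arguments \<open>us\<close> of degrees \<open>ds\<close>
  and extended multilinearly.
\<close>

definition multihom ::
  "('k, 'v::ab_group_add) gspace \<Rightarrow> (int list \<Rightarrow> 'v list \<Rightarrow> 'w::ab_group_add) \<Rightarrow> 'v list \<Rightarrow> 'w" where
  "multihom G \<Phi> vs =
     (\<Sum>ds | length ds = length vs \<and> set ds \<subseteq> degrees G. \<Phi> ds (map2 (gproj G) ds vs))"

definition sg :: "int \<Rightarrow> 'w::ab_group_add \<Rightarrow> 'w" where
  "sg n w = (if even n then w else - w)"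

definition ground :: "('k::field, 'k) gspace" where
  "ground = \<lparr>smul = (*), hcomp = (\<lambda>d. if d = 0 then UNIV else {0})\<rparr>"

definition gshift :: "('k, 'v) gspace \<Rightarrow> ('k, 'v) gspace" where
  "gshift G = \<lparr>smul = smul G, hcomp = (\<lambda>d. hcomp G (d + 1))\<rparr>"

definition gsum :: "('k, 'v) gspace \<Rightarrow> ('k, 'w) gspace \<Rightarrow> ('k, 'v \<times> 'w) gspace" where
  "gsum G H = \<lparr>smul = (\<lambda>c (x, y). (smul G c x, smul H c y)),
               hcomp = (\<lambda>d. hcomp G d \<times> hcomp H d)\<rparr>"

definition gdual :: "('k::field, 'v::ab_group_add) gspace \<Rightarrow> ('k, 'v \<Rightarrow> 'k) gspace" where
  "gdual G = \<lparr>smul = (\<lambda>c g x. c * g x),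
              hcomp = (\<lambda>d. {g. Vector_Spaces.linear (smul G) (*) g \<and>
                               (\<forall>d' x. d' \<noteq> - d \<longrightarrow> x \<in> hcomp G d' \<longrightarrow> g x = 0)})\<rparr>"

section \<open>Multilinear maps\<close>

definition tuples :: "('k::field, 'v::ab_group_add) gspace \<Rightarrow> nat \<Rightarrow> 'v list set" where
  "tuples G n = {vs. length vs = n \<and> set vs \<subseteq> gcarrier G}"

definition multilinear ::
  "('k::field, 'v::ab_group_add) gspace \<Rightarrow> ('k, 'w::ab_group_add) gspace \<Rightarrow> nat
    \<Rightarrow> ('v list \<Rightarrow> 'w) \<Rightarrow> bool" where
  "multilinear G H k F \<longleftrightarrow>
     (\<forall>vs\<in>tuples G k. F vs \<in> gcarrier H) \<and>
     (\<forall>us ws x y a. us @ x # ws \<in> tuples G k \<longrightarrow> y \<in> gcarrier G \<longrightarrow>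
        F (us @ (x + y) # ws) = F (us @ x # ws) + F (us @ y # ws) \<and>
        F (us @ smul G a x # ws) = smul H a (F (us @ x # ws)))"

definition has_degree ::
  "('k, 'v) gspace \<Rightarrow> ('k, 'w) gspace \<Rightarrow> nat \<Rightarrow> int \<Rightarrow> ('v list \<Rightarrow> 'w) \<Rightarrow> bool" where
  "has_degree G H k \<delta> F \<longleftrightarrow>
     (\<forall>ds vs. length vs = k \<longrightarrow> list_all2 (\<lambda>d v. v \<in> hcomp G d) ds vs \<longrightarrow>
        F vs \<in> hcomp H (sum_list ds + \<delta>))"

definition skew_sym ::
  "('k::field, 'v::ab_group_add) gspace \<Rightarrow> nat \<Rightarrow> ('v list \<Rightarrow> 'w::ab_group_add) \<Rightarrow> bool" where
  "skew_sym G k F \<longleftrightarrow>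
     (\<forall>us ws x y d d'. us @ [x, y] @ ws \<in> tuples G k \<longrightarrow> x \<in> hcomp G d \<longrightarrow> y \<in> hcomp G d' \<longrightarrow>
        F (us @ [y, x] @ ws) = - sg (d * d') (F (us @ [x, y] @ ws)))"

definition graded_sym ::
  "('k::field, 'v::ab_group_add) gspace \<Rightarrow> nat \<Rightarrow> ('v list \<Rightarrow> 'w::ab_group_add) \<Rightarrow> bool" where
  "graded_sym G k F \<longleftrightarrow>
     (\<forall>us ws x y d d'. us @ [x, y] @ ws \<in> tuples G k \<longrightarrow> x \<in> hcomp G d \<longrightarrow> y \<in> hcomp G d' \<longrightarrow>
        F (us @ [y, x] @ ws) = sg (d * d') (F (us @ [x, y] @ ws)))"

definition cyclic ::
  "('k::field, 'v::ab_group_add) gspace \<Rightarrow> nat \<Rightarrow> ('v list \<Rightarrow> 'w::ab_group_add) \<Rightarrow> bool" where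
  "cyclic G n F \<longleftrightarrow>
     (\<forall>ds vs d v. length vs + 1 = n \<longrightarrow> list_all2 (\<lambda>d v. v \<in> hcomp G d) ds vs \<longrightarrow> v \<in> hcomp G d \<longrightarrow>
        F (v # vs) = sg (d * sum_list ds) (F (vs @ [v])))"

text \<open>Parity of the permutation of odd letters turning \<open>v\<^sub>0 \<dots> v\<^sub>n\<close> into \<open>v\<^bsub>\<sigma> 0\<^esub> \<dots> v\<^bsub>\<sigma> n\<^esub>\<close>.\<close>

definition koszul :: "(nat \<Rightarrow> nat) \<Rightarrow> int list \<Rightarrow> int" where
  "koszul \<sigma> ds = (\<Sum>(i, j) | i < j \<and> j < length ds \<and> \<sigma> j < \<sigma> i. ds ! \<sigma> i * ds ! \<sigma> j)"

text \<open>No division by \<open>n!\<close>; the signs are those of the degrees in \<open>G\<close>.\<close>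

definition symmetrize ::
  "('k, 'v::ab_group_add) gspace \<Rightarrow> ('v list \<Rightarrow> 'w::ab_group_add) \<Rightarrow> 'v list \<Rightarrow> 'w" where
  "symmetrize G F =
     multihom G (\<lambda>ds us. \<Sum>\<sigma> | \<sigma> permutes {..<length us}. sg (koszul \<sigma> ds) (F (permute_list \<sigma> us)))"

definition cyclize ::
  "('k, 'v::ab_group_add) gspace \<Rightarrow> ('v list \<Rightarrow> 'w::ab_group_add) \<Rightarrow> 'v list \<Rightarrow> 'w" where
  "cyclize G F =
     multihom G (\<lambda>ds us. \<Sum>r<length us.
       sg (sum_list (take r ds) * sum_list (drop r ds)) (F (rotate r us)))"

text \<open>
  \<open>Q(x\<^sub>1,\<dots>,x\<^sub>k) = (-1)^(\<Sum>\<^sub>j (k - j) deg x\<^sub>j) q(x\<^sub>1,\<dots>,x\<^sub>k)\<close>, with \<open>deg\<close> the degree in \<open>G[1]\<close>. The same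
  formula turns \<open>Q\<close> back into \<open>q\<close>, and for \<open>k = 2\<close> it turns a bilinear form \<open>b\<close> into \<open>B\<close>.
\<close>

definition shift_map ::
  "('k, 'v::ab_group_add) gspace \<Rightarrow> ('v list \<Rightarrow> 'w::ab_group_add) \<Rightarrow> 'v list \<Rightarrow> 'w" where
  "shift_map G q =
     multihom (gshift G) (\<lambda>ds us. sg (\<Sum>j<length us. int (length us - (j + 1)) * ds ! j) (q us))"

section \<open>Graded Lie algebras and modules\<close>

definition lie_algebra :: "('k::field, 'v::ab_group_add) gspace \<Rightarrow> ('v list \<Rightarrow> 'v) \<Rightarrow> bool" where
  "lie_algebra V q \<longleftrightarrow>
     multilinear V V 2 q \<and> has_degree V V 2 0 q \<and> skew_sym V 2 q \<and>
     (\<forall>x y z d d'. x \<in> hcomp V d \<longrightarrow> y \<in> hcomp V d' \<longrightarrow>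
        q [x, q [y, z]] = q [q [x, y], z] + sg (d * d') (q [y, q [x, z]]))"

definition lie_module ::
  "('k::field, 'v::ab_group_add) gspace \<Rightarrow> ('v list \<Rightarrow> 'v) \<Rightarrow> ('k, 'm::ab_group_add) gspace
    \<Rightarrow> ('v \<Rightarrow> 'm \<Rightarrow> 'm) \<Rightarrow> bool" where
  "lie_module V q M act \<longleftrightarrow>
     (\<forall>x. Vector_Spaces.linear (smul M) (smul M) (act x)) \<and>
     (\<forall>a. Vector_Spaces.linear (smul V) (smul M) (\<lambda>x. act x a)) \<and>
     (\<forall>x a d d'. x \<in> hcomp V d \<longrightarrow> a \<in> hcomp M d' \<longrightarrow> act x a \<in> hcomp M (d + d')) \<and>
     (\<forall>x y a d d'. x \<in> hcomp V d \<longrightarrow> y \<in> hcomp V d' \<longrightarrow>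
        act (q [x, y]) a = act x (act y a) - sg (d * d') (act y (act x a)))"

section \<open>The double semidirect product\<close>

definition semidirect_bracket ::
  "('k, 'v::ab_group_add) gspace \<Rightarrow> ('k, 'm::ab_group_add) gspace \<Rightarrow> ('v list \<Rightarrow> 'v)
    \<Rightarrow> ('v \<Rightarrow> 'm \<Rightarrow> 'm) \<Rightarrow> ('v \<times> 'm) list \<Rightarrow> 'v \<times> 'm" where
  "semidirect_bracket V M q act =
     multihom (gsum V M) (\<lambda>ds ws.
       let (x, a) = ws ! 0; (y, b) = ws ! 1
       in (q [x, y], act x b - sg (ds ! 0 * ds ! 1) (act y a)))"

text \<open>
  The action \<open>(w \<cdot> f)(w') = - f(q\<^sub>W(w, w'))\<close> of \<open>w\<close> of degree \<open>d\<close> on \<open>f = (g, h)\<close> of degree \<open>d'\<close>.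
  The two components of the result are \<open>x \<cdot> g + a \<cdot> h\<close> and \<open>x \<cdot> h\<close>.
\<close>

definition dual_act ::
  "('k::field, 'v::ab_group_add) gspace \<Rightarrow> ('k, 'm::ab_group_add) gspace \<Rightarrow> ('v list \<Rightarrow> 'v)
    \<Rightarrow> ('v \<Rightarrow> 'm \<Rightarrow> 'm) \<Rightarrow> int \<Rightarrow> 'v \<times> 'm \<Rightarrow> int \<Rightarrow> ('v \<Rightarrow> 'k) \<times> ('m \<Rightarrow> 'k) \<Rightarrow> ('v \<Rightarrow> 'k) \<times> ('m \<Rightarrow> 'k)" where
  "dual_act V M q act d w d' f =
     (let ev = (\<lambda>w'. fst f (fst w') + snd f (snd w'));
          wf = (\<lambda>w'. - sg (d * d') (ev (semidirect_bracket V M q act [w, w'])))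
      in (\<lambda>y. wf (y, 0), \<lambda>b. wf (0, b)))"

type_synonym ('k, 'v, 'm) double = "'v \<times> 'm \<times> ('v \<Rightarrow> 'k) \<times> ('m \<Rightarrow> 'k)"

definition double_space ::
  "('k::field, 'v::ab_group_add) gspace \<Rightarrow> ('k, 'm::ab_group_add) gspace
    \<Rightarrow> ('k, ('k, 'v, 'm) double) gspace" where
  "double_space V M = gsum V (gsum M (gsum (gdual V) (gdual M)))"

abbreviation shifted_double ::
  "('k::field, 'v::ab_group_add) gspace \<Rightarrow> ('k, 'm::ab_group_add) gspace
    \<Rightarrow> ('k, ('k, 'v, 'm) double) gspace" where
  "shifted_double V M \<equiv> gshift (double_space V M)"

definition double_bracket ::
  "('k::field, 'v::ab_group_add) gspace \<Rightarrow> ('k, 'm::ab_group_add) gspace \<Rightarrow> ('v list \<Rightarrow> 'v)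
    \<Rightarrow> ('v \<Rightarrow> 'm \<Rightarrow> 'm) \<Rightarrow> ('k, 'v, 'm) double list \<Rightarrow> ('k, 'v, 'm) double" where
  "double_bracket V M q act =
     multihom (double_space V M) (\<lambda>ds us.
       let d = ds ! 0; d' = ds ! 1;
           (x, a, g, h) = us ! 0; (x', a', g', h') = us ! 1;
           (g1, h1) = dual_act V M q act d (x, a) d' (g', h');
           (g2, h2) = dual_act V M q act d' (x', a') d (g, h)
       in (q [x, x'],
           act x a' - sg (d * d') (act x' a),
           g1 - sg (d * d') g2,
           h1 - sg (d * d') h2))"

definition double_form ::
  "('k::field, 'v::ab_group_add) gspace \<Rightarrow> ('k, 'm::ab_group_add) gspace
    \<Rightarrow> ('k, 'v, 'm) double list \<Rightarrow> 'k" where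
  "double_form V M =
     multihom (double_space V M) (\<lambda>ds us.
       let (x, a, g, h) = us ! 0; (x', a', g', h') = us ! 1
       in g x' + h a' + sg (ds ! 0 * ds ! 1) (g' x + h' a))"

definition Omega ::
  "('k::field, 'v::ab_group_add) gspace \<Rightarrow> ('k, 'm::ab_group_add) gspace
    \<Rightarrow> (('k, 'v, 'm) double list \<Rightarrow> ('k, 'v, 'm) double) \<Rightarrow> ('k, 'v, 'm) double list \<Rightarrow> 'k" where
  "Omega V M F vs = shift_map (double_space V M) (double_form V M) [F (butlast vs), last vs]"

text \<open>
  Sign in \<open>C\<^sub>j\<close>: as \<open>h\<^sub>j\<close> and the value of \<open>C\<^sub>j\<close> are here elements of the shifted double, the Koszul
  rule is applied to the relation, all of whose letters live there,
  \<open>B(C\<^sub>j(x\<^sub>1,\<dots>,h\<^sub>j,\<dots>,x\<^sub>k), y) = B(C(x\<^bsub>j+1\<^esub>,\<dots>,x\<^sub>k,y,x\<^sub>1,\<dots>,x\<^bsub>j-1\<^esub>), h\<^sub>j)\<close>.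
  The left side is \<open>(-1)^(deg y) C\<^sub>j(\<dots>)(y)\<close>, the right side is \<open>- h\<^sub>j(C(\<dots>,y,\<dots>))\<close> times the sign of the
  permutation. This is the only choice for which the form of \<open>C~\<close> is cyclic.
\<close>

definition tilde ::
  "('k::field, 'v::ab_group_add) gspace \<Rightarrow> ('k, 'm::ab_group_add) gspace \<Rightarrow> ('v list \<Rightarrow> 'm)
    \<Rightarrow> ('k, 'v, 'm) double list \<Rightarrow> ('k, 'v, 'm) double" where
  "tilde V M C =
     multihom (shifted_double V M) (\<lambda>ds us.
       let xs = map (\<lambda>(x, a, g, h). x) us;
           hs = map (\<lambda>(x, a, g, h). h) us
       in (0,
           C xs,
           (\<lambda>y. \<Sum>j<length us. multihom (gshift V) (\<lambda>es ys.
              let deg_y = hd es; before = sum_list (take j ds); after = sum_list (drop (j + 1) ds)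
              in sg (1 + deg_y + (before + ds ! j) * (after + deg_y))
                    ((hs ! j) (C (drop (j + 1) xs @ ys @ take j xs)))) [y]),
           0))"

definition Omega_cochain ::
  "('k::field, 'v::ab_group_add) gspace \<Rightarrow> ('k, 'm::ab_group_add) gspace \<Rightarrow> ('v list \<Rightarrow> 'm)
    \<Rightarrow> ('k, 'v, 'm) double list \<Rightarrow> 'k" where
  "Omega_cochain V M c = Omega V M (tilde V M (shift_map V c))"

definition Omega_bracket ::
  "('k::field, 'v::ab_group_add) gspace \<Rightarrow> ('k, 'm::ab_group_add) gspace \<Rightarrow> ('v list \<Rightarrow> 'v)
    \<Rightarrow> ('v \<Rightarrow> 'm \<Rightarrow> 'm) \<Rightarrow> ('k, 'v, 'm) double list \<Rightarrow> 'k" where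
  "Omega_bracket V M q act =
     Omega V M (shift_map (double_space V M) (double_bracket V M q act))"

section \<open>Chevalley cochains\<close>

text \<open>
  The Chevalley coboundary preserves the degree \<open>\<delta>\<close> and raises the arity \<open>k\<close>, so the complex has to
  contain cochains of all arities for a given \<open>\<delta>\<close>, not only of arity \<open>2 - \<delta>\<close>.
\<close>

definition cochains ::
  "('k::field, 'v::ab_group_add) gspace \<Rightarrow> ('k, 'm::ab_group_add) gspace \<Rightarrow> nat \<Rightarrow> int
    \<Rightarrow> ('v list \<Rightarrow> 'm) set" where
  "cochains V M k \<delta> = {c. multilinear V M k c \<and> skew_sym V k c \<and> has_degree V M k \<delta> c}"

text \<open>\<open>p\<close> is the degree of \<open>C\<close>, with which the odd letters \<open>Q\<close> and \<open>x\<^sub>1\<close> are commuted.\<close>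

definition Q_commutator ::
  "('k::field, 'v::ab_group_add) gspace \<Rightarrow> ('k, 'm::ab_group_add) gspace \<Rightarrow> ('v list \<Rightarrow> 'v)
    \<Rightarrow> ('v \<Rightarrow> 'm \<Rightarrow> 'm) \<Rightarrow> nat \<Rightarrow> int \<Rightarrow> ('v list \<Rightarrow> 'm) \<Rightarrow> 'v list \<Rightarrow> 'm" where
  "Q_commutator V M q act k p C =
     (let Q = shift_map V q;
          Q_W = shift_map (gsum V M) (semidirect_bracket V M q act)
      in multihom (gshift V) (\<lambda>ds xs.
           snd (Q_W [(0, C (take k xs)), (xs ! k, 0)])
         + sg (p * ds ! 0) (snd (Q_W [(xs ! 0, 0), (0, C (drop 1 xs))]))
         - (\<Sum>j<k. sg (p + sum_list (take j ds))
                     (C (take j xs @ [Q [xs ! j, xs ! (j + 1)]] @ drop (j + 2) xs)))))"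

text \<open>\<open>(d c)[1] = [Q, C]^Sym\<close>; the outer \<open>shift_map\<close> undoes the shift \<open>[1]\<close>.\<close>

definition chevalley_d ::
  "('k::field, 'v::ab_group_add) gspace \<Rightarrow> ('k, 'm::ab_group_add) gspace \<Rightarrow> ('v list \<Rightarrow> 'v)
    \<Rightarrow> ('v \<Rightarrow> 'm \<Rightarrow> 'm) \<Rightarrow> nat \<Rightarrow> int \<Rightarrow> ('v list \<Rightarrow> 'm) \<Rightarrow> 'v list \<Rightarrow> 'm" where
  "chevalley_d V M q act k \<delta> c =
     shift_map V (symmetrize (gshift V)
       (Q_commutator V M q act k (\<delta> + int k - 1) (shift_map V c)))"

section \<open>Pinczon bracket\<close>

definition cyclic_forms ::
  "('k::field, 'v::ab_group_add) gspace \<Rightarrow> nat \<Rightarrow> ('v list \<Rightarrow> 'k) set" where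
  "cyclic_forms G n = {\<Omega>. multilinear G ground n \<Omega> \<and> cyclic G n \<Omega>}"

definition symmetric_forms ::
  "('k::field, 'v::ab_group_add) gspace \<Rightarrow> nat \<Rightarrow> ('v list \<Rightarrow> 'k) set" where
  "symmetric_forms G n = {\<Omega>. multilinear G ground n \<Omega> \<and> graded_sym G n \<Omega>}"

text \<open>The quotient of the cyclic forms by restriction to symmetric tensors.\<close>

definition restricted_forms ::
  "('k::field, 'v::ab_group_add) gspace \<Rightarrow> nat \<Rightarrow> ('v list \<Rightarrow> 'k) set" where
  "restricted_forms G n =
     {\<Omega>. \<exists>\<Omega>'\<in>cyclic_forms G n. \<forall>vs\<in>tuples G n. \<Omega> vs = symmetrize G \<Omega>' vs}"

definition dual_bases ::
  "('k::field, 'v::ab_group_add) gspace \<Rightarrow> ('v list \<Rightarrow> 'k) \<Rightarrow> nat \<Rightarrow> (nat \<Rightarrow> 'v) \<Rightarrow> (nat \<Rightarrow> 'v) \<Rightarrow> bool" where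
  "dual_bases G b N e e' \<longleftrightarrow>
     (\<forall>f\<in>{e, e'}. inj_on f {..<N} \<and> \<not> module.dependent (smul G) (f ` {..<N}) \<and>
        module.span (smul G) (f ` {..<N}) = gcarrier G) \<and>
     (\<forall>i<N. \<forall>j<N. b [e i, e' j] = (if i = j then 1 else 0))"

text \<open>
  \<open>\<iota>\<^sub>u \<Omega> \<otimes> \<iota>\<^bsub>u'\<^esub> \<Omega>'\<close> for a form \<open>\<Omega>\<close> in \<open>k + 1\<close> variables. The Koszul sign is that of the permutation
  \<open>\<Omega> \<Omega>' u u' v\<^sub>1 \<dots> v\<^sub>n \<mapsto> \<Omega> u v\<^sub>1 \<dots> v\<^sub>k \<Omega>' u' v\<^bsub>k+1\<^esub> \<dots> v\<^sub>n\<close>. The letter \<open>\<Omega>'\<close> counts with the total degree of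
  its arguments, which is its own parity wherever it does not vanish.
\<close>

definition insert_tensor ::
  "('k::field, 'v::ab_group_add) gspace \<Rightarrow> nat \<Rightarrow> 'v \<Rightarrow> 'v \<Rightarrow> ('v list \<Rightarrow> 'k) \<Rightarrow> ('v list \<Rightarrow> 'k)
    \<Rightarrow> 'v list \<Rightarrow> 'k" where
  "insert_tensor G k u u' \<Omega> \<Omega>' vs =
     multihom G (\<lambda>ds us.
       let du = ds ! 0; du' = ds ! 1;
           left = sum_list (take k (drop 2 ds)); right = sum_list (drop k (drop 2 ds))
       in sg ((du' + right) * (du + left) + du' * left)
             (\<Omega> (us ! 0 # take k (drop 2 us)) * \<Omega>' (us ! 1 # drop k (drop 2 us))))
     ([u, u'] @ vs)"

definition pinczon ::
  "('k::field, 'v::ab_group_add) gspace \<Rightarrow> nat \<Rightarrow> (nat \<Rightarrow> 'v) \<Rightarrow> (nat \<Rightarrow> 'v) \<Rightarrow> nat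
    \<Rightarrow> ('v list \<Rightarrow> 'k) \<Rightarrow> ('v list \<Rightarrow> 'k) \<Rightarrow> 'v list \<Rightarrow> 'k" where
  "pinczon G N e e' k \<Omega> \<Omega>' vs = (\<Sum>i<N. cyclize G (insert_tensor G k (e i) (e' i) \<Omega> \<Omega>') vs)"

text \<open>
  The bracket of symmetric forms is the symmetrization of their Pinczon bracket as cyclic forms,
  that is \<open>(k + k') \<Sum>\<^sub>i \<iota>\<^bsub>e\<^sub>i\<^esub>\<Omega> \<cdot> \<iota>\<^bsub>e'\<^sub>i\<^esub>\<Omega>'\<close> with \<open>\<alpha> \<cdot> \<beta> = (\<alpha> \<otimes> \<beta>)^Sym\<close>.
\<close>

definition pinczon_sym ::
  "('k::field, 'v::ab_group_add) gspace \<Rightarrow> nat \<Rightarrow> (nat \<Rightarrow> 'v) \<Rightarrow> (nat \<Rightarrow> 'v) \<Rightarrow> nat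
    \<Rightarrow> ('v list \<Rightarrow> 'k) \<Rightarrow> ('v list \<Rightarrow> 'k) \<Rightarrow> 'v list \<Rightarrow> 'k" where
  "pinczon_sym G N e e' k \<Omega> \<Omega>' = symmetrize G (pinczon G N e e' k \<Omega> \<Omega>')"

definition pinczon_d ::
  "('k::field, 'v::ab_group_add) gspace \<Rightarrow> ('k, 'm::ab_group_add) gspace \<Rightarrow> ('v list \<Rightarrow> 'v)
    \<Rightarrow> ('v \<Rightarrow> 'm \<Rightarrow> 'm) \<Rightarrow> nat \<Rightarrow> (nat \<Rightarrow> ('k, 'v, 'm) double) \<Rightarrow> (nat \<Rightarrow> ('k, 'v, 'm) double)
    \<Rightarrow> (('k, 'v, 'm) double list \<Rightarrow> 'k) \<Rightarrow> ('k, 'v, 'm) double list \<Rightarrow> 'k" where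
  "pinczon_d V M q act N e e' \<Omega> =
     pinczon_sym (shifted_double V M) N e e' 2 (Omega_bracket V M q act) \<Omega>"

end

theory Submission
  imports Defs
begin

text \<open>
  On homogeneous arguments \<open>\<Omega>\<^bsub>C~\<^esub>\<close> is the cyclic sum of the pairing
  \<open>(v\<^sub>1,\<dots>,v\<^bsub>k+1\<^esub>) \<mapsto> - h\<^bsub>k+1\<^esub>(C(x\<^sub>1,\<dots>,x\<^sub>k))\<close>. Since every permutation is a rotation times a
  permutation fixing the last letter, \<open>\<Omega>\<close> of \<open>[Q, C]^Sym\<close> is the full symmetrization of the pairing
  with \<open>[Q, C]\<close>. On the other side, invariance of the form gives
  \<open>\<Omega>\<^bsub>Q~\<^esub>(e, v\<^sub>1, v\<^sub>2) = - b(e, Q~(v\<^sub>1, v\<^sub>2))\<close>, so summing over dual bases inserts \<open>Q~(v\<^sub>1, v\<^sub>2)\<close> into the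
  first slot of \<open>\<Omega>\<^bsub>C~\<^esub>\<close>. Up to permutations of the arguments, both sides consist of the same two
  kinds of terms, \<open>h(x\<cdot>C(\<dots>))\<close> occurring twice and \<open>h(C(Q(x, y), \<dots>))\<close> occurring \<open>k\<close> times; the
  degree of \<open>C\<close> enters the signs only where these terms do not vanish.
\<close>

section \<open>Signs and permutations of graded letters\<close>

text \<open>Where the factors come from: a cyclic sum over \<open>k + 2\<close> letters multiplies a
  full symmetrization by \<open>k + 2\<close>, so \<open>pinczon_d\<close> sends the form of
  \<open>c\<close> to \<open>k + 2\<close> times the form of its coboundary. The map that commutes
  without a factor sends \<open>c\<close> to the restriction of its form to symmetric tensors. As no
  division takes place in \<open>symmetrize\<close>, restriction multiplies a symmetric form in
  \<open>n\<close> variables by \<open>n!\<close>, and the factors match. The obstacle is the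
  bookkeeping of signs. A degree cannot be read off a vector, because zero is homogeneous of every
  degree, and the dual bases need not be homogeneous. Identities are therefore proved on lists of
  pairs of a degree and a vector of that degree, and multilinearity carries them to arbitrary
  arguments. There, every comparison of signs rests on two facts: the Koszul sign is multiplicative,
  and moving one block of letters past another costs the product of their total degrees.
  Characteristic zero enters where \<open>k!\<close> is cancelled to see that the form of a cochain
  is symmetric.\<close>

lemma sg_cong: "(even n \<longleftrightarrow> even m) \<Longrightarrow> sg n w = sg m w"
  by (simp add: sg_def)

lemma sg_0 [simp]: "sg 0 w = w"
  by (simp add: sg_def)

lemma sg_zero [simp]: "sg n 0 = 0"
  by (simp add: sg_def)

lemma sg_sg: "sg n (sg m w) = sg (n + m) w"
  by (simp add: sg_def)

lemma sg_add: "sg n (v + w) = sg n v + sg n w"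
  by (simp add: sg_def)

lemma sg_minus: "sg n (- w) = - sg n w"
  by (simp add: sg_def)

lemma sg_succ: "sg (1 + n) w = - sg n w"
  by (simp add: sg_def)

lemma sg_sum: "sg n (sum f A) = (\<Sum>x\<in>A. sg n (f x))"
  by (simp add: sg_def sum_negf)

lemma sg_mult_right: "a * sg n b = sg n (a * b :: 'a::ring)"
  by (simp add: sg_def)

lemma sg_Pair: "sg n (v, w) = (sg n v, sg n w)"
  by (simp add: sg_def uminus_prod_def)

abbreviation degs :: "(int \<times> 'v) list \<Rightarrow> int list" where
  "degs zs \<equiv> map fst zs"

abbreviation vecs :: "(int \<times> 'v) list \<Rightarrow> 'v list" where
  "vecs zs \<equiv> map snd zs"

abbreviation tdeg :: "(int \<times> 'v) list \<Rightarrow> int" where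
  "tdeg zs \<equiv> sum_list (degs zs)"

section \<open>Inversions and multiplicativity of the Koszul sign\<close>

lemma permutes_lessThan_iff:
  "\<sigma> permutes {..<n} \<Longrightarrow> \<sigma> i < n \<longleftrightarrow> i < n"
  using permutes_in_image[of \<sigma> "{..<n}" i] by simp

text \<open>A permutation does not preserve the triangle \<open>i < j\<close>, but it preserves the
  square without its diagonal, and for symmetric \<open>g\<close> the sum over that square is twice
  the sum over the triangle.\<close>

lemma sum_triangle_permute:
  fixes g :: "nat \<Rightarrow> nat \<Rightarrow> int"
  assumes \<tau>: "\<tau> permutes {..<n}" and sym: "\<And>i j. g i j = g j i"
  shows "(\<Sum>(i, j) | i < j \<and> j < n. g (\<tau> i) (\<tau> j)) = (\<Sum>(i, j) | i < j \<and> j < n. g i j)"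
proof -
  have double: "2 * (\<Sum>(i, j) | i < j \<and> j < n. h i j) = (\<Sum>(i, j) | i \<noteq> j \<and> i < n \<and> j < n. h i j)"
    if h: "\<And>i j. h i j = h j i" for h :: "nat \<Rightarrow> nat \<Rightarrow> int"
  proof -
    have fin: "finite {(i, j). i < j \<and> j < n}" "finite {(i, j). j < i \<and> i < n}"
      by (rule finite_subset[of _ "{..<n} \<times> {..<n}"]; auto)+
    have "{(i, j). i \<noteq> j \<and> i < n \<and> j < n} = {(i, j). i < j \<and> j < n} \<union> {(i, j). j < i \<and> i < n}"
      by auto
    then have "(\<Sum>(i, j) | i \<noteq> j \<and> i < n \<and> j < n. h i j)
        = (\<Sum>(i, j) | i < j \<and> j < n. h i j) + (\<Sum>(i, j) | j < i \<and> i < n. h i j)"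
      using fin by (simp add: sum.union_disjoint disjoint_iff)
    moreover have "(\<Sum>(i, j) | j < i \<and> i < n. h i j) = (\<Sum>(i, j) | i < j \<and> j < n. h i j)"
      by (rule sum.reindex_bij_witness[of _ "\<lambda>(i, j). (j, i)" "\<lambda>(i, j). (j, i)"]) (auto simp: h)
    ultimately show ?thesis by simp
  qed
  have inj: "\<tau> i = \<tau> j \<longleftrightarrow> i = j" for i j
    using permutes_inj[OF \<tau>] by (auto dest: injD)
  have inv: "\<tau> (inv \<tau> i) = i" "inv \<tau> (\<tau> i) = i" for i
    using permutes_inverses[OF \<tau>] by auto
  have inj': "inv \<tau> i = inv \<tau> j \<longleftrightarrow> i = j" for i j
    by (metis inv(1))
  have "(\<Sum>(i, j) | i \<noteq> j \<and> i < n \<and> j < n. g (\<tau> i) (\<tau> j))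
      = (\<Sum>(i, j) | i \<noteq> j \<and> i < n \<and> j < n. g i j)"
    by (rule sum.reindex_bij_witness[of _ "\<lambda>(i, j). (inv \<tau> i, inv \<tau> j)" "\<lambda>(i, j). (\<tau> i, \<tau> j)"])
      (auto simp: inv inj inj' permutes_lessThan_iff[OF \<tau>] permutes_lessThan_iff[OF permutes_inv[OF \<tau>]])
  then have "2 * (\<Sum>(i, j) | i < j \<and> j < n. g (\<tau> i) (\<tau> j)) = 2 * (\<Sum>(i, j) | i < j \<and> j < n. g i j)"
    by (subst (1 2) double) (simp_all add: sym)
  then show ?thesis by simp
qed

text \<open>Moving the inversion condition into the summand gives all Koszul exponents the same
  index set, so that they can be added and subtracted term by term.\<close>

lemma koszul_eq:
  "koszul \<sigma> ds = (\<Sum>(i, j) | i < j \<and> j < length ds. if \<sigma> j < \<sigma> i then ds ! \<sigma> i * ds ! \<sigma> j else 0)"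
proof -
  have "finite {(i, j). i < j \<and> j < length ds}"
    by (rule finite_subset[of _ "{..<length ds} \<times> {..<length ds}"]) auto
  then show ?thesis
    unfolding koszul_def by (intro sum.mono_neutral_cong_left) (auto split: if_splits)
qed

text \<open>Cocycle property of the Koszul sign. Only the parity is additive: a pair inverted by
  both permutations counts twice on the right and not at all on the left.\<close>

lemma koszul_comp:
  assumes \<sigma>: "\<sigma> permutes {..<length ds}" and \<tau>: "\<tau> permutes {..<length ds}"
  shows "even (koszul (\<sigma> \<circ> \<tau>) ds) \<longleftrightarrow> even (koszul \<sigma> ds + koszul \<tau> (permute_list \<sigma> ds))"
proof -
  let ?n = "length ds"
  \<comment> \<open>\<open>g\<close> is the weight of an inversion of \<open>\<sigma>\<close> as a
    function of the unordered pair; being symmetric, it can be reindexed along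
    \<open>\<tau>\<close>.\<close>
  define g where
    "g i j = (if (i < j \<and> \<sigma> j < \<sigma> i) \<or> (j < i \<and> \<sigma> i < \<sigma> j) then ds ! \<sigma> i * ds ! \<sigma> j else 0)" for i j
  have "koszul \<sigma> ds = (\<Sum>(i, j) | i < j \<and> j < ?n. g i j)"
    unfolding koszul_eq by (rule sum.cong) (auto simp: g_def)
  also have "\<dots> = (\<Sum>(i, j) | i < j \<and> j < ?n. g (\<tau> i) (\<tau> j))"
    by (rule sum_triangle_permute[OF \<tau>, symmetric]) (auto simp: g_def mult.commute)
  finally have 1: "koszul \<sigma> ds = (\<Sum>(i, j) | i < j \<and> j < ?n. g (\<tau> i) (\<tau> j))" .
  have 2: "koszul \<tau> (permute_list \<sigma> ds)
      = (\<Sum>(i, j) | i < j \<and> j < ?n. if \<tau> j < \<tau> i then ds ! \<sigma> (\<tau> i) * ds ! \<sigma> (\<tau> j) else 0)"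
    unfolding koszul_eq length_permute_list
    by (rule sum.cong) (auto simp: permute_list_nth[OF \<sigma>] permutes_lessThan_iff[OF \<tau>])
  have inj: "\<sigma> i = \<sigma> j \<longleftrightarrow> i = j" "\<tau> i = \<tau> j \<longleftrightarrow> i = j" for i j
    using permutes_inj[OF \<sigma>] permutes_inj[OF \<tau>] by (auto dest: injD)
  have "even (koszul \<sigma> ds + koszul \<tau> (permute_list \<sigma> ds) - koszul (\<sigma> \<circ> \<tau>) ds)"
    unfolding 1 2 koszul_eq[of "\<sigma> \<circ> \<tau>"] sum.distrib[symmetric] sum_subtractf[symmetric]
  proof (rule dvd_sum)
    fix x assume "x \<in> {(i, j). i < j \<and> j < ?n}"
    then obtain i j where x: "x = (i, j)" and "i < j" by auto
    then have "\<tau> i \<noteq> \<tau> j" "\<sigma> (\<tau> i) \<noteq> \<sigma> (\<tau> j)" using inj by auto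
    then show "even ((case x of (i, j) \<Rightarrow> g (\<tau> i) (\<tau> j))
        + (case x of (i, j) \<Rightarrow> if \<tau> j < \<tau> i then ds ! \<sigma> (\<tau> i) * ds ! \<sigma> (\<tau> j) else 0)
        - (case x of (i, j) \<Rightarrow> if (\<sigma> \<circ> \<tau>) j < (\<sigma> \<circ> \<tau>) i then ds ! (\<sigma> \<circ> \<tau>) i * ds ! (\<sigma> \<circ> \<tau>) j else 0))"
      by (cases "\<tau> i < \<tau> j"; cases "\<sigma> (\<tau> i) < \<sigma> (\<tau> j)") (auto simp: x g_def)
  qed
  then show ?thesis by simp
qed

lemma koszul_id [simp]: "koszul id ds = 0"
  by (auto simp: koszul_eq intro!: sum.neutral)

section \<open>Swaps of two adjacent blocks\<close>

definition block_swap :: "nat \<Rightarrow> nat \<Rightarrow> nat \<Rightarrow> nat \<Rightarrow> nat" where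
  "block_swap p a b i = (if p \<le> i \<and> i < p + b then i + a
     else if p + b \<le> i \<and> i < p + b + a then i - b else i)"

text \<open>\<open>permute_list \<sigma> xs\<close> has \<open>xs ! \<sigma> i\<close> at place
  \<open>i\<close>, so the \<open>b\<close> places after the prefix have to read the second block,
  which is stored \<open>a\<close> places further on. Thus \<open>a\<close> and \<open>b\<close> are
  the block lengths before the swap. Rotations, adjacent transpositions and moves of a single letter
  are all of this form.\<close>

lemma block_swap_simps:
  "i < p \<Longrightarrow> block_swap p a b i = i"
  "j < b \<Longrightarrow> block_swap p a b (p + j) = p + a + j"
  "j < a \<Longrightarrow> block_swap p a b (p + b + j) = p + j"
  "block_swap p a b (p + b + a + j) = p + b + a + j"
  by (simp_all add: block_swap_def)

lemma block_cases:
  obtains (prefix) "i < (p :: nat)" | (first) j where "i = p + j" "j < b"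
    | (second) j where "i = p + b + j" "j < a" | (suffix) j where "i = p + b + a + j"
proof -
  consider "i < p" | "p \<le> i" "i < p + b" | "p + b \<le> i" "i < p + b + a" | "p + b + a \<le> i"
    by linarith
  then show thesis
  proof cases
    case 2
    then show ?thesis using first[of "i - p"] by simp
  next
    case 3
    then show ?thesis using second[of "i - p - b"] by simp
  next
    case 4
    then show ?thesis using suffix[of "i - p - b - a"] by simp
  qed (rule prefix)
qed

lemma block_swap_inverse: "block_swap p b a (block_swap p a b i) = i"
proof (cases rule: block_cases[where i = i and p = p and b = b and a = a])
  case (suffix j)
  then show ?thesis
    using block_swap_simps(4)[of p a b j] block_swap_simps(4)[of p b a j] by (simp add: ac_simps)
qed (simp_all add: block_swap_simps)

lemma block_swap_less: "p + a + b \<le> n \<Longrightarrow> i < n \<Longrightarrow> block_swap p a b i < n"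
  by (cases rule: block_cases[where i = i and p = p and b = b and a = a]) (simp_all add: block_swap_simps)

lemma block_swap_permutes:
  assumes "p + a + b \<le> n"
  shows "block_swap p a b permutes {..<n}"
proof (rule bij_imp_permutes)
  show "bij_betw (block_swap p a b) {..<n} {..<n}"
    by (rule bij_betw_byWitness[of _ "block_swap p b a"])
      (use assms in \<open>auto simp: block_swap_inverse intro!: block_swap_less\<close>)
qed (use assms in \<open>simp add: block_swap_def\<close>)

lemma permute_list_block_swap:
  assumes "length P = p" "length A = a" "length B = b"
  shows "permute_list (block_swap p a b) (P @ A @ B @ R) = P @ B @ A @ R"
proof (rule nth_equalityI)
  fix i assume i: "i < length (permute_list (block_swap p a b) (P @ A @ B @ R))"
  have "block_swap p a b permutes {..<length (P @ A @ B @ R)}"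
    by (rule block_swap_permutes) (use assms in auto)
  then have "permute_list (block_swap p a b) (P @ A @ B @ R) ! i = (P @ A @ B @ R) ! block_swap p a b i"
    using i by (simp only: permute_list_nth length_permute_list)
  also have "\<dots> = (P @ B @ A @ R) ! i"
    using assms by (cases rule: block_cases[where i = i and p = p and b = b and a = a]) (simp_all add: block_swap_simps nth_append)
  finally show "permute_list (block_swap p a b) (P @ A @ B @ R) ! i = (P @ B @ A @ R) ! i" .
qed (use assms in auto)

text \<open>The order inside each block is kept, so an inversion takes one place from each
  block.\<close>

lemma block_swap_inversion:
  assumes "i < j" "block_swap p a b j < block_swap p a b i"
  shows "p \<le> i \<and> i < p + b \<and> p + b \<le> j \<and> j < p + b + a"
  using assms
  by (cases rule: block_cases[where i = i and p = p and b = b and a = a]; cases rule: block_cases[where i = j and p = p and b = b and a = a])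
    (simp_all add: block_swap_simps)

text \<open>The inverted pairs form the full product of the two blocks, so the exponent factors into
  the two total degrees.\<close>

lemma koszul_block_swap:
  assumes "length P = p" "length A = a" "length B = b"
  shows "koszul (block_swap p a b) (P @ A @ B @ R) = sum_list A * sum_list B"
proof -
  let ?ds = "P @ A @ B @ R"
  let ?h = "\<lambda>(j, i). (p + i, p + b + j)"
  have img: "{(i, j). i < j \<and> j < length ?ds \<and> block_swap p a b j < block_swap p a b i}
      = ?h ` ({..<a} \<times> {..<b})"
  proof (rule set_eqI, clarify)
    fix i j
    have "i < j \<and> j < length ?ds \<and> block_swap p a b j < block_swap p a b i
        \<longleftrightarrow> p \<le> i \<and> i < p + b \<and> p + b \<le> j \<and> j < p + b + a"
      using block_swap_inversion[of i j p a b] assms by (auto simp: block_swap_def)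
    also have "\<dots> \<longleftrightarrow> (i, j) \<in> ?h ` ({..<a} \<times> {..<b})"
    proof
      assume "p \<le> i \<and> i < p + b \<and> p + b \<le> j \<and> j < p + b + a"
      then have "(i, j) = ?h (j - p - b, i - p)" "(j - p - b, i - p) \<in> {..<a} \<times> {..<b}" by auto
      then show "(i, j) \<in> ?h ` ({..<a} \<times> {..<b})" by (rule image_eqI)
    qed auto
    finally show "(i, j) \<in> {(i, j). i < j \<and> j < length ?ds \<and> block_swap p a b j < block_swap p a b i}
        \<longleftrightarrow> (i, j) \<in> ?h ` ({..<a} \<times> {..<b})" by simp
  qed
  have inj: "inj_on ?h ({..<a} \<times> {..<b})"
    by (auto simp: inj_on_def)
  have "koszul (block_swap p a b) ?ds = (\<Sum>(j, i)\<in>{..<a} \<times> {..<b}. A ! j * B ! i)"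
    unfolding koszul_def img sum.reindex[OF inj]
  proof (rule sum.cong[OF refl])
    fix x assume "x \<in> {..<a} \<times> {..<b}"
    then obtain j i where x: "x = (j, i)" and "j < a" "i < b" by auto
    then have "block_swap p a b (p + i) = p + a + i" "block_swap p a b (p + b + j) = p + j"
      "?ds ! (p + a + i) = B ! i" "?ds ! (p + j) = A ! j"
      using assms by (simp_all add: block_swap_def nth_append)
    then show "((\<lambda>(i, j). ?ds ! block_swap p a b i * ?ds ! block_swap p a b j) \<circ> ?h) x
        = (case x of (j, i) \<Rightarrow> A ! j * B ! i)"
      by (simp add: x mult.commute)
  qed
  also have "\<dots> = (\<Sum>j<a. A ! j) * (\<Sum>i<b. B ! i)"
    by (simp add: sum_product sum.cartesian_product)
  finally show ?thesis
    using assms by (simp add: sum_list_sum_nth atLeast0LessThan)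
qed

section \<open>Symmetrization and cyclic sums of functions of graded letters\<close>

definition Sym :: "((int \<times> 'v) list \<Rightarrow> 'w::ab_group_add) \<Rightarrow> (int \<times> 'v) list \<Rightarrow> 'w" where
  "Sym F zs = (\<Sum>\<sigma> | \<sigma> permutes {..<length zs}. sg (koszul \<sigma> (degs zs)) (F (permute_list \<sigma> zs)))"

definition Cyc :: "((int \<times> 'v) list \<Rightarrow> 'w::ab_group_add) \<Rightarrow> (int \<times> 'v) list \<Rightarrow> 'w" where
  "Cyc F zs = (\<Sum>r<length zs. sg (tdeg (take r zs) * tdeg (drop r zs)) (F (rotate r zs)))"

text \<open>A condition at a single list: the maps in question are symmetric only at lists of
  homogeneous letters, so symmetry cannot be demanded everywhere. \<open>Sym\<close> and
  \<open>Cyc\<close> likewise take the degrees from the letters and project nothing.\<close>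

definition Symmetric :: "((int \<times> 'v) list \<Rightarrow> 'w::ab_group_add) \<Rightarrow> (int \<times> 'v) list \<Rightarrow> bool" where
  "Symmetric F zs \<longleftrightarrow>
     (\<forall>\<sigma>. \<sigma> permutes {..<length zs} \<longrightarrow> F (permute_list \<sigma> zs) = sg (koszul \<sigma> (degs zs)) (F zs))"

lemma degs_permute_list:
  "\<sigma> permutes {..<length zs} \<Longrightarrow> degs (permute_list \<sigma> zs) = permute_list \<sigma> (degs zs)"
  by (simp add: permute_list_map)

lemma tdeg_mset: "mset ys = mset zs \<Longrightarrow> tdeg ys = tdeg zs"
  by (metis mset_map sum_mset_sum_list)

lemma Sym_cong:
  assumes "\<And>ys. mset ys = mset zs \<Longrightarrow> F ys = G ys"
  shows "Sym F zs = Sym G zs"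
  unfolding Sym_def by (rule sum.cong) (auto simp: assms)

lemma Sym_sum: "Sym (\<lambda>zs. \<Sum>i\<in>I. F i zs) zs = (\<Sum>i\<in>I. Sym (F i) zs)"
  unfolding Sym_def sg_sum by (rule sum.swap)

lemma Sym_add: "Sym (\<lambda>zs. F zs + G zs) zs = Sym F zs + Sym G zs"
  by (simp add: Sym_def sg_add sum.distrib)

lemma finite_permutes [simp]: "finite {\<sigma>. \<sigma> permutes {..<n::nat}}"
  by (simp add: finite_permutations)

lemma bij_comp_permutes:
  assumes "\<tau> permutes S"
  shows "bij_betw (\<lambda>\<sigma>. \<tau> \<circ> \<sigma>) {\<sigma>. \<sigma> permutes S} {\<sigma>. \<sigma> permutes S}"
    and "bij_betw (\<lambda>\<sigma>. \<sigma> \<circ> \<tau>) {\<sigma>. \<sigma> permutes S} {\<sigma>. \<sigma> permutes S}"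
proof -
  note inv = permutes_inv_o[OF assms] permutes_inv[OF assms]
  show "bij_betw (\<lambda>\<sigma>. \<tau> \<circ> \<sigma>) {\<sigma>. \<sigma> permutes S} {\<sigma>. \<sigma> permutes S}"
    by (rule bij_betw_byWitness[of _ "\<lambda>\<sigma>. inv \<tau> \<circ> \<sigma>"])
      (auto simp: o_assoc inv intro: permutes_compose assms)
  show "bij_betw (\<lambda>\<sigma>. \<sigma> \<circ> \<tau>) {\<sigma>. \<sigma> permutes S} {\<sigma>. \<sigma> permutes S}"
    by (rule bij_betw_byWitness[of _ "\<lambda>\<sigma>. \<sigma> \<circ> inv \<tau>"])
      (auto simp: o_assoc[symmetric] inv intro: permutes_compose assms)
qed

text \<open>Right translation by \<open>\<tau>\<close> is a bijection of the symmetric group, and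
  the cocycle property absorbs the sign. Two functions that differ by a fixed signed rearrangement
  of the letters thus have the same symmetrization.\<close>

lemma Sym_twist:
  assumes \<tau>: "\<tau> permutes {..<length zs}"
  shows "Sym (\<lambda>ys. sg (koszul \<tau> (degs ys)) (F (permute_list \<tau> ys))) zs = Sym F zs"
proof -
  have "Sym (\<lambda>ys. sg (koszul \<tau> (degs ys)) (F (permute_list \<tau> ys))) zs
      = (\<Sum>\<sigma> | \<sigma> permutes {..<length zs}. sg (koszul (\<sigma> \<circ> \<tau>) (degs zs)) (F (permute_list (\<sigma> \<circ> \<tau>) zs)))"
    unfolding Sym_def
  proof (rule sum.cong[OF refl])
    fix \<sigma> assume "\<sigma> \<in> {\<sigma>. \<sigma> permutes {..<length zs}}"
    then have \<sigma>: "\<sigma> permutes {..<length zs}" by simp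
    have k: "even (koszul (\<sigma> \<circ> \<tau>) (degs zs))
        \<longleftrightarrow> even (koszul \<sigma> (degs zs) + koszul \<tau> (permute_list \<sigma> (degs zs)))"
      by (rule koszul_comp) (use \<sigma> \<tau> in simp_all)
    show "sg (koszul \<sigma> (degs zs))
          (sg (koszul \<tau> (degs (permute_list \<sigma> zs))) (F (permute_list \<tau> (permute_list \<sigma> zs))))
        = sg (koszul (\<sigma> \<circ> \<tau>) (degs zs)) (F (permute_list (\<sigma> \<circ> \<tau>) zs))"
      unfolding sg_sg permute_list_compose[OF \<tau>] degs_permute_list[OF \<sigma>]
      by (rule sg_cong[OF k[symmetric]])
  qed
  also have "\<dots> = Sym F zs"
    unfolding Sym_def
    using sum.reindex_bij_betw[OF bij_comp_permutes(2)[OF \<tau>],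
        of "\<lambda>\<sigma>. sg (koszul \<sigma> (degs zs)) (F (permute_list \<sigma> zs))"] by simp
  finally show ?thesis .
qed

text \<open>Left translation by \<open>\<tau>\<close> reindexes the sum, and the cocycle property
  pulls the sign of \<open>\<tau>\<close> out of it.\<close>

lemma Symmetric_Sym: "Symmetric (Sym F) zs"
  unfolding Symmetric_def
proof (intro allI impI)
  fix \<tau> assume \<tau>: "\<tau> permutes {..<length zs}"
  have "Sym F (permute_list \<tau> zs)
      = (\<Sum>\<sigma> | \<sigma> permutes {..<length zs}.
          sg (koszul \<tau> (degs zs)) (sg (koszul (\<tau> \<circ> \<sigma>) (degs zs)) (F (permute_list (\<tau> \<circ> \<sigma>) zs))))"
    unfolding Sym_def length_permute_list
  proof (rule sum.cong[OF refl])
    fix \<sigma> assume "\<sigma> \<in> {\<sigma>. \<sigma> permutes {..<length zs}}"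
    then have \<sigma>: "\<sigma> permutes {..<length zs}" by simp
    have k: "even (koszul (\<tau> \<circ> \<sigma>) (degs zs))
        \<longleftrightarrow> even (koszul \<tau> (degs zs) + koszul \<sigma> (permute_list \<tau> (degs zs)))"
      by (rule koszul_comp) (use \<sigma> \<tau> in simp_all)
    show "sg (koszul \<sigma> (degs (permute_list \<tau> zs))) (F (permute_list \<sigma> (permute_list \<tau> zs)))
        = sg (koszul \<tau> (degs zs)) (sg (koszul (\<tau> \<circ> \<sigma>) (degs zs)) (F (permute_list (\<tau> \<circ> \<sigma>) zs)))"
      unfolding sg_sg permute_list_compose[OF \<sigma>] degs_permute_list[OF \<tau>]
      by (rule sg_cong) (use k in auto)
  qed
  also have "\<dots> = sg (koszul \<tau> (degs zs)) (Sym F zs)"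
    unfolding Sym_def sg_sum[symmetric]
    using sum.reindex_bij_betw[OF bij_comp_permutes(1)[OF \<tau>],
        of "\<lambda>\<sigma>. sg (koszul \<sigma> (degs zs)) (F (permute_list \<sigma> zs))"] by simp
  finally show "Sym F (permute_list \<tau> zs) = sg (koszul \<tau> (degs zs)) (Sym F zs)" .
qed

text \<open>The form in which the terms of the two coboundaries are matched. The hypothesis concerns
  only rearrangements of \<open>zs\<close> cut into blocks of prescribed lengths, so homogeneity of
  the letters is at hand when it is checked.\<close>

lemma Sym_block_swap:
  assumes len: "length zs = p + a + b + c"
    and FG: "\<And>P A B R. mset (P @ A @ B @ R) = mset zs \<Longrightarrow> length P = p \<Longrightarrow> length A = a \<Longrightarrow>
      length B = b \<Longrightarrow> length R = c \<Longrightarrow>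
      F (P @ A @ B @ R) = sg (tdeg A * tdeg B) (G (P @ B @ A @ R))"
  shows "Sym F zs = Sym G zs"
proof -
  let ?\<tau> = "block_swap p a b"
  have \<tau>: "?\<tau> permutes {..<length zs}"
    by (rule block_swap_permutes) (simp add: len)
  have "Sym F zs = Sym (\<lambda>ys. sg (koszul ?\<tau> (degs ys)) (G (permute_list ?\<tau> ys))) zs"
  proof (rule Sym_cong)
    fix ys :: "(int \<times> 'a) list" assume ys: "mset ys = mset zs"
    define P A B R where "P = take p ys" and "A = take a (drop p ys)"
      and "B = take b (drop (p + a) ys)" and "R = drop (p + a + b) ys"
    have n: "length ys = p + a + b + c"
      using ys len by (metis size_mset)
    have split: "ys = P @ A @ B @ R"
      unfolding P_def A_def B_def R_def
      by (metis add.commute append_take_drop_id drop_drop)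
    have l: "length P = p" "length A = a" "length B = b" "length R = c"
      using n by (auto simp: P_def A_def B_def R_def)
    show "F ys = sg (koszul ?\<tau> (degs ys)) (G (permute_list ?\<tau> ys))"
      using FG[OF _ l] ys l
      by (simp add: split permute_list_block_swap koszul_block_swap)
  qed
  also have "\<dots> = Sym G zs"
    by (rule Sym_twist[OF \<tau>])
  finally show ?thesis .
qed

lemma Sym_rotate:
  assumes "r \<le> length zs"
  shows "Sym (\<lambda>ys. sg (tdeg (take r ys) * tdeg (drop r ys)) (F (drop r ys @ take r ys))) zs = Sym F zs"
  by (rule Sym_block_swap[where p = 0 and a = r and b = "length zs - r" and c = 0])
    (use assms in auto)

text \<open>A rotation swaps an initial and a final block, so all summands of the cyclic sum
  symmetrize to the same value. With \<open>k + 2\<close> letters this gives the factor of the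
  bracket of forms.\<close>

lemma Sym_Cyc:
  fixes F :: "(int \<times> 'v) list \<Rightarrow> 'w::comm_ring_1"
  shows "Sym (Cyc F) zs = of_nat (length zs) * Sym F zs"
proof -
  have "Sym (Cyc F) zs
      = Sym (\<lambda>ys. \<Sum>r<length zs. sg (tdeg (take r ys) * tdeg (drop r ys)) (F (drop r ys @ take r ys))) zs"
  proof (rule Sym_cong)
    fix ys :: "(int \<times> 'v) list" assume "mset ys = mset zs"
    then have n: "length ys = length zs" by (metis size_mset)
    show "Cyc F ys
        = (\<Sum>r<length zs. sg (tdeg (take r ys) * tdeg (drop r ys)) (F (drop r ys @ take r ys)))"
      unfolding Cyc_def n by (rule sum.cong) (simp_all add: rotate_drop_take n)
  qed
  then show ?thesis
    by (simp add: Sym_sum Sym_rotate)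
qed

text \<open>The appended letter stays behind all the others and takes part in no inversion.\<close>

lemma koszul_snoc:
  assumes "\<sigma> permutes {..<length ds}"
  shows "koszul \<sigma> (ds @ [d]) = koszul \<sigma> ds"
  unfolding koszul_def
proof (rule sum.mono_neutral_cong_right)
  show "finite {(i, j). i < j \<and> j < length (ds @ [d]) \<and> \<sigma> j < \<sigma> i}"
    by (rule finite_subset[of _ "{..length ds} \<times> {..length ds}"]) auto
next
  show "\<forall>i\<in>{(i, j). i < j \<and> j < length (ds @ [d]) \<and> \<sigma> j < \<sigma> i}
      - {(i, j). i < j \<and> j < length ds \<and> \<sigma> j < \<sigma> i}.
      (case i of (i, j) \<Rightarrow> (ds @ [d]) ! \<sigma> i * (ds @ [d]) ! \<sigma> j) = 0"
  proof
    fix x assume "x \<in> {(i, j). i < j \<and> j < length (ds @ [d]) \<and> \<sigma> j < \<sigma> i}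
      - {(i, j). i < j \<and> j < length ds \<and> \<sigma> j < \<sigma> i}"
    then obtain i j where x: "x = (i, j)" and a: "i < j" "j < Suc (length ds)" "\<sigma> j < \<sigma> i" "\<not> j < length ds"
      by auto
    then have "j = length ds" by simp
    then have "\<sigma> j = length ds" "\<sigma> i < length ds"
      using a permutes_not_in[OF assms, of j] permutes_lessThan_iff[OF assms, of i] by auto
    then show "(case x of (i, j) \<Rightarrow> (ds @ [d]) ! \<sigma> i * (ds @ [d]) ! \<sigma> j) = 0" using a by simp
  qed
qed (auto simp: nth_append permutes_lessThan_iff[OF assms])

lemma permute_list_snoc:
  assumes "\<sigma> permutes {..<length xs}"
  shows "permute_list \<sigma> (xs @ [x]) = permute_list \<sigma> xs @ [x]"
proof -
  have "\<sigma> (length xs) = length xs"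
    by (rule permutes_not_in[OF assms]) simp
  then show ?thesis
    by (auto simp: permute_list_def nth_append permutes_lessThan_iff[OF assms])
qed

text \<open>
  Every permutation is, in exactly one way, a permutation of the first \<open>n\<close> letters followed by a
  rotation of all \<open>n + 1\<close> letters.
\<close>

lemma Cyc_Sym_butlast:
  assumes zs: "zs \<noteq> []"
  shows "Cyc (\<lambda>ys. Sym (\<lambda>xs. F (xs @ [last ys])) (butlast ys)) zs = Sym F zs"
proof -
  obtain n where n: "length zs = Suc n" using zs by (cases zs) auto
  define \<rho> where "\<rho> r = block_swap 0 r (Suc n - r)" for r
  define f where "f \<pi> = sg (koszul \<pi> (degs zs)) (F (permute_list \<pi> zs))" for \<pi>
  have \<rho>: "\<rho> r permutes {..<Suc n}" if "r < Suc n" for r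
    unfolding \<rho>_def by (rule block_swap_permutes) (use that in simp)
  have up: "\<sigma> permutes {..<Suc n}" if "\<sigma> permutes {..<n}" for \<sigma>
    using that by (rule permutes_subset) auto
  have rotz: "permute_list (\<rho> r) zs = rotate r zs" if "r < Suc n" for r
    using permute_list_block_swap[of "[]" 0 "take r zs" r "drop r zs" "Suc n - r" "[]"] that
    by (auto simp: \<rho>_def n rotate_drop_take)
  have step: "sg (tdeg (take r zs) * tdeg (drop r zs)) (Sym (\<lambda>xs. F (xs @ [last (rotate r zs)]))
        (butlast (rotate r zs))) = (\<Sum>\<sigma> | \<sigma> permutes {..<n}. f (\<rho> r \<circ> \<sigma>))" if r: "r < Suc n" for r
  proof -
    let ?ys = "rotate r zs"
    have ys: "?ys = butlast ?ys @ [last ?ys]"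
      by (rule append_butlast_last_id[symmetric]) (use zs in simp)
    have kr: "koszul (\<rho> r) (degs zs) = tdeg (take r zs) * tdeg (drop r zs)"
      using koszul_block_swap[of "[]" 0 "take r (degs zs)" r "drop r (degs zs)" "Suc n - r" "[]"] r
      by (simp add: \<rho>_def n take_map drop_map flip: map_append)
    have "sg (tdeg (take r zs) * tdeg (drop r zs))
        (sg (koszul \<sigma> (degs (butlast ?ys))) (F (permute_list \<sigma> (butlast ?ys) @ [last ?ys]))) = f (\<rho> r \<circ> \<sigma>)"
      if \<sigma>: "\<sigma> permutes {..<n}" for \<sigma>
    proof -
      have "permute_list \<sigma> ?ys = permute_list \<sigma> (butlast ?ys) @ [last ?ys]"
        by (subst ys, rule permute_list_snoc) (use \<sigma> n in simp)
      moreover have "koszul \<sigma> (degs ?ys) = koszul \<sigma> (degs (butlast ?ys))"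
        by (subst ys) (use koszul_snoc[of \<sigma> "degs (butlast ?ys)"] \<sigma> n in simp)
      moreover have "even (koszul (\<rho> r \<circ> \<sigma>) (degs zs))
          \<longleftrightarrow> even (koszul (\<rho> r) (degs zs) + koszul \<sigma> (permute_list (\<rho> r) (degs zs)))"
        by (rule koszul_comp) (use \<rho>[OF r] up[OF \<sigma>] n in auto)
      moreover have "permute_list (\<rho> r) (degs zs) = degs ?ys"
        using \<rho>[OF r] by (simp add: degs_permute_list n flip: rotz[OF r])
      moreover have "permute_list (\<rho> r \<circ> \<sigma>) zs = permute_list \<sigma> ?ys"
        using rotz[OF r] permute_list_compose[of \<sigma> zs "\<rho> r"] up[OF \<sigma>] n by simp
      ultimately show ?thesis
        unfolding f_def sg_sg kr by (auto intro: sg_cong)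
    qed
    then show ?thesis
      unfolding Sym_def sg_sum by (intro sum.cong) (auto simp: n)
  qed
  let ?S = "{..<Suc n} \<times> {\<sigma>. \<sigma> permutes {..<n}}"
  have inj: "inj_on (\<lambda>(r, \<sigma>). \<rho> r \<circ> \<sigma>) ?S"
  proof (rule inj_onI, clarsimp)
    fix r \<sigma> r' \<sigma>' assume a: "r < Suc n" "r' < Suc n" "\<sigma> permutes {..<n}" "\<sigma>' permutes {..<n}"
      and eq: "\<rho> r \<circ> \<sigma> = \<rho> r' \<circ> \<sigma>'"
    \<comment> \<open>Both permutations fix the last place \<open>n\<close>, so its image depends on
      the rotation alone, and this image determines \<open>r\<close>.\<close>
    have "\<sigma> n = n" "\<sigma>' n = n"
      using a by (auto intro: permutes_not_in)
    then have "\<rho> r n = \<rho> r' n"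
      using fun_cong[OF eq, of n] by simp
    moreover have "\<rho> s n = (if s = 0 then n else s - 1)" if "s < Suc n" for s
      using that by (auto simp: \<rho>_def block_swap_def)
    ultimately have r: "r = r'" using a by (auto split: if_splits)
    have "\<rho> r (\<sigma> i) = \<rho> r (\<sigma>' i)" for i
      using fun_cong[OF eq, of i] r by simp
    then have "\<sigma> = \<sigma>'"
      using permutes_inj[OF \<rho>[OF a(1)]] by (auto dest: injD)
    then show "r = r' \<and> \<sigma> = \<sigma>'" using r by simp
  qed
  \<comment> \<open>With injectivity known, counting replaces an explicit factorization:
    \<open>(n + 1) n!\<close> pairs fill the \<open>(n + 1)!\<close> permutations.\<close>
  have img: "(\<lambda>(r, \<sigma>). \<rho> r \<circ> \<sigma>) ` ?S = {\<pi>. \<pi> permutes {..<Suc n}}"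
  proof (rule card_subset_eq)
    show "(\<lambda>(r, \<sigma>). \<rho> r \<circ> \<sigma>) ` ?S \<subseteq> {\<pi>. \<pi> permutes {..<Suc n}}"
      using \<rho> up by (auto intro!: permutes_compose)
    show "card ((\<lambda>(r, \<sigma>). \<rho> r \<circ> \<sigma>) ` ?S) = card {\<pi>. \<pi> permutes {..<Suc n}}"
      by (simp add: card_image[OF inj] card_cartesian_product card_permutations)
  qed simp
  have "Cyc (\<lambda>ys. Sym (\<lambda>xs. F (xs @ [last ys])) (butlast ys)) zs
      = (\<Sum>r<Suc n. \<Sum>\<sigma> | \<sigma> permutes {..<n}. f (\<rho> r \<circ> \<sigma>))"
    unfolding Cyc_def n by (rule sum.cong[OF refl]) (use step in auto)
  also have "\<dots> = (\<Sum>(r, \<sigma>)\<in>?S. f (\<rho> r \<circ> \<sigma>))"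
    by (rule sum.cartesian_product)
  also have "\<dots> = (\<Sum>\<pi> | \<pi> permutes {..<Suc n}. f \<pi>)"
    using sum.reindex[OF inj, of f, unfolded img] by (simp add: comp_def case_prod_unfold)
  finally show ?thesis
    by (simp add: Sym_def f_def n)
qed

text \<open>The sign of each permutation cancels against the sign by which \<open>F\<close> changes,
  so all summands equal \<open>F zs\<close>.\<close>

lemma Sym_Symmetric:
  fixes F :: "(int \<times> 'v) list \<Rightarrow> 'w::comm_ring_1"
  assumes "Symmetric F zs"
  shows "Sym F zs = of_nat (fact (length zs)) * F zs"
proof -
  have "Sym F zs = (\<Sum>\<sigma> | \<sigma> permutes {..<length zs}. F zs)"
    unfolding Sym_def
  proof (rule sum.cong[OF refl])
    fix \<sigma> assume "\<sigma> \<in> {\<sigma>. \<sigma> permutes {..<length zs}}"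
    then have "F (permute_list \<sigma> zs) = sg (koszul \<sigma> (degs zs)) (F zs)"
      using assms by (simp add: Symmetric_def)
    then show "sg (koszul \<sigma> (degs zs)) (F (permute_list \<sigma> zs)) = F zs"
      by (simp add: sg_def)
  qed
  then show ?thesis by (simp add: card_permutations)
qed

lemma Symmetric_block:
  assumes "Symmetric F (P @ A @ B @ R)"
  shows "F (P @ B @ A @ R) = sg (tdeg A * tdeg B) (F (P @ A @ B @ R))"
  using assms[unfolded Symmetric_def, rule_format, OF block_swap_permutes, of "length P" "length A" "length B"]
  by (simp add: permute_list_block_swap koszul_block_swap)

section \<open>Reduction of symmetry to adjacent transpositions\<close>

lemma transpose_Suc: "i < j \<Longrightarrow>
  Transposition.transpose i (Suc j)
    = Transposition.transpose j (Suc j) \<circ> Transposition.transpose i j \<circ> Transposition.transpose j (Suc j)"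
  by (auto simp: fun_eq_iff Transposition.transpose_def)

text \<open>Adjacent transpositions generate the symmetric group, and by the cocycle property the
  permutations that act with the right sign are closed under composition.\<close>

lemma Symmetric_adjacentI:
  assumes adj: "\<And>A x y B. mset (A @ [x, y] @ B) = mset zs \<Longrightarrow>
    F (A @ [y, x] @ B) = sg (fst x * fst y) (F (A @ [x, y] @ B))"
  shows "Symmetric F zs"
proof -
  let ?n = "length zs"
  \<comment> \<open>The quantification over all rearrangements of \<open>zs\<close> is what makes
    \<open>good\<close> closed under composition: the second permutation acts on a list that is
    already rearranged.\<close>
  define good where "good \<sigma> \<longleftrightarrow> \<sigma> permutes {..<?n} \<and>
    (\<forall>ys. mset ys = mset zs \<longrightarrow> F (permute_list \<sigma> ys) = sg (koszul \<sigma> (degs ys)) (F ys))" for \<sigma>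
  have comp: "good (\<sigma> \<circ> \<tau>)" if "good \<sigma>" "good \<tau>" for \<sigma> \<tau>
    unfolding good_def
  proof (intro conjI allI impI)
    show "\<sigma> \<circ> \<tau> permutes {..<?n}"
      using that by (auto simp: good_def intro: permutes_compose)
    fix ys assume ys: "mset ys = mset zs"
    have l: "length ys = ?n" using ys by (rule mset_eq_length)
    have \<sigma>: "\<sigma> permutes {..<length ys}" and \<tau>: "\<tau> permutes {..<length ys}"
      using that l by (auto simp: good_def)
    have k: "even (koszul (\<sigma> \<circ> \<tau>) (degs ys)) \<longleftrightarrow> even (koszul \<sigma> (degs ys) + koszul \<tau> (permute_list \<sigma> (degs ys)))"
      by (rule koszul_comp) (use \<sigma> \<tau> in simp_all)
    have "F (permute_list (\<sigma> \<circ> \<tau>) ys) = sg (koszul \<tau> (degs (permute_list \<sigma> ys))) (F (permute_list \<sigma> ys))"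
      using that(2) ys \<sigma> unfolding permute_list_compose[OF \<tau>] good_def by simp
    also have "F (permute_list \<sigma> ys) = sg (koszul \<sigma> (degs ys)) (F ys)"
      using that(1) ys by (simp add: good_def)
    finally have eq: "F (permute_list (\<sigma> \<circ> \<tau>) ys)
        = sg (koszul \<tau> (permute_list \<sigma> (degs ys)) + koszul \<sigma> (degs ys)) (F ys)"
      unfolding sg_sg degs_permute_list[OF \<sigma>] .
    show "F (permute_list (\<sigma> \<circ> \<tau>) ys) = sg (koszul (\<sigma> \<circ> \<tau>) (degs ys)) (F ys)"
      unfolding eq by (rule sg_cong) (use k in auto)
  qed
  have adjacent: "good (Transposition.transpose i (Suc i))" if i: "Suc i < ?n" for i
    unfolding good_def
  proof (intro conjI allI impI)
    show "Transposition.transpose i (Suc i) permutes {..<?n}"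
      using i by (intro permutes_swap_id) auto
    fix ys assume ys: "mset ys = mset zs"
    have l: "length ys = ?n" using ys by (rule mset_eq_length)
    define A B where "A = take i ys" and "B = drop (Suc (Suc i)) ys"
    have split: "ys = A @ [ys ! i] @ [ys ! Suc i] @ B"
      using i l by (simp add: A_def B_def Cons_nth_drop_Suc)
    have A: "length A = i" using i l by (simp add: A_def)
    have t: "Transposition.transpose i (Suc i) = block_swap i 1 1"
      by (auto simp: fun_eq_iff Transposition.transpose_def block_swap_def)
    have "permute_list (block_swap i 1 1) ys = A @ [ys ! Suc i] @ [ys ! i] @ B"
      by (subst split, rule permute_list_block_swap) (simp_all add: A)
    moreover have "degs ys = degs A @ [fst (ys ! i)] @ [fst (ys ! Suc i)] @ degs B"
      by (subst split) simp
    then have "koszul (block_swap i 1 1) (degs ys) = fst (ys ! i) * fst (ys ! Suc i)"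
      using koszul_block_swap[of "degs A" i "[fst (ys ! i)]" 1 "[fst (ys ! Suc i)]" 1 "degs B"] A by simp
    moreover have "mset (A @ [ys ! i, ys ! Suc i] @ B) = mset zs"
      using ys split by simp
    from adj[OF this] have "F (A @ [ys ! Suc i] @ [ys ! i] @ B) = sg (fst (ys ! i) * fst (ys ! Suc i)) (F ys)"
      using split by simp
    ultimately show "F (permute_list (Transposition.transpose i (Suc i)) ys)
        = sg (koszul (Transposition.transpose i (Suc i)) (degs ys)) (F ys)"
      unfolding t by simp
  qed
  have transp: "good (Transposition.transpose i j)" if "i < j" "j < ?n" for i j
    using that
  proof (induction j)
    case (Suc j)
    show ?case
    proof (cases "i = j")
      case False
      with Suc show ?thesis
        by (subst transpose_Suc) (auto intro!: comp adjacent)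
    qed (use Suc adjacent in auto)
  qed simp
  have id: "good id"
    by (auto simp: good_def permutes_id)
  have "good \<sigma>" if "\<sigma> permutes {..<?n}" for \<sigma>
    using that finite_lessThan
  proof (induction rule: permutes_induct)
    case (swap a b p)
    then have "good (Transposition.transpose a b)"
      using transp[of a b] transp[of b a] by (cases a b rule: linorder_cases) (auto simp: Transposition.transpose_commute)
    then show ?case using swap by (intro comp) auto
  qed (rule id)
  then show ?thesis
    by (simp add: good_def Symmetric_def)
qed

text \<open>Rotations by zero and by the full length agree and both carry the sign plus, so the
  range may be moved by one. In this indexing the summand \<open>s\<close> ends with the letter at
  place \<open>s\<close>.\<close>

lemma Cyc_shift:
  "Cyc F zs = (\<Sum>s<length zs. sg (tdeg (take (Suc s) zs) * tdeg (drop (Suc s) zs)) (F (drop (Suc s) zs @ take (Suc s) zs)))"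
proof -
  define g where "g r = sg (tdeg (take r zs) * tdeg (drop r zs)) (F (drop r zs @ take r zs))" for r
  have "Cyc F zs = (\<Sum>r<length zs. g r)"
    unfolding Cyc_def by (rule sum.cong) (auto simp: g_def rotate_drop_take)
  also have "\<dots> = (\<Sum>r<length zs. g (Suc r))"
    using sum.lessThan_Suc_shift[of g "length zs"] sum.lessThan_Suc[of g "length zs"]
    by (simp add: g_def)
  finally show ?thesis by (simp add: g_def)
qed

lemma tdeg_unshift: "tdeg (map (\<lambda>(d, v). (d + 1, v)) zs) = tdeg zs + int (length zs)"
  by (induction zs) auto

lemma length_Suc_0_D: "length xs = Suc 0 \<Longrightarrow> xs = [hd xs]"
  by (cases xs) auto

lemma length_2E:
  assumes "length zs = n + 2"
  obtains y1 y2 ys where "zs = y1 # y2 # ys" "length ys = n"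
  using assms by (auto simp: numeral_2_eq_2 length_Suc_conv)

text \<open>Place \<open>j\<close> of the permuted list reads place \<open>\<sigma> j\<close>, so
  the changed entry turns up at \<open>inv \<sigma> i\<close>.\<close>

lemma permute_list_update:
  assumes \<sigma>: "\<sigma> permutes {..<length vs}" and i: "i < length vs"
  shows "permute_list \<sigma> (vs[i := x]) = (permute_list \<sigma> vs)[inv \<sigma> i := x]"
proof (rule nth_equalityI)
  fix j assume "j < length (permute_list \<sigma> (vs[i := x]))"
  then have j: "j < length vs" by simp
  have "inv \<sigma> i = j \<longleftrightarrow> i = \<sigma> j"
    using permutes_inv_eq[OF \<sigma>] by metis
  then show "permute_list \<sigma> (vs[i := x]) ! j = (permute_list \<sigma> vs)[inv \<sigma> i := x] ! j"
    using \<sigma> i j by (auto simp: permute_list_nth nth_list_update permutes_lessThan_iff)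
qed simp

lemma map2_update:
  "length ds = length vs \<Longrightarrow> i < length vs \<Longrightarrow> map2 f ds (vs[i := x]) = (map2 f ds vs)[i := f (ds ! i) x]"
  by (rule nth_equalityI) (auto simp: nth_list_update)

section \<open>Homogeneous components\<close>

text \<open>The type underlying the double contains functions that are not linear, so the double
  cannot satisfy \<open>graded_space\<close>, which decomposes every element of the type. The locale
  asks for decompositions on the carrier only. Finiteness of the set of degrees keeps the sums in
  \<open>multihom\<close> meaningful.\<close>

locale graded =
  fixes G :: "('k::field, 'v::ab_group_add) gspace"
  assumes vector_space_smul: "vector_space (smul G)"
    and subspace_hcomp: "module.subspace (smul G) (hcomp G d)"
    and decomposes_ex: "v \<in> gcarrier G \<Longrightarrow> \<exists>f. decomposes G v f"
    and decomposes_unique: "decomposes G v f \<Longrightarrow> decomposes G v f' \<Longrightarrow> f = f'"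
    and finite_degrees: "finite (degrees G)"
begin

sublocale vector_space "smul G"
  by (rule vector_space_smul)

lemma hcomp_0: "0 \<in> hcomp G d"
  and hcomp_add: "x \<in> hcomp G d \<Longrightarrow> y \<in> hcomp G d \<Longrightarrow> x + y \<in> hcomp G d"
  and hcomp_scale: "x \<in> hcomp G d \<Longrightarrow> smul G a x \<in> hcomp G d"
  and hcomp_minus: "x \<in> hcomp G d \<Longrightarrow> - x \<in> hcomp G d"
  and hcomp_sum: "(\<And>i. i \<in> I \<Longrightarrow> f i \<in> hcomp G d) \<Longrightarrow> sum f I \<in> hcomp G d"
  by (rule subspace_0 subspace_add subspace_scale subspace_neg subspace_sum, rule subspace_hcomp; assumption)+

lemma hcomp_sg: "x \<in> hcomp G d \<Longrightarrow> sg n x \<in> hcomp G d"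
  by (simp add: sg_def hcomp_minus)

lemma hcomp_carrier: "x \<in> hcomp G d \<Longrightarrow> x \<in> gcarrier G"
  unfolding gcarrier_def by (rule span_base) auto

lemma carrier_0: "0 \<in> gcarrier G"
  and carrier_add: "x \<in> gcarrier G \<Longrightarrow> y \<in> gcarrier G \<Longrightarrow> x + y \<in> gcarrier G"
  and carrier_scale: "x \<in> gcarrier G \<Longrightarrow> smul G a x \<in> gcarrier G"
  and carrier_minus: "x \<in> gcarrier G \<Longrightarrow> - x \<in> gcarrier G"
  and carrier_sum: "(\<And>i. i \<in> I \<Longrightarrow> f i \<in> gcarrier G) \<Longrightarrow> sum f I \<in> gcarrier G"
  unfolding gcarrier_def by (auto intro: span_zero span_add span_scale span_neg span_sum)

lemma carrier_sg: "x \<in> gcarrier G \<Longrightarrow> sg n x \<in> gcarrier G"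
  by (simp add: sg_def carrier_minus)

lemma hcomp_degrees: "x \<in> hcomp G d \<Longrightarrow> x \<noteq> 0 \<Longrightarrow> d \<in> degrees G"
  unfolding degrees_def by auto

lemma gproj_eq:
  assumes "decomposes G v f"
  shows "gproj G d v = f d"
proof -
  have "(THE f. decomposes G v f) = f"
    by (rule the_equality[of "decomposes G v"]) (rule assms, rule decomposes_unique[OF _ assms])
  then show ?thesis by (simp add: gproj_def)
qed

lemma decomposes_gproj:
  assumes "v \<in> gcarrier G"
  shows "decomposes G v (\<lambda>d. gproj G d v)"
proof -
  obtain f where f: "decomposes G v f"
    using decomposes_ex[OF assms] by (rule exE)
  then have "(\<lambda>d. gproj G d v) = f"
    by (simp add: gproj_eq fun_eq_iff)
  with f show ?thesis by simp
qed

lemma gproj_hcomp: "v \<in> gcarrier G \<Longrightarrow> gproj G d v \<in> hcomp G d"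
  using decomposes_gproj by (auto simp: decomposes_def)

lemma gproj_carrier: "v \<in> gcarrier G \<Longrightarrow> gproj G d v \<in> gcarrier G"
  by (rule hcomp_carrier[OF gproj_hcomp])

text \<open>The support of a decomposition varies with the vector; with the fixed index set
  \<open>degrees G\<close>, sums of decompositions can be formed termwise.\<close>

lemma decomposes_iff:
  "decomposes G v f \<longleftrightarrow> (\<forall>d. f d \<in> hcomp G d) \<and> v = (\<Sum>d\<in>degrees G. f d)"
proof (cases "\<forall>d. f d \<in> hcomp G d")
  case True
  have sub: "{d. f d \<noteq> 0} \<subseteq> degrees G"
  proof clarify
    fix d assume "f d \<noteq> 0"
    with True show "d \<in> degrees G" by (intro hcomp_degrees[of "f d"]) simp_all
  qed
  have "(\<Sum>d | f d \<noteq> 0. f d) = (\<Sum>d\<in>degrees G. f d)"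
    by (rule sum.mono_neutral_left[OF finite_degrees sub]) simp
  then show ?thesis
    using True finite_subset[OF sub finite_degrees] unfolding decomposes_def by metis
next
  case False
  then show ?thesis unfolding decomposes_def by metis
qed

lemma sum_gproj: "v \<in> gcarrier G \<Longrightarrow> (\<Sum>d\<in>degrees G. gproj G d v) = v"
  using decomposes_gproj by (simp add: decomposes_iff)

lemma gproj_add: "v \<in> gcarrier G \<Longrightarrow> w \<in> gcarrier G \<Longrightarrow> gproj G d (v + w) = gproj G d v + gproj G d w"
  by (rule gproj_eq) (simp add: decomposes_iff hcomp_add gproj_hcomp sum.distrib sum_gproj)

lemma gproj_scale: "v \<in> gcarrier G \<Longrightarrow> gproj G d (smul G a v) = smul G a (gproj G d v)"
  by (rule gproj_eq) (simp add: decomposes_iff hcomp_scale gproj_hcomp sum_gproj flip: scale_sum_right)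

lemma gproj_homogeneous: "v \<in> hcomp G d' \<Longrightarrow> gproj G d v = (if d = d' then v else 0)"
proof (rule gproj_eq)
  assume v: "v \<in> hcomp G d'"
  then have "v = (if d' \<in> degrees G then v else 0)"
    using hcomp_degrees by auto
  with v show "decomposes G v (\<lambda>d. if d = d' then v else 0)"
    by (auto simp: decomposes_iff hcomp_0 sum.delta finite_degrees)
qed

lemma gproj_0 [simp]: "gproj G d 0 = 0"
  using gproj_homogeneous[OF hcomp_0] by simp

lemma gproj_sum: "(\<And>i. i \<in> I \<Longrightarrow> f i \<in> gcarrier G) \<Longrightarrow> gproj G d (sum f I) = (\<Sum>i\<in>I. gproj G d (f i))"
  by (induction I rule: infinite_finite_induct) (simp_all add: gproj_add carrier_sum)

section \<open>Lists of homogeneous letters\<close>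

definition homog :: "(int \<times> 'v) list \<Rightarrow> bool" where
  "homog zs \<longleftrightarrow> (\<forall>(d, v)\<in>set zs. v \<in> hcomp G d)"

lemma homog_simps [simp]:
  "homog []"
  "homog (z # zs) \<longleftrightarrow> snd z \<in> hcomp G (fst z) \<and> homog zs"
  "homog (ys @ zs) \<longleftrightarrow> homog ys \<and> homog zs"
  by (auto simp: homog_def)

lemma homog_mset: "mset ys = mset zs \<Longrightarrow> homog ys \<longleftrightarrow> homog zs"
  unfolding homog_def by (metis set_mset_mset)

lemma homog_nth: "homog zs \<Longrightarrow> i < length zs \<Longrightarrow> snd (zs ! i) \<in> hcomp G (fst (zs ! i))"
  by (auto simp: homog_def case_prod_unfold)

lemma homog_tuples: "homog zs \<Longrightarrow> length zs = n \<Longrightarrow> vecs zs \<in> tuples G n"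
  by (fastforce simp: homog_def tuples_def intro: hcomp_carrier)

lemma list_all2_homog: "list_all2 (\<lambda>d v. v \<in> hcomp G d) ds vs \<Longrightarrow> homog (zip ds vs)"
  by (auto simp: homog_def list_all2_iff)

text \<open>Components of a tuple in prescribed degrees, packed as letters, so that facts about
  homogeneous lists apply to each summand of \<open>multihom\<close>.\<close>

definition projs :: "int list \<Rightarrow> 'v list \<Rightarrow> (int \<times> 'v) list" where
  "projs ds vs = map2 (\<lambda>d v. (d, gproj G d v)) ds vs"

lemma length_projs: "length ds = length vs \<Longrightarrow> length (projs ds vs) = length vs"
  by (simp add: projs_def)

lemma homog_projs: "set vs \<subseteq> gcarrier G \<Longrightarrow> homog (projs ds vs)"
  by (auto simp: homog_def projs_def dest!: set_zip_rightD intro: gproj_hcomp)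

lemma degs_projs: "length ds = length vs \<Longrightarrow> degs (projs ds vs) = ds"
  by (simp add: projs_def comp_def case_prod_unfold)

lemma vecs_projs: "vecs (projs ds vs) = map2 (gproj G) ds vs"
  by (simp add: projs_def comp_def case_prod_unfold)

abbreviation degree_lists :: "nat \<Rightarrow> int list set" where
  "degree_lists n \<equiv> {ds. length ds = n \<and> set ds \<subseteq> degrees G}"

lemma finite_degree_lists: "finite (degree_lists n)"
  using finite_lists_length_eq[OF finite_degrees, of n] by (simp add: conj_commute)

section \<open>Multilinear maps on homogeneous arguments\<close>

text \<open>
  Multilinearity by index, which is more convenient than the splitting \<open>us @ x # ws\<close> when arguments
  are permuted or dropped; \<open>s\<close> is the scalar multiplication of the codomain.
\<close>

definition mlin :: "('k \<Rightarrow> 'w \<Rightarrow> 'w) \<Rightarrow> nat \<Rightarrow> ('v list \<Rightarrow> 'w::ab_group_add) \<Rightarrow> bool" where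
  "mlin s n F \<longleftrightarrow>
     (\<forall>vs\<in>tuples G n. \<forall>i<n. \<forall>x\<in>gcarrier G. \<forall>y\<in>gcarrier G. \<forall>a.
        F (vs[i := x + y]) = F (vs[i := x]) + F (vs[i := y]) \<and>
        F (vs[i := smul G a x]) = s a (F (vs[i := x])))"

lemma multilinear_iff:
  "multilinear G H n F \<longleftrightarrow> (\<forall>vs\<in>tuples G n. F vs \<in> gcarrier H) \<and> mlin (smul H) n F"
  (is "?L \<longleftrightarrow> ?R")
proof
  assume L: ?L
  have "mlin (smul H) n F"
    unfolding mlin_def
  proof (intro ballI allI impI)
    fix vs i x y a assume a: "vs \<in> tuples G n" "i < n" "x \<in> gcarrier G" "y \<in> gcarrier G"
    then have upd: "vs[i := z] = take i vs @ z # drop (Suc i) vs" for z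
      by (auto simp: tuples_def upd_conv_take_nth_drop)
    have "take i vs @ x # drop (Suc i) vs \<in> tuples G n"
      using a by (auto simp: tuples_def dest: in_set_takeD in_set_dropD)
    then show "F (vs[i := x + y]) = F (vs[i := x]) + F (vs[i := y]) \<and>
        F (vs[i := smul G a x]) = smul H a (F (vs[i := x]))"
      unfolding upd using L a(4) unfolding multilinear_def by blast
  qed
  with L show ?R by (simp add: multilinear_def)
next
  assume R: ?R
  have "F (us @ (x + y) # ws) = F (us @ x # ws) + F (us @ y # ws) \<and>
      F (us @ smul G a x # ws) = smul H a (F (us @ x # ws))"
    if "us @ x # ws \<in> tuples G n" "y \<in> gcarrier G" for us ws x y a
  proof -
    have "length us < n" "x \<in> gcarrier G"
      using that by (auto simp: tuples_def)
    then show ?thesis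
      using R that unfolding mlin_def by (metis list_update_length)
  qed
  with R show ?L unfolding multilinear_def by blast
qed

lemma tuples_update: "vs \<in> tuples G n \<Longrightarrow> x \<in> gcarrier G \<Longrightarrow> vs[i := x] \<in> tuples G n"
  by (auto simp: tuples_def dest: set_update_subset_insert[THEN subsetD])

lemma mlinI:
  assumes "\<And>vs i x y a. vs \<in> tuples G n \<Longrightarrow> length vs = n \<Longrightarrow> i < n \<Longrightarrow> x \<in> gcarrier G \<Longrightarrow> y \<in> gcarrier G \<Longrightarrow>
      F (vs[i := x + y]) = F (vs[i := x]) + F (vs[i := y]) \<and>
      F (vs[i := smul G a x]) = s a (F (vs[i := x]))"
  shows "mlin s n F"
  using assms by (auto simp: mlin_def tuples_def)

lemma mlinD:
  assumes "mlin s n F" "vs \<in> tuples G n" "i < n" "x \<in> gcarrier G"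
  shows "y \<in> gcarrier G \<Longrightarrow> F (vs[i := x + y]) = F (vs[i := x]) + F (vs[i := y])"
    and "F (vs[i := smul G a x]) = s a (F (vs[i := x]))"
  using assms by (auto simp: mlin_def)

lemma mlin_cong:
  assumes "\<And>vs. vs \<in> tuples G n \<Longrightarrow> F vs = F' vs"
  shows "mlin s n F \<longleftrightarrow> mlin s n F'"
proof -
  have "F (vs[i := x]) = F' (vs[i := x])" if "vs \<in> tuples G n" "x \<in> gcarrier G" for vs i x
    using assms tuples_update that by blast
  then show ?thesis
    unfolding mlin_def by (simp add: carrier_add carrier_scale cong: ball_cong)
qed

lemma mlin_zero:
  assumes "mlin s n F" "vs \<in> tuples G n" "0 \<in> set vs"
  shows "F vs = 0"
proof -
  obtain i where i: "i < length vs" "vs ! i = 0"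
    using assms(3) by (auto simp: in_set_conv_nth)
  then have "i < n" "vs[i := 0] = vs"
    using assms(2) by (auto simp: tuples_def list_update_same_conv)
  then show ?thesis
    using mlinD(1)[OF assms(1,2), of i 0 0] carrier_0 by simp
qed

lemma mlin_sum_slot:
  assumes F: "mlin s n F" and vs: "vs \<in> tuples G n" and i: "i < n"
    and f: "\<And>j. j \<in> J \<Longrightarrow> f j \<in> gcarrier G"
  shows "F (vs[i := sum f J]) = (\<Sum>j\<in>J. F (vs[i := f j]))"
  using f
proof (induction J rule: infinite_finite_induct)
  case (insert j J)
  then show ?case
    using mlinD(1)[OF F vs i, of "f j" "sum f J"] carrier_sum[of J f] by simp
qed (use mlin_zero[OF F tuples_update[OF vs carrier_0], of i] i vs in
    \<open>auto simp: tuples_def set_update_memI\<close>)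

lemma mlin_sum:
  assumes "vector_space s" and "\<And>j. j \<in> J \<Longrightarrow> mlin s n (F j)"
  shows "mlin s n (\<lambda>vs. \<Sum>j\<in>J. F j vs)"
proof -
  interpret s: vector_space s by fact
  show ?thesis
    by (rule mlinI) (simp add: mlinD[OF assms(2)] sum.distrib s.scale_sum_right)
qed

lemma mlin_sg:
  assumes "vector_space s" and "mlin s n F"
  shows "mlin s n (\<lambda>vs. sg c (F vs))"
proof -
  interpret s: vector_space s by fact
  show ?thesis
    by (rule mlinI) (simp add: mlinD[OF assms(2)] sg_def)
qed

lemma mlin_add:
  assumes "vector_space s" and "mlin s n F" and "mlin s n F'"
  shows "mlin s n (\<lambda>vs. F vs + F' vs)"
proof -
  interpret s: vector_space s by fact
  show ?thesis
    by (rule mlinI) (simp add: mlinD[OF assms(2)] mlinD[OF assms(3)] s.scale_right_distrib)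
qed

lemma mlin_diff:
  assumes "vector_space s" and "mlin s n F" and "mlin s n F'"
  shows "mlin s n (\<lambda>vs. F vs - F' vs)"
  using mlin_add[OF assms(1,2) mlin_sg[OF assms(1,3), of 1]] by (simp add: sg_def)

lemma tuples_permute: "\<sigma> permutes {..<n} \<Longrightarrow> vs \<in> tuples G n \<Longrightarrow> permute_list \<sigma> vs \<in> tuples G n"
  by (auto simp: tuples_def)

lemma mlin_permute:
  assumes \<sigma>: "\<sigma> permutes {..<n}" and F: "mlin s n F"
  shows "mlin s n (\<lambda>vs. F (permute_list \<sigma> vs))"
proof (rule mlinI)
  fix vs i x y a assume a: "vs \<in> tuples G n" "length vs = n" "i < n" "x \<in> gcarrier G" "y \<in> gcarrier G"
  have "inv \<sigma> i < n"
    using a(3) permutes_lessThan_iff[OF permutes_inv[OF \<sigma>]] by simp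
  then show "F (permute_list \<sigma> (vs[i := x + y])) = F (permute_list \<sigma> (vs[i := x])) + F (permute_list \<sigma> (vs[i := y]))
      \<and> F (permute_list \<sigma> (vs[i := smul G a x])) = s a (F (permute_list \<sigma> (vs[i := x])))"
    using a \<sigma> by (simp add: permute_list_update mlinD[OF F tuples_permute[OF \<sigma> a(1)]])
qed

lemma mlin_rotate:
  assumes "mlin s n F" and "r \<le> n"
  shows "mlin s n (\<lambda>vs. F (drop r vs @ take r vs))"
proof -
  have eq: "permute_list (block_swap 0 r (n - r)) vs = drop r vs @ take r vs" if "length vs = n" for vs :: "'v list"
    using permute_list_block_swap[of "[]" 0 "take r vs" r "drop r vs" "n - r" "[]"] that assms(2) by simp
  have "mlin s n (\<lambda>vs. F (permute_list (block_swap 0 r (n - r)) vs))"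
    by (rule mlin_permute[OF block_swap_permutes assms(1)]) (use assms(2) in simp)
  then show ?thesis
    by (subst (asm) mlin_cong[where F' = "\<lambda>vs. F (drop r vs @ take r vs)"]) (auto simp: eq tuples_def)
qed

lemma map2_gproj_tuples: "vs \<in> tuples G n \<Longrightarrow> length ds = n \<Longrightarrow> map2 (gproj G) ds vs \<in> tuples G n"
  by (auto simp: tuples_def dest!: set_zip_rightD intro: gproj_carrier)

text \<open>Taking components is linear, so each summand of \<open>multihom\<close> inherits
  multilinearity from the formula at its degrees.\<close>

lemma mlin_multihom:
  assumes s: "vector_space s" and \<Phi>: "\<And>ds. ds \<in> degree_lists n \<Longrightarrow> mlin s n (\<Phi> ds)"
  shows "mlin s n (multihom G \<Phi>)"
proof -
  have "mlin s n (\<lambda>vs. \<Phi> ds (map2 (gproj G) ds vs))" if ds: "ds \<in> degree_lists n" for ds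
  proof (rule mlinI)
    fix vs i x y a assume a: "vs \<in> tuples G n" "length vs = n" "i < n" "x \<in> gcarrier G" "y \<in> gcarrier G"
    show "\<Phi> ds (map2 (gproj G) ds (vs[i := x + y]))
        = \<Phi> ds (map2 (gproj G) ds (vs[i := x])) + \<Phi> ds (map2 (gproj G) ds (vs[i := y]))
        \<and> \<Phi> ds (map2 (gproj G) ds (vs[i := smul G a x])) = s a (\<Phi> ds (map2 (gproj G) ds (vs[i := x])))"
      using a ds by (simp add: map2_update gproj_add gproj_scale gproj_carrier
          mlinD[OF \<Phi>[OF ds] map2_gproj_tuples])
  qed
  then have "mlin s n (\<lambda>vs. \<Sum>ds\<in>degree_lists n. \<Phi> ds (map2 (gproj G) ds vs))"
    by (rule mlin_sum[OF s])
  then show ?thesis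
    by (subst (asm) mlin_cong[where F' = "multihom G \<Phi>"]) (auto simp: multihom_def tuples_def)
qed

text \<open>
  The hypothesis on zero arguments is needed because a zero argument is homogeneous of every degree.
\<close>

lemma multihom_homog:
  assumes zs: "homog zs"
    and zero: "\<And>ys. length ys = length zs \<Longrightarrow> homog ys \<Longrightarrow> 0 \<in> set (vecs ys) \<Longrightarrow> \<Phi> (degs ys) (vecs ys) = 0"
  shows "multihom G \<Phi> (vecs zs) = \<Phi> (degs zs) (vecs zs)"
proof -
  let ?n = "length zs"
  have proj: "length (projs ds (vecs zs)) = ?n" "homog (projs ds (vecs zs))"
      "degs (projs ds (vecs zs)) = ds" "vecs (projs ds (vecs zs)) = map2 (gproj G) ds (vecs zs)"
    if "length ds = ?n" for ds
    using that homog_projs[of "vecs zs" ds] homog_tuples[OF zs refl]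
    by (simp_all only: length_projs degs_projs vecs_projs tuples_def length_map mem_Collect_eq)
  \<comment> \<open>A wrong degree at some place projects the letter there to zero.\<close>
  have van: "\<Phi> ds (map2 (gproj G) ds (vecs zs)) = 0" if "length ds = ?n" "ds \<noteq> degs zs" for ds
  proof -
    have "\<exists>i<?n. ds ! i \<noteq> fst (zs ! i)"
      using that by (simp add: list_eq_iff_nth_eq)
    then obtain i where i: "i < ?n" "ds ! i \<noteq> fst (zs ! i)"
      by (elim exE conjE)
    then have "map2 (gproj G) ds (vecs zs) ! i = 0"
      using that(1) gproj_homogeneous[OF homog_nth[OF zs i(1)], of "ds ! i"] by simp
    then have "0 \<in> set (vecs (projs ds (vecs zs)))"
      unfolding proj(4)[OF that(1)] in_set_conv_nth by (intro exI[of _ i]) (use i(1) that(1) in simp)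
    then show ?thesis
      using zero[OF proj(1,2)[OF that(1)]] proj(3,4)[OF that(1)] by simp
  qed
  have same: "map2 (gproj G) (degs zs) (vecs zs) = vecs zs"
    by (rule nth_equalityI) (use gproj_homogeneous[OF homog_nth[OF zs]] in \<open>simp_all add: case_prod_unfold\<close>)
  show ?thesis
  proof (cases "set (degs zs) \<subseteq> degrees G")
    case True
    have "multihom G \<Phi> (vecs zs) = (\<Sum>ds\<in>{degs zs}. \<Phi> ds (map2 (gproj G) ds (vecs zs)))"
      unfolding multihom_def
      by (rule sum.mono_neutral_right) (use True van finite_degree_lists[of ?n] in auto)
    then show ?thesis by (simp add: same)
  next
    \<comment> \<open>A letter whose degree lies outside \<open>degrees G\<close> is zero, so both
      sides vanish.\<close>
    case False
    have "multihom G \<Phi> (vecs zs) = 0"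
      unfolding multihom_def
    proof (rule sum.neutral, rule ballI)
      fix ds assume "ds \<in> degree_lists (length (vecs zs))"
      moreover from this False have "ds \<noteq> degs zs" by blast
      ultimately show "\<Phi> ds (map2 (gproj G) ds (vecs zs)) = 0"
        by (intro van) simp_all
    qed
    moreover have "\<exists>i<?n. fst (zs ! i) \<notin> degrees G"
      using False in_set_conv_nth[of _ zs] by (auto simp: subset_iff) (metis fst_conv)
    then obtain i where i: "i < ?n" "fst (zs ! i) \<notin> degrees G"
      by (elim exE conjE)
    have "snd (zs ! i) = 0"
      using hcomp_degrees[OF homog_nth[OF zs i(1)]] i(2) by blast
    then have "0 \<in> set (vecs zs)"
      using nth_mem[OF i(1)] by (force simp: image_iff)
    then have "\<Phi> (degs zs) (vecs zs) = 0"
      by (rule zero[OF refl zs])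
    ultimately show ?thesis by simp
  qed
qed

lemma multihom_mlin_homog:
  assumes "homog zs" and "\<And>ds. length ds = length zs \<Longrightarrow> mlin s (length zs) (\<Phi> ds)"
  shows "multihom G \<Phi> (vecs zs) = \<Phi> (degs zs) (vecs zs)"
proof (rule multihom_homog[OF assms(1)])
  fix ys assume "length ys = length zs" "homog ys" "0 \<in> set (vecs ys)"
  then show "\<Phi> (degs ys) (vecs ys) = 0"
    using mlin_zero[OF assms(2)[of "degs ys"] homog_tuples[of ys]] by simp
qed

text \<open>Splitting off single slots serves the induction in \<open>mlin_expand\<close> and the
  analysis of \<open>insert_tensor\<close>, whose first two arguments are basis vectors that need
  not be homogeneous.\<close>

lemma multihom_Cons:
  "multihom G \<Phi> (u # vs) = (\<Sum>d\<in>degrees G. multihom G (\<lambda>ds us. \<Phi> (d # ds) (gproj G d u # us)) vs)"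
proof -
  have eq: "degree_lists (length (u # vs)) = (\<lambda>(d, ds). d # ds) ` (degrees G \<times> degree_lists (length vs))"
    by (auto simp: length_Suc_conv image_iff)
  have "inj_on (\<lambda>(d, ds). d # ds) (degrees G \<times> degree_lists (length vs))"
    by (auto simp: inj_on_def)
  then have "multihom G \<Phi> (u # vs) = (\<Sum>(d, ds)\<in>degrees G \<times> degree_lists (length vs).
      \<Phi> (d # ds) (gproj G d u # map2 (gproj G) ds vs))"
    unfolding multihom_def eq by (simp add: sum.reindex case_prod_unfold comp_def)
  then show ?thesis
    by (simp add: multihom_def sum.cartesian_product)
qed

lemma mlin_Cons:
  assumes "mlin s (Suc n) F" and "u \<in> gcarrier G"
  shows "mlin s n (\<lambda>vs. F (u # vs))"
proof (rule mlinI)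
  fix vs i x y a assume a: "vs \<in> tuples G n" "i < n" "x \<in> gcarrier G" "y \<in> gcarrier G"
  have "u # vs \<in> tuples G (Suc n)"
    using a(1) assms(2) by (simp add: tuples_def)
  from mlinD[OF assms(1) this, of "Suc i" x] a
  show "F (u # vs[i := x + y]) = F (u # vs[i := x]) + F (u # vs[i := y]) \<and>
      F (u # vs[i := smul G a x]) = s a (F (u # vs[i := x]))"
    by simp
qed

text \<open>A multilinear map is the sum of its values on components; \<open>multihom\<close> is
  thus the multilinear extension of a formula given on homogeneous arguments.\<close>

lemma mlin_expand:
  assumes "mlin s n F" and "vs \<in> tuples G n"
  shows "F vs = multihom G (\<lambda>ds. F) vs"
  using assms
proof (induction n arbitrary: F vs)
  case 0
  then have "vs = []" by (simp add: tuples_def)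
  moreover have "degree_lists 0 = {[]}" by auto
  ultimately show ?case by (simp add: multihom_def)
next
  case (Suc n)
  then obtain u us where vs: "vs = u # us"
    by (auto simp: tuples_def length_Suc_conv)
  then have u: "u \<in> gcarrier G" and us: "us \<in> tuples G n"
    using Suc.prems by (auto simp: tuples_def)
  have "F vs = F ((u # us)[0 := \<Sum>d\<in>degrees G. gproj G d u])"
    by (simp add: vs sum_gproj u)
  also have "\<dots> = (\<Sum>d\<in>degrees G. F (gproj G d u # us))"
    using mlin_sum_slot[OF Suc.prems(1), of "u # us" 0 "degrees G" "\<lambda>d. gproj G d u"] Suc.prems(2) u
    by (simp add: vs gproj_carrier)
  also have "\<dots> = multihom G (\<lambda>ds. F) vs"
    unfolding vs multihom_Cons
    by (rule sum.cong[OF refl Suc.IH[OF mlin_Cons us]]) (use Suc.prems u in \<open>auto intro: gproj_carrier\<close>)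
  finally show ?case .
qed

lemma multihom_ext:
  assumes "vs \<in> tuples G n"
    and "\<And>zs. homog zs \<Longrightarrow> length zs = n \<Longrightarrow> \<Phi> (degs zs) (vecs zs) = \<Psi> (degs zs) (vecs zs)"
  shows "multihom G \<Phi> vs = multihom G \<Psi> vs"
  unfolding multihom_def
proof (rule sum.cong[OF refl])
  fix ds assume "ds \<in> degree_lists (length vs)"
  then have "length ds = length vs" "length vs = n"
    using assms(1) by (auto simp: tuples_def)
  then show "\<Phi> ds (map2 (gproj G) ds vs) = \<Psi> ds (map2 (gproj G) ds vs)"
    using assms(2)[of "projs ds vs"] homog_projs[of vs ds] assms(1)
    by (simp add: length_projs degs_projs vecs_projs tuples_def)
qed

text \<open>Signs are available only on homogeneous letters; this principle carries an identity
  established there to all tuples of the carrier.\<close>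

lemma mlin_ext:
  assumes "mlin s n F" and "mlin s n F'" and "vs \<in> tuples G n"
    and "\<And>zs. homog zs \<Longrightarrow> length zs = n \<Longrightarrow> F (vecs zs) = F' (vecs zs)"
  shows "F vs = F' vs"
  using multihom_ext[OF assms(3), of "\<lambda>_. F" "\<lambda>_. F'"] mlin_expand assms by metis

section \<open>Graded symmetry, symmetrization and cyclic sums on homogeneous letters\<close>

lemma mlin_insert:
  assumes F: "mlin s n F" and ps: "set ps \<subseteq> gcarrier G" and n: "n = k + length ps" and m: "m \<le> k"
  shows "mlin s k (\<lambda>vs. F (take m vs @ ps @ drop m vs))"
proof (rule mlinI)
  fix vs i x y a assume a: "vs \<in> tuples G k" "length vs = k" "i < k" "x \<in> gcarrier G" "y \<in> gcarrier G"
  let ?j = "if i < m then i else i + length ps"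
  have upd: "take m (vs[i := z]) @ ps @ drop m (vs[i := z]) = (take m vs @ ps @ drop m vs)[?j := z]" for z
    using a(2,3) m by (auto simp: list_update_append take_update_swap drop_update_swap list_update_beyond)
  have "take m vs @ ps @ drop m vs \<in> tuples G n"
    using a(1,2) ps n m by (auto simp: tuples_def dest: in_set_takeD in_set_dropD)
  then show "F (take m (vs[i := x + y]) @ ps @ drop m (vs[i := x + y]))
      = F (take m (vs[i := x]) @ ps @ drop m (vs[i := x])) + F (take m (vs[i := y]) @ ps @ drop m (vs[i := y])) \<and>
    F (take m (vs[i := smul G a x]) @ ps @ drop m (vs[i := smul G a x]))
      = s a (F (take m (vs[i := x]) @ ps @ drop m (vs[i := x])))"
    unfolding upd by (intro conjI mlinD[OF F]) (use a n in auto)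
qed

text \<open>In \<open>graded_sym\<close> and \<open>skew_sym\<close> only the two exchanged
  arguments are homogeneous. As the sign depends on these two alone, the other arguments can be
  decomposed. The exponent \<open>f\<close> stays free so that the rule serves both kinds of
  symmetry.\<close>

lemma adjacent_sym_if_homog:
  assumes s: "vector_space s" and F: "mlin s n F"
    and hom: "\<And>A B x y d d'. homog (A @ [(d, x), (d', y)] @ B) \<Longrightarrow> length A + length B + 2 = n \<Longrightarrow>
      F (vecs A @ [y, x] @ vecs B) = sg (f d d') (F (vecs A @ [x, y] @ vecs B))"
    and t: "us @ [x, y] @ ws \<in> tuples G n" and x: "x \<in> hcomp G d" and y: "y \<in> hcomp G d'"
  shows "F (us @ [y, x] @ ws) = sg (f d d') (F (us @ [x, y] @ ws))"
proof -
  let ?m = "length us" and ?k = "length us + length ws"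
  let ?L = "\<lambda>vs. F (take ?m vs @ [y, x] @ drop ?m vs)"
  let ?R = "\<lambda>vs. sg (f d d') (F (take ?m vs @ [x, y] @ drop ?m vs))"
  have n: "n = ?k + 2" and us: "us @ ws \<in> tuples G ?k"
    using t by (auto simp: tuples_def)
  have "?L (us @ ws) = ?R (us @ ws)"
  proof (rule mlin_ext[where s = s and n = ?k and F = ?L and F' = ?R])
    have xy: "set [x, y] \<subseteq> gcarrier G" "set [y, x] \<subseteq> gcarrier G"
      using x y hcomp_carrier by auto
    show "mlin s ?k ?L" "mlin s ?k ?R"
      by (rule mlin_insert[OF F xy(2)] mlin_sg[OF s mlin_insert[OF F xy(1)]]; simp add: n)+
    show "?L (vecs zs) = ?R (vecs zs)" if "homog zs" "length zs = ?k" for zs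
    proof -
      have "homog (take ?m zs)" "homog (drop ?m zs)"
        using that(1) by (metis append_take_drop_id homog_simps(3))+
      then show ?thesis
        using hom[of "take ?m zs" d x d' y "drop ?m zs"] that(2) n x y
        by (simp add: take_map drop_map)
    qed
  qed (rule us)
  then show ?thesis by simp
qed

lemma graded_sym_Symmetric:
  assumes F: "graded_sym G n F" and zs: "homog zs" "length zs = n"
  shows "Symmetric (\<lambda>ys. F (vecs ys)) zs"
proof (rule Symmetric_adjacentI)
  fix A x y B assume m: "mset (A @ [x, y] @ B) = mset zs"
  have "homog (A @ [x, y] @ B)" "length (A @ [x, y] @ B) = n"
    using homog_mset[OF m] zs mset_eq_length[OF m] by auto
  then show "F (vecs (A @ [y, x] @ B)) = sg (fst x * fst y) (F (vecs (A @ [x, y] @ B)))"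
    using F[unfolded graded_sym_def, rule_format, of "vecs A" "snd x" "snd y" "vecs B" "fst x" "fst y"]
      homog_tuples[of "A @ [x, y] @ B"] by simp
qed

text \<open>The left side exchanges neighbours among arbitrary arguments, the right side permutes
  homogeneous letters. Generation by adjacent transpositions gives one direction, multilinearity the
  other.\<close>

lemma graded_sym_iff:
  assumes s: "vector_space s" and F: "mlin s n F"
  shows "graded_sym G n F \<longleftrightarrow> (\<forall>zs. homog zs \<longrightarrow> length zs = n \<longrightarrow> Symmetric (\<lambda>ys. F (vecs ys)) zs)"
proof
  assume "graded_sym G n F"
  then show "\<forall>zs. homog zs \<longrightarrow> length zs = n \<longrightarrow> Symmetric (\<lambda>ys. F (vecs ys)) zs"
    using graded_sym_Symmetric by blast
next
  assume R: "\<forall>zs. homog zs \<longrightarrow> length zs = n \<longrightarrow> Symmetric (\<lambda>ys. F (vecs ys)) zs"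
  show "graded_sym G n F"
    unfolding graded_sym_def
  proof (intro allI impI)
    fix us ws x y d d'
    assume a: "us @ [x, y] @ ws \<in> tuples G n" "x \<in> hcomp G d" "y \<in> hcomp G d'"
    show "F (us @ [y, x] @ ws) = sg (d * d') (F (us @ [x, y] @ ws))"
    proof (rule adjacent_sym_if_homog[OF s F _ a, of "\<lambda>d d'. d * d'"])
      fix A B x y d d' assume "homog (A @ [(d, x), (d', y)] @ B)" "length A + length B + 2 = n"
      then have "Symmetric (\<lambda>ys. F (vecs ys)) (A @ [(d, x)] @ [(d', y)] @ B)"
        using R by simp
      from Symmetric_block[OF this]
      show "F (vecs A @ [y, x] @ vecs B) = sg (d * d') (F (vecs A @ [x, y] @ vecs B))"
        by simp
    qed
  qed
qed

text \<open>Moving the last letter to the front is the swap of a block with a single letter.\<close>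

lemma cyclic_if_graded_sym:
  assumes F: "graded_sym G n F"
  shows "cyclic G n F"
  unfolding cyclic_def
proof (intro allI impI)
  fix ds vs d v
  assume n: "length vs + 1 = n" and vs: "list_all2 (\<lambda>d v. v \<in> hcomp G d) ds vs" and v: "v \<in> hcomp G d"
  have l: "length ds = length vs" using vs by (rule list_all2_lengthD)
  have "Symmetric (\<lambda>ys. F (vecs ys)) ([] @ zip ds vs @ [(d, v)] @ [])"
    by (rule graded_sym_Symmetric[OF F]) (use list_all2_homog[OF vs] v n l in simp_all)
  from Symmetric_block[OF this]
  show "F (v # vs) = sg (d * sum_list ds) (F (vs @ [v]))"
    using l by (simp add: mult.commute)
qed

text \<open>Bridge to the calculus of letters: at homogeneous letters the list of their degrees
  accounts for the whole value of \<open>multihom\<close>.\<close>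

lemma symmetrize_homog:
  assumes s: "vector_space s" and F: "mlin s n F" and zs: "homog zs" "length zs = n"
  shows "symmetrize G F (vecs zs) = Sym (\<lambda>ys. F (vecs ys)) zs"
proof -
  have "symmetrize G F (vecs zs) = (\<Sum>\<sigma> | \<sigma> permutes {..<length (vecs zs)}.
      sg (koszul \<sigma> (degs zs)) (F (permute_list \<sigma> (vecs zs))))"
    unfolding symmetrize_def
  proof (rule multihom_mlin_homog[OF zs(1)])
    fix ds :: "int list"
    have "mlin s n (\<lambda>us. \<Sum>\<sigma> | \<sigma> permutes {..<n}. sg (koszul \<sigma> ds) (F (permute_list \<sigma> us)))"
      by (intro mlin_sum[OF s] mlin_sg[OF s] mlin_permute[OF _ F]) simp
    then show "mlin s (length zs) (\<lambda>us. \<Sum>\<sigma> | \<sigma> permutes {..<length us}. sg (koszul \<sigma> ds) (F (permute_list \<sigma> us)))"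
      unfolding zs(2) by (subst mlin_cong) (auto simp: tuples_def)
  qed
  also have "\<dots> = Sym (\<lambda>ys. F (vecs ys)) zs"
    unfolding Sym_def by (rule sum.cong) (simp_all add: permute_list_map)
  finally show ?thesis .
qed

lemma mlin_symmetrize:
  assumes s: "vector_space s" and F: "mlin s n F"
  shows "mlin s n (symmetrize G F)"
  unfolding symmetrize_def
proof (rule mlin_multihom[OF s])
  fix ds
  have "mlin s n (\<lambda>us. \<Sum>\<sigma> | \<sigma> permutes {..<n}. sg (koszul \<sigma> ds) (F (permute_list \<sigma> us)))"
    by (intro mlin_sum[OF s] mlin_sg[OF s] mlin_permute[OF _ F]) simp
  then show "mlin s n (\<lambda>us. \<Sum>\<sigma> | \<sigma> permutes {..<length us}. sg (koszul \<sigma> ds) (F (permute_list \<sigma> us)))"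
    by (subst (asm) mlin_cong) (auto simp: tuples_def)
qed

lemma graded_sym_symmetrize:
  assumes s: "vector_space s" and F: "mlin s n F"
  shows "graded_sym G n (symmetrize G F)"
  unfolding graded_sym_iff[OF s mlin_symmetrize[OF s F]]
proof (intro allI impI)
  fix zs assume zs: "homog zs" "length zs = n"
  show "Symmetric (\<lambda>ys. symmetrize G F (vecs ys)) zs"
    unfolding Symmetric_def
  proof (intro allI impI)
    fix \<sigma> assume \<sigma>: "\<sigma> permutes {..<length zs}"
    have "homog (permute_list \<sigma> zs)"
      using zs(1) homog_mset[of "permute_list \<sigma> zs" zs] \<sigma> by simp
    then show "symmetrize G F (vecs (permute_list \<sigma> zs)) = sg (koszul \<sigma> (degs zs)) (symmetrize G F (vecs zs))"
      using Symmetric_Sym[of "\<lambda>ys. F (vecs ys)" zs] \<sigma> zs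
      by (simp add: symmetrize_homog[OF s F] Symmetric_def del: set_permute_list)
  qed
qed

text \<open>Only vanishing on zero arguments is asked of \<open>F\<close>, so the lemma applies to
  \<open>insert_tensor\<close> directly and not just to maps known to be multilinear.\<close>

lemma cyclize_homog:
  assumes zs: "homog zs"
    and zero: "\<And>ys. length ys = length zs \<Longrightarrow> homog ys \<Longrightarrow> 0 \<in> set (vecs ys) \<Longrightarrow> F (vecs ys) = 0"
  shows "cyclize G F (vecs zs) = Cyc (\<lambda>ys. F (vecs ys)) zs"
proof -
  have rot: "homog (rotate r ys) \<longleftrightarrow> homog ys" for r ys
    by (simp add: homog_def)
  have "cyclize G F (vecs zs) = (\<Sum>r<length (vecs zs).
      sg (sum_list (take r (degs zs)) * sum_list (drop r (degs zs))) (F (rotate r (vecs zs))))"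
    unfolding cyclize_def
  proof (rule multihom_homog[OF zs], rule sum.neutral, rule ballI)
    fix ys r assume ys: "length ys = length zs" "homog ys" "0 \<in> set (vecs ys)"
    then have "F (vecs (rotate r ys)) = 0"
      by (intro zero) (simp_all add: rot)
    then show "sg (sum_list (take r (degs ys)) * sum_list (drop r (degs ys))) (F (rotate r (vecs ys))) = 0"
      by (simp add: rotate_map)
  qed
  then show ?thesis
    by (simp add: Cyc_def rotate_map take_map drop_map)
qed

lemma mlin_cyclize:
  assumes s: "vector_space s" and F: "mlin s n F"
  shows "mlin s n (cyclize G F)"
  unfolding cyclize_def
proof (rule mlin_multihom[OF s])
  fix ds
  have "mlin s n (\<lambda>us. \<Sum>r<n. sg (sum_list (take r ds) * sum_list (drop r ds)) (F (drop r us @ take r us)))"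
    by (intro mlin_sum[OF s] mlin_sg[OF s] mlin_rotate[OF F]) simp
  then show "mlin s n (\<lambda>us. \<Sum>r<length us. sg (sum_list (take r ds) * sum_list (drop r ds)) (F (rotate r us)))"
    by (subst (asm) mlin_cong) (auto simp: tuples_def rotate_drop_take)
qed

end

section \<open>Shifts, sums and duals of graded spaces\<close>

text \<open>The vectors with components only in the degrees that occur in a finite spanning set
  \<open>B\<close> form a subspace containing \<open>B\<close>, hence exhaust the space.\<close>

lemma decomposes_finite_degrees:
  assumes vs: "vector_space (smul G)" and sub: "\<And>d. module.subspace (smul G) (hcomp G d)"
    and ex1: "\<And>v. \<exists>!f. decomposes G v f"
    and B: "finite B" "module.span (smul G) B = UNIV"
  shows "finite (degrees G)"
proof -
  interpret vector_space "smul G" by fact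
  define p where "p v = (THE f. decomposes G v f)" for v
  have p: "decomposes G v (p v)" for v
    unfolding p_def by (rule theI'[OF ex1])
  have p_eq: "p v = f" if "decomposes G v f" for v f
    using ex1[of v] p[of v] that by blast
  let ?D = "\<Union>b\<in>B. {d. p b d \<noteq> 0}"
  have fin: "finite ?D"
    using B(1) p by (auto simp: decomposes_def)
  define S where "S = {v. \<forall>d. d \<notin> ?D \<longrightarrow> p v d = 0}"
  have "subspace S"
  proof (rule subspaceI)
    have "decomposes G 0 (\<lambda>d. 0)"
      by (simp add: decomposes_def subspace_0[OF sub])
    then show "0 \<in> S" by (simp add: S_def p_eq)
  next
    have p_sum: "v = (\<Sum>d\<in>D. p v d)" if "finite D" "{d. p v d \<noteq> 0} \<subseteq> D" for v D
    proof -
      have "v = (\<Sum>d | p v d \<noteq> 0. p v d)" using p[of v] by (simp add: decomposes_def)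
      also have "\<dots> = (\<Sum>d\<in>D. p v d)" by (rule sum.mono_neutral_left) (use that in auto)
      finally show ?thesis .
    qed
    have dec: "decomposes G v f" if "\<And>d. f d \<in> hcomp G d" "finite D" "{d. f d \<noteq> 0} \<subseteq> D" "v = (\<Sum>d\<in>D. f d)" for v f D
    proof -
      have "(\<Sum>d | f d \<noteq> 0. f d) = (\<Sum>d\<in>D. f d)" by (rule sum.mono_neutral_left) (use that in auto)
      then show ?thesis using that finite_subset[OF that(3,2)] by (simp add: decomposes_def)
    qed
    have hc: "p v d \<in> hcomp G d" "finite {d. p v d \<noteq> 0}" for v d
      using p[of v] by (auto simp: decomposes_def)
    {
      fix x y assume "x \<in> S" "y \<in> S"
      let ?E = "{d. p x d \<noteq> 0} \<union> {d. p y d \<noteq> 0}"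
      have "decomposes G (x + y) (\<lambda>d. p x d + p y d)"
      proof (rule dec[of _ ?E])
        show "x + y = (\<Sum>d\<in>?E. p x d + p y d)"
          unfolding sum.distrib using hc(2) by (intro arg_cong2[of _ _ _ _ "(+)"] p_sum) auto
      qed (use hc sub in \<open>auto intro: subspace_add\<close>)
      with \<open>x \<in> S\<close> \<open>y \<in> S\<close> show "x + y \<in> S" by (simp add: S_def p_eq)
    next
      fix c x assume "x \<in> S"
      have "decomposes G (smul G c x) (\<lambda>d. smul G c (p x d))"
      proof (rule dec[of _ "{d. p x d \<noteq> 0}"])
        show "smul G c x = (\<Sum>d | p x d \<noteq> 0. smul G c (p x d))"
          unfolding scale_sum_right[symmetric] using hc(2) by (intro arg_cong[of _ _ "smul G c"] p_sum) auto
      qed (use hc sub in \<open>auto intro: subspace_scale\<close>)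
      with \<open>x \<in> S\<close> show "smul G c x \<in> S" by (simp add: S_def p_eq)
    }
  qed
  moreover have "B \<subseteq> S" by (auto simp: S_def)
  ultimately have S: "v \<in> S" for v
    using span_minimal[of B S] B(2) by auto
  have "degrees G \<subseteq> ?D"
  proof
    fix d assume "d \<in> degrees G"
    then obtain v where v: "v \<in> hcomp G d" "v \<noteq> 0"
      using subspace_0[OF sub, of d] by (auto simp: degrees_def)
    have "decomposes G v (\<lambda>d'. if d' = d then v else 0)"
      using v by (auto simp: decomposes_def subspace_0[OF sub])
    from p_eq[OF this] v(2) have "p v d \<noteq> 0" by simp
    with S[of v] show "d \<in> ?D" by (auto simp: S_def)
  qed
  then show ?thesis using fin by (rule finite_subset)
qed

lemma graded_space_graded:
  assumes "graded_space G"
  shows "graded G"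
proof -
  obtain B where vs: "vector_space (smul G)" and sub: "\<And>d. module.subspace (smul G) (hcomp G d)"
    and ex1: "\<And>v. \<exists>!f. decomposes G v f" and B: "finite B" "module.span (smul G) B = UNIV"
    using assms unfolding graded_space_def by blast
  show ?thesis
    by (rule graded.intro[OF vs sub _ _ decomposes_finite_degrees[OF vs sub ex1 B]]) (use ex1 in blast)+
qed

lemma graded_space_carrier:
  assumes "graded_space G"
  shows "gcarrier G = UNIV"
proof -
  interpret graded G by (rule graded_space_graded[OF assms])
  have "v \<in> gcarrier G" for v
  proof -
    obtain f where "decomposes G v f"
      using assms unfolding graded_space_def by blast
    then have f: "\<And>d. f d \<in> hcomp G d" "v = (\<Sum>d | f d \<noteq> 0. f d)"
      by (auto simp: decomposes_def)
    show ?thesis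
      unfolding f(2) by (rule carrier_sum) (rule hcomp_carrier[OF f(1)])
  qed
  then show ?thesis by blast
qed

lemma smul_gshift [simp]: "smul (gshift G) = smul G"
  and hcomp_gshift [simp]: "hcomp (gshift G) d = hcomp G (d + 1)"
  by (simp_all add: gshift_def)

lemma gcarrier_gshift [simp]: "gcarrier (gshift G) = gcarrier G"
proof -
  have "(\<Union>d. hcomp G (d + 1)) = (\<Union>d. hcomp G d)"
    by auto (metis diff_add_cancel)
  then show ?thesis by (simp add: gcarrier_def)
qed

lemma tuples_gshift [simp]: "tuples (gshift G) n = tuples G n"
  by (simp add: tuples_def)

lemma degrees_gshift: "degrees (gshift G) = (\<lambda>d. d - 1) ` degrees G"
proof -
  have "d \<in> degrees (gshift G) \<longleftrightarrow> d + 1 \<in> degrees G" for d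
    by (simp add: degrees_def)
  then show ?thesis by (force simp: image_iff)
qed

lemma decomposes_gshift:
  "decomposes (gshift G) v f \<longleftrightarrow> decomposes G v (\<lambda>d. f (d - 1))"
proof -
  have inj: "inj_on (\<lambda>d. d + 1) A" for A :: "int set" by (simp add: inj_on_def)
  have eq: "{d. f (d - 1) \<noteq> 0} = (\<lambda>d. d + 1) ` {d. f d \<noteq> 0}"
    by (auto simp: image_iff) (metis diff_add_cancel)
  have "(\<Sum>d | f (d - 1) \<noteq> 0. f (d - 1)) = (\<Sum>d | f d \<noteq> 0. f d)"
    unfolding eq by (simp add: sum.reindex[OF inj])
  moreover have "finite {d. f (d - 1) \<noteq> 0} \<longleftrightarrow> finite {d. f d \<noteq> 0}"
    unfolding eq by (rule finite_image_iff[OF inj])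
  moreover have "(\<forall>d. f d \<in> hcomp G (d + 1)) \<longleftrightarrow> (\<forall>d. f (d - 1) \<in> hcomp G d)"
    by (metis add_diff_cancel_right' diff_add_cancel)
  ultimately show ?thesis by (simp add: decomposes_def)
qed

lemma graded_gshift:
  assumes "graded G"
  shows "graded (gshift G)"
proof -
  interpret graded G by fact
  show ?thesis
  proof
    show "\<exists>f. decomposes (gshift G) v f" if v: "v \<in> gcarrier (gshift G)" for v
    proof -
      obtain f where "decomposes G v f" using decomposes_ex v by auto
      then have "decomposes (gshift G) v (\<lambda>d. f (d + 1))" by (simp add: decomposes_gshift)
      then show ?thesis by blast
    qed
    show "f = f'" if "decomposes (gshift G) v f" "decomposes (gshift G) v f'" for v f f'
    proof
      fix d
      have "(\<lambda>d. f (d - 1)) = (\<lambda>d. f' (d - 1))"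
        using that unfolding decomposes_gshift by (rule decomposes_unique)
      from fun_cong[OF this, of "d + 1"] show "f d = f' d" by simp
    qed
  qed (use vector_space_smul subspace_hcomp finite_degrees in
      \<open>simp_all add: degrees_gshift vector_space_def module_def\<close>)
qed

section \<open>Direct sums of graded spaces\<close>

lemma gsum_simps [simp]:
  "smul (gsum G H) c v = (smul G c (fst v), smul H c (snd v))"
  "hcomp (gsum G H) d = hcomp G d \<times> hcomp H d"
  by (simp_all add: gsum_def case_prod_unfold)

lemma sum_fst: "fst (sum f I) = (\<Sum>i\<in>I. fst (f i))"
  and sum_snd: "snd (sum f I) = (\<Sum>i\<in>I. snd (f i))"
  by (induction I rule: infinite_finite_induct) simp_all

lemma vector_space_gsum:
  assumes "vector_space (smul G)" "vector_space (smul H)"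
  shows "vector_space (smul (gsum G H))"
proof -
  interpret G: vector_space "smul G" by fact
  interpret H: vector_space "smul H" by fact
  show ?thesis
    by unfold_locales (auto simp: prod_eq_iff G.scale_right_distrib H.scale_right_distrib
        G.scale_left_distrib H.scale_left_distrib)
qed

lemma graded_gsum:
  assumes "graded G" "graded H"
  shows "graded (gsum G H)" and "gcarrier (gsum G H) = gcarrier G \<times> gcarrier H"
proof -
  interpret G: graded G by fact
  interpret H: graded H by fact
  interpret GH: vector_space "smul (gsum G H)"
    by (rule vector_space_gsum G.vector_space_smul H.vector_space_smul)+
  have sub: "GH.subspace (hcomp (gsum G H) d)" for d
    by (rule GH.subspaceI)
      (auto simp: zero_prod_def G.hcomp_0 H.hcomp_0 G.hcomp_add H.hcomp_add G.hcomp_scale H.hcomp_scale)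
  \<comment> \<open>A pair and its two entries have different supports; all three sums are compared
    over the common finite set \<open>degrees G \<union> degrees H\<close>.\<close>
  have dec: "decomposes (gsum G H) v f \<longleftrightarrow>
      decomposes G (fst v) (\<lambda>d. fst (f d)) \<and> decomposes H (snd v) (\<lambda>d. snd (f d))" for v f
  proof (cases "\<forall>d. f d \<in> hcomp G d \<times> hcomp H d")
    case True
    then have h: "\<And>d. fst (f d) \<in> hcomp G d" "\<And>d. snd (f d) \<in> hcomp H d"
      by (auto simp: mem_Times_iff)
    let ?D = "degrees G \<union> degrees H"
    have D: "{d. f d \<noteq> 0} \<subseteq> ?D" "{d. fst (f d) \<noteq> 0} \<subseteq> ?D" "{d. snd (f d) \<noteq> 0} \<subseteq> ?D"
      using G.hcomp_degrees[OF h(1)] H.hcomp_degrees[OF h(2)] by (auto simp: prod_eq_iff)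
    have fin: "finite ?D" by (simp add: G.finite_degrees H.finite_degrees)
    have s: "(\<Sum>d | f d \<noteq> 0. f d) = (\<Sum>d\<in>?D. f d)"
        "(\<Sum>d | fst (f d) \<noteq> 0. fst (f d)) = (\<Sum>d\<in>?D. fst (f d))"
        "(\<Sum>d | snd (f d) \<noteq> 0. snd (f d)) = (\<Sum>d\<in>?D. snd (f d))"
      by (rule sum.mono_neutral_left[OF fin]; use D in auto)+
    have f: "finite {d. f d \<noteq> 0}" "finite {d. fst (f d) \<noteq> 0}" "finite {d. snd (f d) \<noteq> 0}"
      using D fin by (auto dest: finite_subset)
    show ?thesis
      unfolding decomposes_def s using True h f by (auto simp: prod_eq_iff sum_fst sum_snd)
  qed (auto simp: decomposes_def mem_Times_iff)
  have sub_c: "gcarrier (gsum G H) \<subseteq> gcarrier G \<times> gcarrier H"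
    unfolding gcarrier_def[of "gsum G H"]
    by (rule GH.span_minimal, force intro: G.hcomp_carrier H.hcomp_carrier, rule GH.subspaceI)
      (auto simp: zero_prod_def G.carrier_0 H.carrier_0 G.carrier_add H.carrier_add G.carrier_scale H.carrier_scale)
  have dec_ex: "\<exists>f. decomposes (gsum G H) v f" if v: "v \<in> gcarrier G \<times> gcarrier H" for v
  proof -
    obtain f g where "decomposes G (fst v) f" "decomposes H (snd v) g"
      using G.decomposes_ex[of "fst v"] H.decomposes_ex[of "snd v"] v by auto
    then have "decomposes (gsum G H) v (\<lambda>d. (f d, g d))" by (simp add: dec)
    then show ?thesis by blast
  qed
  show "graded (gsum G H)"
  proof
    show "\<exists>f. decomposes (gsum G H) v f" if "v \<in> gcarrier (gsum G H)" for v
      using that sub_c dec_ex by blast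
    show "f = f'" if "decomposes (gsum G H) v f" "decomposes (gsum G H) v f'" for v f f'
      using that G.decomposes_unique H.decomposes_unique unfolding dec prod_eq_iff fun_eq_iff by metis
    have "degrees (gsum G H) \<subseteq> degrees G \<union> degrees H"
      by (auto simp: degrees_def zero_prod_def)
    then show "finite (degrees (gsum G H))"
      by (rule finite_subset) (simp add: G.finite_degrees H.finite_degrees)
  qed (rule sub)
  show "gcarrier (gsum G H) = gcarrier G \<times> gcarrier H"
  proof
    show "gcarrier G \<times> gcarrier H \<subseteq> gcarrier (gsum G H)"
    proof
      fix v assume "v \<in> gcarrier G \<times> gcarrier H"
      then obtain f where "decomposes (gsum G H) v f" using dec_ex by blast
      then have f: "\<And>d. f d \<in> hcomp (gsum G H) d" "v = (\<Sum>d | f d \<noteq> 0. f d)"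
        by (auto simp: decomposes_def)
      show "v \<in> gcarrier (gsum G H)"
        unfolding f(2) gcarrier_def
        by (rule GH.span_sum, rule GH.span_base) (use f(1) in blast)
    qed
  qed (rule sub_c)
qed

section \<open>The graded dual\<close>

lemma smul_gdual: "smul (gdual G) c g = (\<lambda>x. c * g x)"
  by (simp add: gdual_def)

lemma vector_space_gdual: "vector_space (smul (gdual G))"
proof
  fix a b f g
  show "smul (gdual G) a (f + g) = smul (gdual G) a f + smul (gdual G) a g"
    by (rule ext) (simp add: smul_gdual distrib_left)
  show "smul (gdual G) (a + b) f = smul (gdual G) a f + smul (gdual G) b f"
    by (rule ext) (simp add: smul_gdual distrib_right)
  show "smul (gdual G) a (smul (gdual G) b f) = smul (gdual G) (a * b) f"
    by (rule ext) (simp add: smul_gdual mult.assoc)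
  show "smul (gdual G) 1 f = f"
    by (rule ext) (simp add: smul_gdual)
qed

lemma hcomp_gdual_iff: "g \<in> hcomp (gdual G) d \<longleftrightarrow>
    Vector_Spaces.linear (smul G) (*) g \<and> (\<forall>d' x. d' \<noteq> - d \<longrightarrow> x \<in> hcomp G d' \<longrightarrow> g x = 0)"
  by (simp add: gdual_def)

lemma gdual_vanish: "g \<in> hcomp (gdual G) d \<Longrightarrow> x \<in> hcomp G d' \<Longrightarrow> d' \<noteq> - d \<Longrightarrow> g x = 0"
  by (simp add: hcomp_gdual_iff)

text \<open>Linearity cuts the carrier out of the type of all functions. Hence existence of
  decompositions is proved for linear functionals only.\<close>

lemma graded_gdual:
  fixes G :: "('k::field, 'v::ab_group_add) gspace"
  assumes G: "graded G" and UN: "gcarrier G = UNIV"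
  shows "graded (gdual G)"
    and "gcarrier (gdual G) = {g. Vector_Spaces.linear (smul G) (*) g}"
proof -
  interpret graded G by fact
  interpret K: vector_space "(*) :: 'k \<Rightarrow> 'k \<Rightarrow> 'k"
    by unfold_locales (simp_all add: algebra_simps)
  interpret VK: vector_space_pair "smul G" "(*) :: 'k \<Rightarrow> 'k \<Rightarrow> 'k" ..
  let ?lin = "Vector_Spaces.linear (smul G) ((*) :: 'k \<Rightarrow> 'k \<Rightarrow> 'k)"
  interpret D: vector_space "smul (gdual G)"
    by (rule vector_space_gdual)
  have lin_0: "?lin 0"
    using VK.linear_zero by (simp add: zero_fun_def)
  have lin_add: "?lin (f + g)" if "?lin f" "?lin g" for f g
    using VK.linear_compose_add[OF that] by (simp add: plus_fun_def)
  have lin_scale: "?lin (smul (gdual G) c f)" if "?lin f" for c f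
    using VK.linear_compose_scale_right[OF that, of c] by (simp add: smul_gdual)
  have sub: "D.subspace (hcomp (gdual G) d)" for d
    by (rule D.subspaceI)
      (auto simp: hcomp_gdual_iff lin_0 lin_add intro!: lin_scale, auto simp: smul_gdual)
  have sum_fun: "sum f I x = (\<Sum>i\<in>I. f i x)" for f :: "int \<Rightarrow> 'v \<Rightarrow> 'k" and I x
    by (induction I rule: infinite_finite_induct) simp_all
  have ex: "\<exists>f. decomposes (gdual G) g f" if g: "?lin g" for g
  proof -
    interpret g: Vector_Spaces.linear "smul G" "(*)" g by fact
    \<comment> \<open>The component of degree \<open>d\<close> of a functional is its restriction to
      the summand of degree \<open>- d\<close>, extended by zero.\<close>
    define f where "f d x = g (gproj G (- d) x)" for d x
    have f: "f d \<in> hcomp (gdual G) d" for d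
    proof -
      have "?lin (f d)"
        by unfold_locales (simp_all add: f_def gproj_add gproj_scale UN g.add g.scale)
      then show ?thesis
        by (auto simp: hcomp_gdual_iff f_def gproj_homogeneous g.zero)
    qed
    have z: "f d = 0" if "- d \<notin> degrees G" for d
    proof
      fix x
      have "gproj G (- d) x = 0"
        using hcomp_degrees[OF gproj_hcomp, of x "- d"] that by (auto simp: UN)
      then show "f d x = 0 x" by (simp add: f_def g.zero)
    qed
    have sub: "{d. f d \<noteq> 0} \<subseteq> uminus ` degrees G"
      using z by (force simp: image_iff)
    have fin: "finite (uminus ` degrees G)" by (simp add: finite_degrees)
    have "(\<Sum>d | f d \<noteq> 0. f d) = (\<Sum>d\<in>uminus ` degrees G. f d)"
      by (rule sum.mono_neutral_left[OF fin sub]) auto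
    also have "\<dots> = g"
    proof
      fix x
      have "(\<Sum>d\<in>uminus ` degrees G. f d) x = (\<Sum>d\<in>degrees G. g (gproj G d x))"
        unfolding sum_fun by (subst sum.reindex) (auto simp: inj_on_def f_def)
      also have "\<dots> = g x"
        unfolding g.sum[symmetric] by (simp add: sum_gproj UN)
      finally show "(\<Sum>d\<in>uminus ` degrees G. f d) x = g x" .
    qed
    finally have "decomposes (gdual G) g f"
      using f finite_subset[OF sub fin] by (simp add: decomposes_def)
    then show ?thesis by blast
  qed
  \<comment> \<open>The component of degree \<open>d\<close> is determined by its values on the
    summand of degree \<open>- d\<close>, where all other components vanish and it therefore equals
    \<open>g\<close>.\<close>
  have uniq: "f = f'" if "decomposes (gdual G) g f" "decomposes (gdual G) g f'" for g f f'
  proof -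
    have val: "h d (gproj G (- d) x) = g (gproj G (- d) x)" if "decomposes (gdual G) g h" for h d x
    proof -
      have h: "h e \<in> hcomp (gdual G) e" "finite {e. h e \<noteq> 0}" "g = (\<Sum>e | h e \<noteq> 0. h e)" for e
        using that by (auto simp: decomposes_def)
      have z: "h e (gproj G (- d) x) = 0" if "e \<noteq> d" for e
        by (rule gdual_vanish[OF h(1) gproj_hcomp]) (use that in \<open>simp_all add: UN\<close>)
      have "g (gproj G (- d) x) = (\<Sum>e | h e \<noteq> 0. h e (gproj G (- d) x))"
        by (subst h(3)) (rule sum_fun)
      also have "\<dots> = (\<Sum>e | h e \<noteq> 0. if e = d then h d (gproj G (- d) x) else 0)"
        by (rule sum.cong) (auto simp: z)
      also have "\<dots> = h d (gproj G (- d) x)"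
        using h(2) by (auto simp: sum.delta)
      finally show ?thesis ..
    qed
    have h_proj: "h d x = h d (gproj G (- d) x)" if "decomposes (gdual G) g h" for h d x
    proof -
      have h: "h d \<in> hcomp (gdual G) d"
        using that by (auto simp: decomposes_def)
      then interpret hd: Vector_Spaces.linear "smul G" "(*)" "h d"
        by (simp add: hcomp_gdual_iff)
      have "h d x = (\<Sum>e\<in>degrees G. h d (gproj G e x))"
        unfolding hd.sum[symmetric] by (simp add: sum_gproj UN)
      also have "\<dots> = (\<Sum>e\<in>degrees G. if e = - d then h d (gproj G (- d) x) else 0)"
        by (rule sum.cong) (use gdual_vanish[OF h gproj_hcomp] in \<open>auto simp: UN\<close>)
      also have "\<dots> = h d (gproj G (- d) x)"
        using hcomp_degrees[OF gproj_hcomp, of x "- d"] finite_degrees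
        by (cases "gproj G (- d) x = 0") (auto simp: sum.delta UN hd.zero)
      finally show ?thesis .
    qed
    show "f = f'"
    proof (intro ext)
      fix d x
      show "f d x = f' d x"
        using h_proj[OF that(1)] h_proj[OF that(2)] val[OF that(1)] val[OF that(2)] by metis
    qed
  qed
  show carrier: "gcarrier (gdual G) = {g. ?lin g}"
  proof
    show "gcarrier (gdual G) \<subseteq> {g. ?lin g}"
      unfolding gcarrier_def
      by (rule D.span_minimal, force simp: hcomp_gdual_iff, rule D.subspaceI)
        (simp_all add: lin_0 lin_add lin_scale)
    show "{g. ?lin g} \<subseteq> gcarrier (gdual G)"
    proof clarify
      fix g assume "?lin g"
      from ex[OF this] obtain f where "decomposes (gdual G) g f" ..
      then have f: "\<And>d. f d \<in> hcomp (gdual G) d" "g = (\<Sum>d | f d \<noteq> 0. f d)"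
        by (auto simp: decomposes_def)
      show "g \<in> gcarrier (gdual G)"
        unfolding f(2) gcarrier_def by (rule D.span_sum, rule D.span_base) (use f(1) in blast)
    qed
  qed
  show "graded (gdual G)"
  proof
    have "degrees (gdual G) \<subseteq> uminus ` degrees G"
    proof
      fix d assume "d \<in> degrees (gdual G)"
      then obtain g where g: "g \<in> hcomp (gdual G) d" "g \<noteq> 0"
        using D.subspace_0[OF sub, of d] by (auto simp: degrees_def)
      then interpret g: Vector_Spaces.linear "smul G" "(*)" g
        by (simp add: hcomp_gdual_iff)
      obtain x where "g x \<noteq> 0" using g(2) by (auto simp: fun_eq_iff)
      moreover have "g x = (\<Sum>e\<in>degrees G. g (gproj G e x))"
        unfolding g.sum[symmetric] by (simp add: sum_gproj UN)
      ultimately obtain e where e: "e \<in> degrees G" "g (gproj G e x) \<noteq> 0"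
        by (metis (mono_tags, lifting) sum.neutral)
      then have "e = - d"
        using gdual_vanish[OF g(1) gproj_hcomp, of x e] by (auto simp: UN)
      then show "d \<in> uminus ` degrees G" using e(1) by (force simp: image_iff)
    qed
    then show "finite (degrees (gdual G))"
      by (rule finite_subset) (simp add: finite_degrees)
  qed (use sub ex uniq carrier in auto)
qed

section \<open>Additive maps and bilinear maps on the carrier\<close>

context graded
begin

lemma additive_sum:
  assumes add: "\<And>x y. x \<in> gcarrier G \<Longrightarrow> y \<in> gcarrier G \<Longrightarrow> f (x + y) = f x + f y"
    and "\<And>j. j \<in> J \<Longrightarrow> v j \<in> gcarrier G"
  shows "f (\<Sum>j\<in>J. v j) = (\<Sum>j\<in>J. f (v j) :: 'w::ab_group_add)"
proof -
  have "f 0 = 0" using add[of 0 0] carrier_0 by simp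
  then show ?thesis
    using assms(2) by (induction J rule: infinite_finite_induct) (simp_all add: add carrier_sum)
qed

text \<open>The comparison principle for a single argument, meant for expressions that are not given
  as functions of a list.\<close>

lemma additive_ext:
  fixes f g :: "'v \<Rightarrow> 'w::ab_group_add"
  assumes f: "\<And>x y. x \<in> gcarrier G \<Longrightarrow> y \<in> gcarrier G \<Longrightarrow> f (x + y) = f x + f y"
    and g: "\<And>x y. x \<in> gcarrier G \<Longrightarrow> y \<in> gcarrier G \<Longrightarrow> g (x + y) = g x + g y"
    and eq: "\<And>d x. x \<in> hcomp G d \<Longrightarrow> f x = g x" and v: "v \<in> gcarrier G"
  shows "f v = g v"
proof -
  have "f (\<Sum>d\<in>degrees G. gproj G d v) = g (\<Sum>d\<in>degrees G. gproj G d v)"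
    by (subst additive_sum[of f], (simp add: f gproj_carrier v)+, subst additive_sum[of g])
      (simp_all add: g gproj_carrier v eq[OF gproj_hcomp[OF v]])
  then show ?thesis by (simp add: sum_gproj v)
qed

lemma mlin_2I:
  assumes "\<And>u u' v a. u \<in> gcarrier G \<Longrightarrow> u' \<in> gcarrier G \<Longrightarrow> v \<in> gcarrier G \<Longrightarrow>
      F [u + u', v] = F [u, v] + F [u', v] \<and> F [v, u + u'] = F [v, u] + F [v, u'] \<and>
      F [smul G a u, v] = s a (F [u, v]) \<and> F [v, smul G a u] = s a (F [v, u])"
  shows "mlin s 2 F"
proof (rule mlinI)
  fix vs x y a and i :: nat
  assume a: "vs \<in> tuples G 2" "length vs = 2" "i < 2" "x \<in> gcarrier G" "y \<in> gcarrier G"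
  then obtain u v where vs: "vs = [u, v]"
    by (auto simp: length_Suc_conv numeral_2_eq_2)
  with a have "u \<in> gcarrier G" "v \<in> gcarrier G" "i = 0 \<or> i = 1"
    by (auto simp: tuples_def)
  then show "F (vs[i := x + y]) = F (vs[i := x]) + F (vs[i := y]) \<and>
      F (vs[i := smul G a x]) = s a (F (vs[i := x]))"
    using assms a(4,5) by (auto simp: vs)
qed

lemma mlin_2D:
  assumes "mlin s 2 F" "u \<in> gcarrier G" "u' \<in> gcarrier G" "v \<in> gcarrier G"
  shows "F [u + u', v] = F [u, v] + F [u', v]" "F [v, u + u'] = F [v, u] + F [v, u']"
    and "F [smul G a u, v] = s a (F [u, v])" "F [v, smul G a u] = s a (F [v, u])"
  using mlinD(1)[OF assms(1), of "[u, v]" 0 u u'] mlinD(1)[OF assms(1), of "[v, u]" 1 u u']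
    mlinD(2)[OF assms(1), of "[u, v]" 0 u a] mlinD(2)[OF assms(1), of "[v, u]" 1 u a] assms(2-)
  by (simp_all add: tuples_def)

end

section \<open>The double semidirect product\<close>

lemma vector_space_field: "vector_space ((*) :: 'k::field \<Rightarrow> 'k \<Rightarrow> 'k)"
  by unfold_locales (simp_all add: algebra_simps)

lemma smul_ground [simp]: "smul ground = (*)"
  by (simp add: ground_def)

lemma gcarrier_ground [simp]: "gcarrier (ground :: ('k::field, 'k) gspace) = UNIV"
proof -
  interpret vector_space "(*) :: 'k \<Rightarrow> 'k \<Rightarrow> 'k" by (rule vector_space_field)
  have "(\<Union>d. hcomp (ground :: ('k, 'k) gspace) d) = UNIV"
    by (auto simp: ground_def split: if_splits)
  then show ?thesis by (simp add: gcarrier_def span_UNIV)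
qed

section \<open>Evaluation of functionals on \<open>W\<close>\<close>

abbreviation wpart :: "('k, 'v, 'm) double \<Rightarrow> 'v \<times> 'm" where
  "wpart v \<equiv> (fst v, fst (snd v))"

abbreviation fpart :: "('k, 'v, 'm) double \<Rightarrow> ('v \<Rightarrow> 'k) \<times> ('m \<Rightarrow> 'k)" where
  "fpart v \<equiv> snd (snd v)"

definition ev :: "('v \<Rightarrow> 'k) \<times> ('m \<Rightarrow> 'k) \<Rightarrow> 'v \<times> 'm \<Rightarrow> 'k::field" where
  "ev f w = fst f (fst w) + snd f (snd w)"

lemma VS_linear_0: "Vector_Spaces.linear s1 s2 f \<Longrightarrow> f 0 = 0"
  unfolding Vector_Spaces.linear_def by (blast intro: module_hom.zero)

locale module_double =
  fixes V :: "('k::field_char_0, 'v::ab_group_add) gspace"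
    and M :: "('k, 'm::ab_group_add) gspace"
    and q :: "'v list \<Rightarrow> 'v"
    and act :: "'v \<Rightarrow> 'm \<Rightarrow> 'm"
  assumes graded_space_V: "graded_space V" and graded_space_M: "graded_space M"
    and lie_algebra: "lie_algebra V q" and lie_module: "lie_module V q M act"
begin

abbreviation "W \<equiv> gsum V M"
abbreviation "D \<equiv> double_space V M"
abbreviation "T \<equiv> shifted_double V M"
abbreviation "SB \<equiv> semidirect_bracket V M q act"

sublocale V: graded V by (rule graded_space_graded[OF graded_space_V])
sublocale M: graded M by (rule graded_space_graded[OF graded_space_M])

lemma carrier_V [simp]: "gcarrier V = UNIV" and carrier_M [simp]: "gcarrier M = UNIV"
  by (rule graded_space_carrier graded_space_V graded_space_M)+

sublocale V': graded "gdual V" by (rule graded_gdual[OF V.graded_axioms carrier_V])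
sublocale M': graded "gdual M" by (rule graded_gdual[OF M.graded_axioms carrier_M])
sublocale W: graded W by (rule graded_gsum V.graded_axioms M.graded_axioms)+
sublocale W': graded "gsum (gdual V) (gdual M)" by (rule graded_gsum V'.graded_axioms M'.graded_axioms)+
sublocale D: graded D unfolding double_space_def by (rule graded_gsum V.graded_axioms M.graded_axioms W'.graded_axioms)+
sublocale T: graded T by (rule graded_gshift D.graded_axioms)+
sublocale sV: graded "gshift V" by (rule graded_gshift V.graded_axioms)+

lemma carrier_W [simp]: "gcarrier W = UNIV"
  by (simp add: graded_gsum(2)[OF V.graded_axioms M.graded_axioms])

lemma carrier_V': "gcarrier (gdual V) = {g. Vector_Spaces.linear (smul V) (*) g}"
  and carrier_M': "gcarrier (gdual M) = {g. Vector_Spaces.linear (smul M) (*) g}"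
  by (rule graded_gdual(2) V.graded_axioms M.graded_axioms carrier_V carrier_M)+

lemma carrier_D_iff: "v \<in> gcarrier D \<longleftrightarrow>
    Vector_Spaces.linear (smul V) (*) (fst (fpart v)) \<and> Vector_Spaces.linear (smul M) (*) (snd (fpart v))"
  unfolding double_space_def graded_gsum(2)[OF V.graded_axioms graded_gsum(1)[OF M.graded_axioms W'.graded_axioms]]
    graded_gsum(2)[OF M.graded_axioms W'.graded_axioms] graded_gsum(2)[OF V'.graded_axioms M'.graded_axioms]
    carrier_V' carrier_M'
  by (auto simp: mem_Times_iff)

lemma hcomp_D_iff: "v \<in> hcomp D d \<longleftrightarrow>
    wpart v \<in> hcomp W d \<and> fpart v \<in> hcomp (gsum (gdual V) (gdual M)) d"
  by (auto simp: double_space_def mem_Times_iff)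

lemma smul_D: "smul D a v = (smul V a (fst v), smul M a (fst (snd v)), smul (gsum (gdual V) (gdual M)) a (fpart v))"
  by (simp add: double_space_def)

lemma ev_add_left: "ev (f + f') w = ev f w + ev f' w"
  and ev_minus_left: "ev (- f) w = - ev f w"
  and ev_diff_left: "ev (f - f') w = ev f w - ev f' w"
  and ev_sg_left: "ev (sg n f) w = sg n (ev f w)"
  and ev_zero_left: "ev 0 w = 0"
  and ev_scale_left: "ev (smul (gsum (gdual V) (gdual M)) a f) w = a * ev f w"
  for f f' :: "('v \<Rightarrow> 'k) \<times> ('m \<Rightarrow> 'k)"
  by (simp_all add: ev_def sg_def smul_gdual algebra_simps)

lemma ev_right:
  assumes "v \<in> gcarrier D"
  shows "ev (fpart v) (w + w') = ev (fpart v) w + ev (fpart v) w'"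
    and "ev (fpart v) (smul W a w) = a * ev (fpart v) w"
    and "ev (fpart v) 0 = 0" and "ev (fpart v) (sg n w) = sg n (ev (fpart v) w)"
proof -
  interpret g: Vector_Spaces.linear "smul V" "(*)" "fst (fpart v)" using assms by (simp add: carrier_D_iff)
  interpret h: Vector_Spaces.linear "smul M" "(*)" "snd (fpart v)" using assms by (simp add: carrier_D_iff)
  show "ev (fpart v) (w + w') = ev (fpart v) w + ev (fpart v) w'"
    and "ev (fpart v) (smul W a w) = a * ev (fpart v) w"
    and "ev (fpart v) 0 = 0" and "ev (fpart v) (sg n w) = sg n (ev (fpart v) w)"
    by (simp_all add: ev_def g.add h.add g.scale h.scale g.zero h.zero g.neg h.neg sg_def algebra_simps)
qed

text \<open>A functional of degree \<open>d\<close> sees only vectors of degree \<open>- d\<close>.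
  Comparisons of signs that hold only on the support of the form go back to this.\<close>

lemma ev_vanish:
  "v \<in> hcomp D d \<Longrightarrow> w \<in> hcomp W d' \<Longrightarrow> d' \<noteq> - d \<Longrightarrow> ev (fpart v) w = 0"
  using gdual_vanish[of "fst (fpart v)" V d "fst w" d'] gdual_vanish[of "snd (fpart v)" M d "snd w" d']
  by (auto simp: hcomp_D_iff ev_def mem_Times_iff)

lemma q_mlin: "V.mlin (smul V) 2 q"
  using lie_algebra by (auto simp: lie_algebra_def V.multilinear_iff)

lemmas q_bilinear = V.mlin_2D[OF q_mlin, simplified]

lemma q_zero: "q [0, y] = 0" "q [x, 0] = 0"
  using V.mlin_zero[OF q_mlin, of "[0, y]"] V.mlin_zero[OF q_mlin, of "[x, 0]"]
  by (auto simp: tuples_def)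

lemma q_hcomp: "x \<in> hcomp V d \<Longrightarrow> y \<in> hcomp V d' \<Longrightarrow> q [x, y] \<in> hcomp V (d + d')"
proof -
  assume "x \<in> hcomp V d" "y \<in> hcomp V d'"
  moreover have "has_degree V V 2 0 q" using lie_algebra by (simp add: lie_algebra_def)
  ultimately show ?thesis
    unfolding has_degree_def by (metis (no_types, lifting) One_nat_def Suc_1 add.right_neutral
        length_Cons list.rel_inject(2) list.rel_intros(1) list.size(3) sum_list.Cons sum_list.Nil)
qed

lemma q_skew: "x \<in> hcomp V d \<Longrightarrow> y \<in> hcomp V d' \<Longrightarrow> q [y, x] = - sg (d * d') (q [x, y])"
proof -
  assume a: "x \<in> hcomp V d" "y \<in> hcomp V d'"
  have "skew_sym V 2 q" using lie_algebra by (simp add: lie_algebra_def)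
  from this[unfolded skew_sym_def, rule_format, of "[]" x y "[]", OF _ a] show ?thesis
    by (simp add: tuples_def)
qed

lemma act_bilinear:
  "act (x + x') a = act x a + act x' a" "act x (a + a') = act x a + act x a'"
  "act (smul V c x) a = smul M c (act x a)" "act x (smul M c a) = smul M c (act x a)"
  "act 0 a = 0" "act x 0 = 0" "act x (- a) = - act x a"
proof -
  have r: "Vector_Spaces.linear (smul M) (smul M) (act x)" for x
    using lie_module by (simp add: lie_module_def)
  have l: "Vector_Spaces.linear (smul V) (smul M) (\<lambda>x. act x a)" for a
    using lie_module by (simp add: lie_module_def)
  interpret r: Vector_Spaces.linear "smul M" "smul M" "act x" by (rule r)
  interpret l: Vector_Spaces.linear "smul V" "smul M" "\<lambda>x. act x a" by (rule l)
  show "act (x + x') a = act x a + act x' a" "act x (a + a') = act x a + act x a'"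
    "act (smul V c x) a = smul M c (act x a)" "act x (smul M c a) = smul M c (act x a)"
    "act 0 a = 0" "act x 0 = 0" "act x (- a) = - act x a"
    by (rule r.add l.add r.scale l.scale r.zero l.zero r.neg)+
qed

lemma act_hcomp: "x \<in> hcomp V d \<Longrightarrow> a \<in> hcomp M d' \<Longrightarrow> act x a \<in> hcomp M (d + d')"
  using lie_module by (simp add: lie_module_def)

text \<open>The bracket of \<open>W\<close> with the degrees as explicit parameters, hence free of
  projections; on homogeneous vectors it agrees with \<open>SB\<close>.\<close>

definition sb :: "int \<Rightarrow> 'v \<times> 'm \<Rightarrow> int \<Rightarrow> 'v \<times> 'm \<Rightarrow> 'v \<times> 'm" where
  "sb d w d' w' = (q [fst w, fst w'], act (fst w) (snd w') - sg (d * d') (act (fst w') (snd w)))"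

lemma sb_mlin: "W.mlin (smul W) 2 (\<lambda>ws. sb d (ws ! 0) d' (ws ! 1))"
  by (rule W.mlin_2I) (simp add: sb_def q_bilinear act_bilinear sg_def algebra_simps
      V.scale_right_distrib M.scale_right_distrib M.scale_right_diff_distrib)

lemma SB_mlin: "W.mlin (smul W) 2 SB"
  unfolding semidirect_bracket_def
  by (rule W.mlin_multihom[OF W.vector_space_smul])
    (use sb_mlin in \<open>simp add: sb_def Let_def case_prod_unfold\<close>)

lemmas SB_bilinear = W.mlin_2D[OF SB_mlin, unfolded carrier_W, OF UNIV_I UNIV_I UNIV_I]

lemma SB_zero: "SB [0, w] = 0" "SB [w, 0] = 0"
  using W.mlin_zero[OF SB_mlin, of "[0, w]"] W.mlin_zero[OF SB_mlin, of "[w, 0]"]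
  by (auto simp: tuples_def)

lemma SB_homog:
  assumes "w \<in> hcomp W d" "w' \<in> hcomp W d'"
  shows "SB [w, w'] = sb d w d' w'"
proof -
  have "SB (map snd [(d, w), (d', w')]) = (\<lambda>ds ws. sb (ds ! 0) (ws ! 0) (ds ! 1) (ws ! 1))
      (map fst [(d, w), (d', w')]) (map snd [(d, w), (d', w')])"
    unfolding semidirect_bracket_def
    by (subst W.multihom_mlin_homog[where s = "smul W"])
      (use assms sb_mlin in \<open>simp_all add: sb_def Let_def case_prod_unfold numeral_2_eq_2\<close>)
  then show ?thesis by simp
qed

lemma sb_hcomp:
  assumes "w \<in> hcomp W d" "w' \<in> hcomp W d'"
  shows "sb d w d' w' \<in> hcomp W (d + d')"
proof -
  have "act (fst w') (snd w) \<in> hcomp M (d + d')"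
    using act_hcomp[of "fst w'" d' "snd w" d] assms by (auto simp: add.commute)
  then show ?thesis
    using assms by (auto simp: sb_def intro!: q_hcomp act_hcomp M.subspace_diff[OF M.subspace_hcomp] M.hcomp_sg)
qed

lemma SB_skew:
  assumes "w \<in> hcomp W d" "w' \<in> hcomp W d'"
  shows "SB [w', w] = - sg (d * d') (SB [w, w'])"
  using assms q_skew[of "fst w" d "fst w'" d']
  by (auto simp: SB_homog[OF assms] SB_homog[OF assms(2,1)] sb_def sg_def mult.commute)

abbreviation "da \<equiv> dual_act V M q act"

text \<open>\<open>dual_act\<close> stores a functional by its values on \<open>V\<close> and on
  \<open>M\<close> separately; additivity of the bracket and of the functional joins them to the
  defining relation of the dual module.\<close>

lemma ev_dual_act:
  assumes "v \<in> gcarrier D"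
  shows "ev (da d w d' (fpart v)) w' = - sg (d * d') (ev (fpart v) (SB [w, w']))"
proof -
  have w': "w' = (fst w', 0) + (0, snd w')" by simp
  have "ev (da d w d' (fpart v)) w'
      = - sg (d * d') (ev (fpart v) (SB [w, (fst w', 0)])) - sg (d * d') (ev (fpart v) (SB [w, (0, snd w')]))"
    by (simp add: dual_act_def ev_def Let_def)
  also have "\<dots> = - sg (d * d') (ev (fpart v) (SB [w, (fst w', 0)] + SB [w, (0, snd w')]))"
    by (simp add: ev_right[OF assms] sg_add)
  finally show ?thesis
    unfolding SB_bilinear(2)[symmetric] by simp
qed

lemma dual_act_linear:
  assumes "v \<in> gcarrier D"
  shows "Vector_Spaces.linear (smul V) (*) (fst (da d w d' (fpart v)))"
    and "Vector_Spaces.linear (smul M) (*) (snd (da d w d' (fpart v)))"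
proof -
  let ?f = "da d w d' (fpart v)"
  have add: "ev ?f (w + w') = ev ?f w + ev ?f w'" and scale: "ev ?f (smul W c w) = c * ev ?f w" for w w' c
    by (simp_all add: ev_dual_act[OF assms] SB_bilinear ev_right[OF assms] sg_add sg_mult_right del: gsum_simps)
  have f0: "fst ?f 0 = 0" "snd ?f 0 = 0"
    using ev_right(3)[OF assms] by (simp_all add: dual_act_def Let_def ev_def SB_zero flip: zero_prod_def)
  have e: "fst ?f y = ev ?f (y, 0)" "snd ?f b = ev ?f (0, b)" for y b
    by (simp_all add: ev_def f0)
  show "Vector_Spaces.linear (smul V) (*) (fst ?f)"
    unfolding Vector_Spaces.linear_iff
    using add[of "(_, 0)" "(_, 0)"] scale[of _ "(_, 0)"]
    by (simp add: e V.vector_space_smul vector_space_field)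
  show "Vector_Spaces.linear (smul M) (*) (snd ?f)"
    unfolding Vector_Spaces.linear_iff
    using add[of "(0, _)" "(0, _)"] scale[of _ "(0, _)"]
    by (simp add: e M.vector_space_smul vector_space_field)
qed

lemma dual_act_hcomp:
  assumes w: "w \<in> hcomp W d" and v: "v \<in> hcomp D d'"
  shows "da d w d' (fpart v) \<in> hcomp (gsum (gdual V) (gdual M)) (d + d')"
proof -
  have c: "v \<in> gcarrier D" by (rule D.hcomp_carrier[OF v])
  let ?f = "da d w d' (fpart v)"
  have "fst ?f 0 = 0" "snd ?f 0 = 0"
    using dual_act_linear[OF c, of d w d', THEN VS_linear_0] by auto
  then have e: "fst ?f y = ev ?f (y, 0)" "snd ?f b = ev ?f (0, b)" for y b
    by (simp_all add: ev_def)
  have z: "ev ?f w' = 0" if "w' \<in> hcomp W d''" "d'' \<noteq> - (d + d')" for w' d''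
    unfolding ev_dual_act[OF c] SB_homog[OF w that(1)]
    using ev_vanish[OF v sb_hcomp[OF w that(1)]] that(2) by simp
  have "fst ?f y = 0" if "y \<in> hcomp V d''" "d'' \<noteq> - (d + d')" for y d''
    unfolding e by (rule z[OF _ that(2)]) (simp add: that M.hcomp_0)
  moreover have "snd ?f b = 0" if "b \<in> hcomp M d''" "d'' \<noteq> - (d + d')" for b d''
    unfolding e by (rule z[OF _ that(2)]) (simp add: that V.hcomp_0)
  ultimately show ?thesis
    using dual_act_linear[OF c] by (auto simp: mem_Times_iff hcomp_gdual_iff)
qed

text \<open>The bracket of the double at given degrees. Its two halves are the bracket of
  \<open>W\<close> and the antisymmetrized coadjoint action.\<close>

definition dbr :: "int \<Rightarrow> ('k, 'v, 'm) double \<Rightarrow> int \<Rightarrow> ('k, 'v, 'm) double \<Rightarrow> ('k, 'v, 'm) double" where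
  "dbr d u d' v = (let w = sb d (wpart u) d' (wpart v) in (fst w, snd w,
     da d (wpart u) d' (fpart v) - sg (d * d') (da d' (wpart v) d (fpart u))))"

text \<open>A constant moved from one component of the pair to the other is invisible to
  \<open>ev\<close>, hence the two conditions at zero.\<close>

lemma ev_ext:
  assumes "\<And>w. ev f w = ev g w" and "fst f 0 = fst g 0" and "snd f 0 = snd g 0"
  shows "f = g"
proof -
  have "fst f y = fst g y" for y
    using assms(1)[of "(y, 0)"] assms(3) by (simp add: ev_def)
  moreover have "snd f y = snd g y" for y
    using assms(1)[of "(0, y)"] assms(2) by (simp add: ev_def)
  ultimately show ?thesis by (simp add: prod_eq_iff fun_eq_iff)
qed

lemma dual_act_zero:
  assumes v: "v \<in> gcarrier D" and "w = 0 \<or> fpart v = 0"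
  shows "da d w d' (fpart v) = 0"
proof (rule ev_ext)
  show "ev (da d w d' (fpart v)) w' = ev 0 w'" for w'
    using assms(2) by (auto simp: ev_dual_act[OF v] SB_zero ev_right[OF v] ev_zero_left)
  show "fst (da d w d' (fpart v)) 0 = fst 0 0" "snd (da d w d' (fpart v)) 0 = snd 0 0"
    using dual_act_linear[OF v, of d w d', THEN VS_linear_0] by auto
qed

text \<open>Vanishing on zero arguments of any nominal degree is what \<open>multihom_homog\<close>
  asks for; it stands in for multilinearity of the double bracket.\<close>

lemma dbr_zero:
  assumes "u \<in> hcomp D d" "v \<in> hcomp D d'" and "u = 0 \<or> v = 0"
  shows "dbr d u d' v = 0"
proof -
  have uv: "wpart u = 0 \<or> fpart v = 0" "wpart v = 0 \<or> fpart u = 0" "wpart u = 0 \<or> wpart v = 0"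
    using assms(3) by (auto simp: zero_prod_def)
  have "sb d (wpart u) d' (wpart v) = 0"
    using uv(3) by (auto simp: sb_def q_zero act_bilinear zero_prod_def)
  moreover have "da d (wpart u) d' (fpart v) = 0"
    by (rule dual_act_zero[OF D.hcomp_carrier[OF assms(2)] uv(1)])
  moreover have "da d' (wpart v) d (fpart u) = 0"
    by (rule dual_act_zero[OF D.hcomp_carrier[OF assms(1)] uv(2)])
  ultimately have "dbr d u d' v = (0, 0, 0)"
    unfolding dbr_def Let_def by simp
  then show ?thesis by (simp only: zero_prod_def)
qed

lemma dbr_hcomp:
  assumes u: "u \<in> hcomp D d" and v: "v \<in> hcomp D d'"
  shows "dbr d u d' v \<in> hcomp D (d + d')"
proof -
  have w: "wpart u \<in> hcomp W d" "wpart v \<in> hcomp W d'"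
    using u v by (simp_all only: hcomp_D_iff)
  have "da d' (wpart v) d (fpart u) \<in> hcomp (gsum (gdual V) (gdual M)) (d + d')"
    using dual_act_hcomp[OF w(2) u] by (simp only: add.commute)
  then have "da d (wpart u) d' (fpart v) - sg (d * d') (da d' (wpart v) d (fpart u))
      \<in> hcomp (gsum (gdual V) (gdual M)) (d + d')"
    by (intro W'.subspace_diff[OF W'.subspace_hcomp] W'.hcomp_sg dual_act_hcomp w v)
  with sb_hcomp[OF w] show ?thesis
    unfolding hcomp_D_iff by (simp add: dbr_def Let_def)
qed

lemma double_bracket_homog:
  assumes "u \<in> hcomp D d" "v \<in> hcomp D d'"
  shows "double_bracket V M q act [u, v] = dbr d u d' v"
proof -
  have eq: "(let d = ds ! 0; d' = ds ! 1; (x, a, g, h) = us ! 0; (x', a', g', h') = us ! 1;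
           (g1, h1) = da d (x, a) d' (g', h'); (g2, h2) = da d' (x', a') d (g, h)
       in (q [x, x'], act x a' - sg (d * d') (act x' a), g1 - sg (d * d') g2, h1 - sg (d * d') h2))
     = dbr (ds ! 0) (us ! 0) (ds ! 1) (us ! 1)" for ds us
    by (simp add: Let_def case_prod_unfold dbr_def sb_def prod_eq_iff sg_def)
  have "double_bracket V M q act (map snd [(d, u), (d', v)])
      = dbr (map fst [(d, u), (d', v)] ! 0) (map snd [(d, u), (d', v)] ! 0)
          (map fst [(d, u), (d', v)] ! 1) (map snd [(d, u), (d', v)] ! 1)"
    unfolding double_bracket_def eq
  proof (rule D.multihom_homog)
    fix ys :: "(int \<times> ('k, 'v, 'm) double) list"
    assume ys: "length ys = length [(d, u), (d', v)]" "D.homog ys" "0 \<in> set (vecs ys)"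
    then obtain y z where "ys = [y, z]" by (auto simp: length_Suc_conv)
    with ys show "dbr (degs ys ! 0) (vecs ys ! 0) (degs ys ! 1) (vecs ys ! 1) = 0"
      by (auto intro!: dbr_zero)
  qed (use assms in simp)
  then show ?thesis by simp
qed

section \<open>The invariant symmetric form\<close>

abbreviation "b \<equiv> double_form V M"

lemma b_mlin: "D.mlin (*) 2 b"
  unfolding double_form_def
proof (rule D.mlin_multihom[OF vector_space_field])
  fix ds
  have "D.mlin (*) 2 (\<lambda>us. ev (fpart (us ! 0)) (wpart (us ! 1)) + sg (ds ! 0 * ds ! 1) (ev (fpart (us ! 1)) (wpart (us ! 0))))"
  proof (rule D.mlin_2I, intro conjI)
    fix u u' v a assume c: "u \<in> gcarrier D" "u' \<in> gcarrier D" "v \<in> gcarrier D"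
    have s: "wpart (x + y) = wpart x + wpart y" "wpart (smul D a x) = smul W a (wpart x)"
      "fpart (x + y) = fpart x + fpart y" "fpart (smul D a x) = smul (gsum (gdual V) (gdual M)) a (fpart x)" for x y
      by (simp_all add: smul_D)
    note r = ev_right[OF c(3)] ev_add_left ev_scale_left
    let ?F = "\<lambda>us. ev (fpart (us ! 0)) (wpart (us ! 1)) + sg (ds ! 0 * ds ! 1) (ev (fpart (us ! 1)) (wpart (us ! 0)))"
    show "?F [u + u', v] = ?F [u, v] + ?F [u', v]" "?F [v, u + u'] = ?F [v, u] + ?F [v, u']"
      "?F [smul D a u, v] = a * ?F [u, v]" "?F [v, smul D a u] = a * ?F [v, u]"
      by (simp_all only: nth_Cons_0 nth_Cons_Suc One_nat_def s r sg_add sg_mult_right distrib_left add_ac)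
  qed
  then show "D.mlin (*) 2 (\<lambda>us. let (x, a, g, h) = us ! 0; (x', a', g', h') = us ! 1
       in g x' + h a' + sg (ds ! 0 * ds ! 1) (g' x + h' a))"
    by (simp add: case_prod_unfold Let_def ev_def)
qed

lemmas b_bilinear = D.mlin_2D[OF b_mlin]

lemma b_homog:
  assumes "u \<in> hcomp D d" "v \<in> hcomp D d'"
  shows "b [u, v] = ev (fpart u) (wpart v) + sg (d * d') (ev (fpart v) (wpart u))"
proof -
  have eq: "(let (x, a, g, h) = us ! 0; (x', a', g', h') = us ! 1
       in g x' + h a' + sg (ds ! 0 * ds ! 1) (g' x + h' a))
     = ev (fpart (us ! 0)) (wpart (us ! 1)) + sg (ds ! 0 * ds ! 1) (ev (fpart (us ! 1)) (wpart (us ! 0)))" for ds us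
    by (simp add: case_prod_unfold Let_def ev_def)
  have "b (map snd [(d, u), (d', v)]) = (\<lambda>ds us. ev (fpart (us ! 0)) (wpart (us ! 1))
      + sg (ds ! 0 * ds ! 1) (ev (fpart (us ! 1)) (wpart (us ! 0)))) (map fst [(d, u), (d', v)]) (map snd [(d, u), (d', v)])"
    unfolding double_form_def eq
  proof (rule D.multihom_homog)
    fix ys :: "(int \<times> ('k, 'v, 'm) double) list"
    assume ys: "length ys = length [(d, u), (d', v)]" "D.homog ys" "0 \<in> set (vecs ys)"
    then obtain y z where "ys = [y, z]" by (auto simp: length_Suc_conv)
    with ys have "snd y \<in> gcarrier D" "snd z \<in> gcarrier D" "snd y = 0 \<or> snd z = 0" "ys = [y, z]"
      by (auto intro: D.hcomp_carrier)
    then show "ev (fpart (vecs ys ! 0)) (wpart (vecs ys ! 1))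
        + sg (degs ys ! 0 * degs ys ! 1) (ev (fpart (vecs ys ! 1)) (wpart (vecs ys ! 0))) = 0"
      using ev_right(3)[of "snd y"] ev_right(3)[of "snd z"] by (auto simp: ev_zero_left simp flip: zero_prod_def)
  qed (use assms in simp)
  then show ?thesis by simp
qed

text \<open>For arbitrary \<open>u\<close> the sign may depend on \<open>v\<close> only. This is
  possible because the second value vanishes unless the degree of \<open>u\<close> is
  \<open>- d\<close>, and then the product of the degrees has the parity of
  \<open>d\<close>.\<close>

lemma b_left:
  assumes u: "u \<in> gcarrier D" and v: "v \<in> hcomp D d"
  shows "b [u, v] = ev (fpart u) (wpart v) + sg d (ev (fpart v) (wpart u))"
proof (rule D.additive_ext[OF _ _ _ u])
  have c: "v \<in> gcarrier D" by (rule D.hcomp_carrier[OF v])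
  fix x y assume "x \<in> gcarrier D" "y \<in> gcarrier D"
  then show "b [x + y, v] = b [x, v] + b [y, v]"
    using b_bilinear(1) c by blast
  have "wpart (x + y) = wpart x + wpart y" by simp
  then show "ev (fpart (x + y)) (wpart v) + sg d (ev (fpart v) (wpart (x + y)))
      = ev (fpart x) (wpart v) + sg d (ev (fpart v) (wpart x)) + (ev (fpart y) (wpart v) + sg d (ev (fpart v) (wpart y)))"
    by (simp only: ev_right[OF c] sg_add snd_add ev_add_left add_ac)
next
  fix d' x assume x: "x \<in> hcomp D d'"
  show "b [x, v] = ev (fpart x) (wpart v) + sg d (ev (fpart v) (wpart x))"
  proof (cases "d' = - d")
    case False
    then show ?thesis
      using ev_vanish[OF v, of "wpart x" d'] x by (simp add: b_homog[OF x v] hcomp_D_iff)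
  next
    case True
    then have "sg (d' * d) = (sg d :: 'k \<Rightarrow> 'k)" by (auto simp: sg_def fun_eq_iff)
    then show ?thesis by (simp add: b_homog[OF x v])
  qed
qed

lemma b_vanish:
  assumes u: "u \<in> hcomp D d" and v: "v \<in> hcomp D d'" and "d' \<noteq> - d"
  shows "b [u, v] = 0"
proof -
  have "wpart u \<in> hcomp W d" "wpart v \<in> hcomp W d'"
    using u v by (simp_all only: hcomp_D_iff)
  then show ?thesis
    using assms ev_vanish[OF u, of "wpart v" d'] ev_vanish[OF v, of "wpart u" d]
    by (simp add: b_homog[OF u v])
qed

text \<open>Both sides vanish unless the degrees add up to zero. If they do, both expand into the
  same three values \<open>p\<close>, \<open>q\<close>, \<open>r\<close>, each the functional of one
  vector at the bracket of the other two, and \<open>e\<close> has the parity of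
  \<open>d + d'\<close>.\<close>

lemma b_invariant:
  assumes u: "u \<in> hcomp D d" and v: "v \<in> hcomp D d'" and z: "z \<in> hcomp D e"
  shows "b [dbr d u d' v, z] = b [u, dbr d' v e z]"
proof (cases "d + d' + e = 0")
  case False
  then show ?thesis
    using b_vanish[OF dbr_hcomp[OF u v] z] b_vanish[OF u dbr_hcomp[OF v z]] by simp
next
  case True
  have w: "wpart u \<in> hcomp W d" "wpart v \<in> hcomp W d'" "wpart z \<in> hcomp W e"
    using u v z by (simp_all only: hcomp_D_iff)
  note c = D.hcomp_carrier[OF u] D.hcomp_carrier[OF v] D.hcomp_carrier[OF z]
  define p q r where "p = ev (fpart u) (SB [wpart v, wpart z])"
    and "q = ev (fpart v) (SB [wpart u, wpart z])" and "r = ev (fpart z) (SB [wpart u, wpart v])"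
  have dbr: "wpart (dbr i x j y) = SB [wpart x, wpart y]"
    "fpart (dbr i x j y) = da i (wpart x) j (fpart y) - sg (i * j) (da j (wpart y) i (fpart x))"
    if "x \<in> hcomp D i" "y \<in> hcomp D j" for i x j y
    using SB_homog[of "wpart x" i "wpart y" j] that by (simp_all add: dbr_def Let_def hcomp_D_iff)
  have minus: "ev (fpart z) (- w) = - ev (fpart z) w" "ev (fpart v) (- w) = - ev (fpart v) w" for w
    using ev_right(4)[OF c(3), of 1] ev_right(4)[OF c(2), of 1] by (simp_all add: sg_def)
  have "b [dbr d u d' v, z] = (- sg (d * d') q - sg (d * d') (- sg (d' * d) p)) + sg e r"
    unfolding b_left[OF D.hcomp_carrier[OF dbr_hcomp[OF u v]] z] dbr[OF u v] ev_diff_left ev_sg_left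
    by (simp add: ev_dual_act c p_def q_def r_def)
  also have "\<dots> = p - sg (d * d') q + sg e r"
    by (simp add: sg_def mult.commute)
  finally have 1: "b [dbr d u d' v, z] = p - sg (d * d') q + sg e r" .
  have "b [u, dbr d' v e z] = p + sg (d * (d' + e))
     (- sg (d' * e) (ev (fpart z) (SB [wpart v, wpart u])) - sg (d' * e) (- sg (e * d') (ev (fpart v) (SB [wpart z, wpart u]))))"
    unfolding b_homog[OF u dbr_hcomp[OF v z]] dbr[OF v z] ev_diff_left ev_sg_left
    by (simp add: ev_dual_act c p_def q_def r_def)
  also have "\<dots> = p + sg (d * (d' + e)) (- sg (d' * e) (- sg (d * d') r) - sg (d' * e) (- sg (e * d') (- sg (d * e) q)))"
    unfolding SB_skew[OF w(1,2)] SB_skew[OF w(1,3)] minus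
    by (simp only: ev_right(4)[OF c(3)] ev_right(4)[OF c(2)] r_def q_def)
  finally have 2: "b [u, dbr d' v e z] = \<dots>" .
  have "even e = (even d = even d')"
    using True by (metis even_add even_zero)
  then show ?thesis
    unfolding 1 2 by (simp add: sg_def split: if_splits)
qed

end

section \<open>Shifted multilinear maps\<close>

text \<open>The exponent in \<open>shift_map\<close>, named so that it can be computed along the
  list.\<close>

definition shift_exp :: "int list \<Rightarrow> int" where
  "shift_exp ds = (\<Sum>j<length ds. int (length ds - (j + 1)) * ds ! j)"

lemma shift_exp_Nil [simp]: "shift_exp [] = 0"
  by (simp add: shift_exp_def)

lemma shift_exp_Cons [simp]: "shift_exp (d # ds) = int (length ds) * d + shift_exp ds"
  by (simp add: shift_exp_def sum.lessThan_Suc_shift del: sum.lessThan_Suc)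

lemma shift_exp_append: "shift_exp (A @ B) = int (length B) * sum_list A + shift_exp A + shift_exp B"
  by (induction A) (simp_all add: algebra_simps)

context graded
begin

lemma graded_shift: "graded (gshift G)"
  by (rule graded_gshift) (rule graded_axioms)

lemma mlin_gshift: "graded.mlin (gshift G) s n F \<longleftrightarrow> mlin s n F"
  by (simp add: mlin_def graded.mlin_def[OF graded_shift])

lemma homog_gshift: "graded.homog (gshift G) zs \<longleftrightarrow> homog (map (\<lambda>(d, v). (d + 1, v)) zs)"
  by (simp add: homog_def graded.homog_def[OF graded_shift] case_prod_unfold)

lemma shift_map_homog:
  assumes "graded.homog (gshift G) zs"
    and "\<And>ys. length ys = length zs \<Longrightarrow> graded.homog (gshift G) ys \<Longrightarrow> 0 \<in> set (vecs ys) \<Longrightarrow> F (vecs ys) = 0"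
  shows "shift_map G F (vecs zs) = sg (shift_exp (degs zs)) (F (vecs zs))"
  unfolding shift_map_def
  by (subst graded.multihom_homog[OF graded_shift assms(1)]) (simp_all add: assms(2) shift_exp_def)

lemma shift_map_mlin_homog:
  assumes F: "mlin s n F" and zs: "graded.homog (gshift G) zs" "length zs = n"
  shows "shift_map G F (vecs zs) = sg (shift_exp (degs zs)) (F (vecs zs))"
proof (rule shift_map_homog[OF zs(1)])
  fix ys assume "length ys = length zs" "graded.homog (gshift G) ys" "0 \<in> set (vecs ys)"
  then show "F (vecs ys) = 0"
    using mlin_zero[OF F] graded.homog_tuples[OF graded_shift, of ys n] zs(2) by simp
qed

lemma mlin_shift_map:
  assumes s: "vector_space s" and F: "mlin s n F"
  shows "mlin s n (shift_map G F)"
proof -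
  interpret S: graded "gshift G" by (rule graded_shift)
  have "S.mlin s n (shift_map G F)"
    unfolding shift_map_def
  proof (rule S.mlin_multihom[OF s])
    fix ds :: "int list"
    have "S.mlin s n (\<lambda>us. sg (\<Sum>j<n. int (n - (j + 1)) * ds ! j) (F us))"
      by (rule S.mlin_sg[OF s]) (simp add: mlin_gshift F)
    then show "S.mlin s n (\<lambda>us. sg (\<Sum>j<length us. int (length us - (j + 1)) * ds ! j) (F us))"
      by (subst (asm) S.mlin_cong) (auto simp: tuples_def)
  qed
  then show ?thesis by (simp add: mlin_gshift)
qed

text \<open>The exponent depends on the degrees only, so the second shift squares the sign.\<close>

lemma shift_map_shift_map:
  assumes s: "vector_space s" and F: "mlin s n F" and vs: "vs \<in> tuples G n"
  shows "shift_map G (shift_map G F) vs = F vs"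
proof -
  interpret S: graded "gshift G" by (rule graded_shift)
  show ?thesis
  proof (rule S.mlin_ext)
    show "S.mlin s n (shift_map G (shift_map G F))" "S.mlin s n F"
      by (simp_all add: mlin_gshift F mlin_shift_map[OF s])
    show "shift_map G (shift_map G F) (vecs zs) = F (vecs zs)" if "S.homog zs" "length zs = n" for zs
      by (simp add: shift_map_mlin_homog[OF mlin_shift_map[OF s F] that] shift_map_mlin_homog[OF F that] sg_sg)
        (simp add: sg_def)
  qed (simp add: vs)
qed

text \<open>With this correction the exponent \<open>1 + (d + 1) * (d' + 1)\<close> of skew symmetry
  in unshifted degrees becomes the exponent \<open>d * d'\<close> of symmetry in shifted
  degrees.\<close>

lemma shift_exp_swap: "even (shift_exp (A @ [d', d] @ B)) \<longleftrightarrow> even (shift_exp (A @ [d, d'] @ B) + d + d')"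
  by (simp add: shift_exp_append) (auto simp: algebra_simps)

lemma graded_sym_shift_map:
  assumes s: "vector_space s" and F: "mlin s n F" and sk: "skew_sym G n F"
  shows "graded_sym (gshift G) n (shift_map G F)"
proof -
  interpret S: graded "gshift G" by (rule graded_shift)
  note mS = mlin_shift_map[OF s F, folded mlin_gshift]
  show ?thesis
    unfolding graded_sym_def
  proof (intro allI impI)
    fix us ws x y d d'
    assume a: "us @ [x, y] @ ws \<in> tuples (gshift G) n" "x \<in> hcomp (gshift G) d" "y \<in> hcomp (gshift G) d'"
    show "shift_map G F (us @ [y, x] @ ws) = sg (d * d') (shift_map G F (us @ [x, y] @ ws))"
    proof (rule S.adjacent_sym_if_homog[OF s mS _ a, of "\<lambda>d d'. d * d'"])
      fix A B x y d d' assume h: "S.homog (A @ [(d, x), (d', y)] @ B)" and l: "length A + length B + 2 = n"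
      have "F (vecs A @ [y, x] @ vecs B) = - sg ((d + 1) * (d' + 1)) (F (vecs A @ [x, y] @ vecs B))"
        using sk[unfolded skew_sym_def, rule_format, of "vecs A" x y "vecs B" "d + 1" "d' + 1"]
          S.homog_tuples[OF h, of n] h l by simp
      moreover have "shift_map G F (vecs A @ [x, y] @ vecs B)
          = sg (shift_exp (degs A @ [d, d'] @ degs B)) (F (vecs A @ [x, y] @ vecs B))"
        using shift_map_mlin_homog[OF F h] l by simp
      moreover have "shift_map G F (vecs A @ [y, x] @ vecs B)
          = sg (shift_exp (degs A @ [d', d] @ degs B)) (F (vecs A @ [y, x] @ vecs B))"
        using shift_map_mlin_homog[OF F, of "A @ [(d', y), (d, x)] @ B"] h l by simp
      moreover note shift_exp_swap[of "degs A" d' d "degs B"]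
      ultimately show "shift_map G F (vecs A @ [y, x] @ vecs B) = sg (d * d') (shift_map G F (vecs A @ [x, y] @ vecs B))"
        by (simp only: sg_def) (cases "even d"; cases "even d'"; simp)
    qed
  qed
qed

lemma skew_sym_shift_map:
  assumes s: "vector_space s" and F: "mlin s n F" and sy: "graded_sym (gshift G) n F"
  shows "skew_sym G n (shift_map G F)"
proof -
  interpret S: graded "gshift G" by (rule graded_shift)
  note mS = mlin_shift_map[OF s F, folded mlin_gshift]
  show ?thesis
    unfolding skew_sym_def
  proof (intro allI impI)
    fix us ws x y d d'
    assume a: "us @ [x, y] @ ws \<in> tuples G n" "x \<in> hcomp G d" "y \<in> hcomp G d'"
    have a': "us @ [x, y] @ ws \<in> tuples (gshift G) n" "x \<in> hcomp (gshift G) (d - 1)" "y \<in> hcomp (gshift G) (d' - 1)"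
      using a by simp_all
    \<comment> \<open>The minus sign of skew symmetry is put into the exponent, which is the shape
      that \<open>adjacent_sym_if_homog\<close> accepts.\<close>
    have "shift_map G F (us @ [y, x] @ ws)
        = sg (1 + (d - 1 + 1) * (d' - 1 + 1)) (shift_map G F (us @ [x, y] @ ws))"
    proof (rule S.adjacent_sym_if_homog[OF s mS _ a', of "\<lambda>d d'. 1 + (d + 1) * (d' + 1)"])
      fix A B x y d d' assume h: "S.homog (A @ [(d, x), (d', y)] @ B)" and l: "length A + length B + 2 = n"
      have "F (vecs A @ [y, x] @ vecs B) = sg (d * d') (F (vecs A @ [x, y] @ vecs B))"
        using sy[unfolded graded_sym_def, rule_format, of "vecs A" x y "vecs B" d d']
          S.homog_tuples[OF h, of n] h l by simp
      moreover have "shift_map G F (vecs A @ [x, y] @ vecs B)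
          = sg (shift_exp (degs A @ [d, d'] @ degs B)) (F (vecs A @ [x, y] @ vecs B))"
        using shift_map_mlin_homog[OF F h] l by simp
      moreover have "shift_map G F (vecs A @ [y, x] @ vecs B)
          = sg (shift_exp (degs A @ [d', d] @ degs B)) (F (vecs A @ [y, x] @ vecs B))"
        using shift_map_mlin_homog[OF F, of "A @ [(d', y), (d, x)] @ B"] h l by simp
      moreover note shift_exp_swap[of "degs A" d' d "degs B"]
      ultimately show "shift_map G F (vecs A @ [y, x] @ vecs B)
          = sg (1 + (d + 1) * (d' + 1)) (shift_map G F (vecs A @ [x, y] @ vecs B))"
        by (simp only: sg_def) (cases "even d"; cases "even d'"; simp)
    qed
    then show "shift_map G F (us @ [y, x] @ ws) = - sg (d * d') (shift_map G F (us @ [x, y] @ ws))"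
      by (simp add: sg_succ)
  qed
qed

lemma has_degree_iff:
  "has_degree G H n \<delta> F \<longleftrightarrow> (\<forall>zs. homog zs \<longrightarrow> length zs = n \<longrightarrow> F (vecs zs) \<in> hcomp H (tdeg zs + \<delta>))"
proof
  assume L: "has_degree G H n \<delta> F"
  show "\<forall>zs. homog zs \<longrightarrow> length zs = n \<longrightarrow> F (vecs zs) \<in> hcomp H (tdeg zs + \<delta>)"
  proof (intro allI impI)
    fix zs assume "homog zs" "length zs = n"
    then have "list_all2 (\<lambda>d v. v \<in> hcomp G d) (degs zs) (vecs zs)"
      by (auto simp: list_all2_conv_all_nth homog_nth)
    with L \<open>length zs = n\<close> show "F (vecs zs) \<in> hcomp H (tdeg zs + \<delta>)"
      by (simp add: has_degree_def)
  qed
next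
  assume R: "\<forall>zs. homog zs \<longrightarrow> length zs = n \<longrightarrow> F (vecs zs) \<in> hcomp H (tdeg zs + \<delta>)"
  show "has_degree G H n \<delta> F"
    unfolding has_degree_def
  proof (intro allI impI)
    fix ds vs assume "length vs = n" "list_all2 (\<lambda>d v. v \<in> hcomp G d) ds vs"
    then show "F vs \<in> hcomp H (sum_list ds + \<delta>)"
      using R[rule_format, OF list_all2_homog] list_all2_lengthD by fastforce
  qed
qed

end

section \<open>The form of the bracket and its insertion\<close>

context module_double
begin

abbreviation "BT \<equiv> shift_map D b"
abbreviation "QT \<equiv> shift_map D (double_bracket V M q act)"

lemma T_hcomp: "v \<in> hcomp T d \<longleftrightarrow> v \<in> hcomp D (d + 1)"
  by simp

lemma B_mlin: "D.mlin (*) 2 BT"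
  by (rule D.mlin_shift_map[OF vector_space_field b_mlin])

lemmas B_bilinear = D.mlin_2D[OF B_mlin]

text \<open>As for \<open>b_left\<close>: on the support the shifted degrees of \<open>u\<close> and
  \<open>v\<close> add up to \<open>- 2\<close>, so they have the same parity and the sign can be
  expressed by \<open>v\<close>.\<close>

lemma B_left:
  assumes u: "u \<in> gcarrier D" and v: "v \<in> hcomp T d"
  shows "BT [u, v] = sg d (ev (fpart u) (wpart v)) - ev (fpart v) (wpart u)"
proof -
  have v': "v \<in> hcomp D (d + 1)" using v by simp
  have c: "v \<in> gcarrier D" by (rule D.hcomp_carrier[OF v'])
  show ?thesis
  proof (rule T.additive_ext)
    fix x y assume "x \<in> gcarrier T" "y \<in> gcarrier T"
    then show "BT [x + y, v] = BT [x, v] + BT [y, v]"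
      using B_bilinear(1) c by simp
    have "wpart (x + y) = wpart x + wpart y" by simp
    then show "sg d (ev (fpart (x + y)) (wpart v)) - ev (fpart v) (wpart (x + y))
        = sg d (ev (fpart x) (wpart v)) - ev (fpart v) (wpart x) + (sg d (ev (fpart y) (wpart v)) - ev (fpart v) (wpart y))"
      by (simp only: ev_right[OF c] sg_add snd_add ev_add_left add_ac diff_conv_add_uminus minus_add_distrib)
  next
    fix e x assume x: "x \<in> hcomp T e"
    have "BT [x, v] = sg e (b [x, v])"
      using D.shift_map_mlin_homog[OF b_mlin, of "[(e, x), (d, v)]"] x v by simp
    also have "b [x, v] = ev (fpart x) (wpart v) + sg (d + 1) (ev (fpart v) (wpart x))"
      by (rule b_left[OF D.hcomp_carrier v']) (use x in simp)
    finally have eq: "BT [x, v] = sg e (ev (fpart x) (wpart v) + sg (d + 1) (ev (fpart v) (wpart x)))" .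
    show "BT [x, v] = sg d (ev (fpart x) (wpart v)) - ev (fpart v) (wpart x)"
    proof (cases "e + 1 = - (d + 1)")
      case False
      have w: "wpart x \<in> hcomp W (e + 1)" "wpart v \<in> hcomp W (d + 1)"
        using x v by (simp_all only: T_hcomp hcomp_D_iff)
      have "ev (fpart x) (wpart v) = 0" "ev (fpart v) (wpart x) = 0"
        using ev_vanish[OF v' w(1)] ev_vanish[OF _ w(2), of x "e + 1"] x False by auto
      then show ?thesis by (simp add: eq)
    next
      case True
      then have "e = - d - 2" by simp
      then show ?thesis by (simp add: eq sg_def)
    qed
  qed (use u in simp)
qed

lemma B_b:
  assumes u: "u \<in> gcarrier D" and v: "v \<in> hcomp T d"
  shows "BT [u, v] = sg d (b [u, v])"
  using B_left[OF assms] b_left[OF u, of v "d + 1"] v by (simp add: sg_def)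

lemma QT_homog:
  assumes u: "u \<in> hcomp T d" and v: "v \<in> hcomp T d'"
  shows "QT [u, v] = sg d (dbr (d + 1) u (d' + 1) v)"
proof -
  have "QT (vecs [(d, u), (d', v)])
      = sg (shift_exp (degs [(d, u), (d', v)])) (double_bracket V M q act (vecs [(d, u), (d', v)]))"
  proof (rule D.shift_map_homog)
    fix ys :: "(int \<times> ('k, 'v, 'm) double) list"
    assume ys: "length ys = length [(d, u), (d', v)]" "T.homog ys" "0 \<in> set (vecs ys)"
    then obtain y z where yz: "ys = [y, z]" by (auto simp: length_Suc_conv)
    with ys have "snd y \<in> hcomp D (fst y + 1)" "snd z \<in> hcomp D (fst z + 1)" "snd y = 0 \<or> snd z = 0"
      by auto
    then show "double_bracket V M q act (vecs ys) = 0"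
      using dbr_zero by (simp add: yz double_bracket_homog)
  qed (use u v in simp)
  then show ?thesis
    using double_bracket_homog[of u "d + 1" v "d' + 1"] u v by simp
qed

lemma QT_hcomp:
  assumes u: "u \<in> hcomp T d" and v: "v \<in> hcomp T d'"
  shows "QT [u, v] \<in> hcomp T (d + d' + 1)"
  using dbr_hcomp[of u "d + 1" v "d' + 1"] u v
  by (simp add: QT_homog[OF assms] D.hcomp_sg add.assoc add.left_commute)

lemma QT_zero:
  assumes "u \<in> hcomp T d" "v \<in> hcomp T d'" and "u = 0 \<or> v = 0"
  shows "QT [u, v] = 0"
  using dbr_zero[of u "d + 1" v "d' + 1"] assms by (simp add: QT_homog)

text \<open>A nonzero value forces \<open>d + d1 + d2 = - 3\<close>, an odd number, so
  \<open>d + d2\<close> and \<open>d1\<close> have opposite parity. This is the minus sign; the sign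
  of \<open>d1\<close> itself is the one that separates \<open>QT [u, v]\<close> from the unshifted
  bracket.\<close>

lemma Omega_bracket_homog:
  assumes e: "e \<in> hcomp T d" and u: "u \<in> hcomp T d1" and v: "v \<in> hcomp T d2"
  shows "Omega_bracket V M q act [e, u, v] = - b [e, QT [u, v]]"
proof -
  have D: "e \<in> hcomp D (d + 1)" "u \<in> hcomp D (d1 + 1)" "v \<in> hcomp D (d2 + 1)"
    using e u v by simp_all
  let ?x = "dbr (d + 1) e (d1 + 1) u" and ?y = "dbr (d1 + 1) u (d2 + 1) v"
  have c: "?x \<in> gcarrier D" "?y \<in> gcarrier D" "e \<in> gcarrier D" "v \<in> gcarrier D"
    by (rule D.hcomp_carrier[OF dbr_hcomp] D.hcomp_carrier D)+
  have sgl: "b [sg n ?x, v] = sg n (b [?x, v])" "b [e, sg n ?y] = sg n (b [e, ?y])" for n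
    using b_bilinear(3)[OF c(1,1,4), of "-1"] b_bilinear(4)[OF c(2,2,3), of "-1"]
    by (simp_all add: sg_def D.scale_minus_left)
  have "Omega_bracket V M q act [e, u, v] = BT [sg d ?x, v]"
    by (simp add: Omega_bracket_def Omega_def QT_homog[OF e u])
  also have "\<dots> = sg (d2 + d) (b [e, ?y])"
    by (simp add: B_b[OF D.carrier_sg[OF c(1)] v] sgl sg_sg b_invariant[OF D])
  also have "\<dots> = - sg d1 (b [e, ?y])"
  proof (cases "d1 + 1 + (d2 + 1) = - (d + 1)")
    case False
    then show ?thesis
      using b_vanish[OF D(1) dbr_hcomp[OF D(2,3)]] by simp
  next
    case True
    then have "d2 = - d - d1 - 3" by simp
    then show ?thesis by (simp add: sg_def)
  qed
  finally show ?thesis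
    by (simp add: QT_homog[OF u v] sgl)
qed

lemma dual_bases_carrier:
  assumes "dual_bases D b N e e'" and "i < N"
  shows "e i \<in> gcarrier D" "e' i \<in> gcarrier D"
proof -
  have "D.span (e' ` {..<N}) = gcarrier D" "D.span (e ` {..<N}) = gcarrier D"
    using assms(1) by (auto simp: dual_bases_def)
  then show "e i \<in> gcarrier D" "e' i \<in> gcarrier D"
    using assms(2) D.span_base[of "e i" "e ` {..<N}"] D.span_base[of "e' i" "e' ` {..<N}"] by auto
qed

lemma b_scale_right: "u \<in> gcarrier D \<Longrightarrow> v \<in> gcarrier D \<Longrightarrow> b [u, smul D a v] = a * b [u, v]"
  by (rule b_bilinear(4))

text \<open>The coefficient of \<open>e' i\<close> is read off by pairing with \<open>e i\<close>
  from the left, the side on which \<open>dual_bases\<close> normalizes the bases.\<close>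

lemma dual_expansion:
  assumes e: "dual_bases D b N e e'" and w: "w \<in> gcarrier D"
  shows "(\<Sum>i<N. smul D (b [e i, w]) (e' i)) = w"
proof -
  have inj: "inj_on e' {..<N}" and sp: "D.span (e' ` {..<N}) = gcarrier D"
    and dual: "\<And>i j. i < N \<Longrightarrow> j < N \<Longrightarrow> b [e i, e' j] = (if i = j then 1 else 0)"
    using e by (auto simp: dual_bases_def)
  note c = dual_bases_carrier[OF e]
  obtain u where "w = (\<Sum>v\<in>e' ` {..<N}. smul D (u v) v)"
    using w D.span_finite[of "e' ` {..<N}"] by (auto simp: sp)
  then have u: "w = (\<Sum>j<N. smul D (u (e' j)) (e' j))"
    by (simp add: sum.reindex[OF inj])
  have "b [e i, w] = u (e' i)" if i: "i < N" for i
  proof -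
    have "b [e i, w] = (\<Sum>j<N. b [e i, smul D (u (e' j)) (e' j)])"
      unfolding u by (rule D.additive_sum[where f = "\<lambda>x. b [e i, x]"])
        (use b_bilinear(2) c i in \<open>auto intro: D.carrier_scale\<close>)
    also have "\<dots> = (\<Sum>j<N. if i = j then u (e' j) else 0)"
      by (rule sum.cong) (simp_all add: b_scale_right c i dual)
    finally show ?thesis using i by simp
  qed
  then have "(\<Sum>i<N. smul D (b [e i, w]) (e' i)) = (\<Sum>j<N. smul D (u (e' j)) (e' j))"
    by (intro sum.cong) auto
  then show ?thesis using u by simp
qed

text \<open>The two inserted vectors have to be expanded into components. Once the sign is free of
  the degree \<open>d\<close> of the component of \<open>u\<close>, these components add up to
  \<open>u\<close> again; those of \<open>u'\<close> stay apart.\<close>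

lemma insert_tensor_homog:
  assumes F: "T.mlin (*) (Suc k) F" and zs: "T.homog (z1 # z2 # zs)" "length zs = k"
    and u: "u \<in> gcarrier D" "u' \<in> gcarrier D"
  shows "insert_tensor T 2 u u' (Omega_bracket V M q act) F (vecs (z1 # z2 # zs))
    = - (\<Sum>d'\<in>degrees T. sg (d' + tdeg zs + d' * (fst z1 + fst z2))
          (b [u, QT [snd z1, snd z2]] * F (gproj T d' u' # vecs zs)))"
proof -
  let ?L = "fst z1 + fst z2" and ?w = "QT [snd z1, snd z2]"
  have z: "snd z1 \<in> hcomp T (fst z1)" "snd z2 \<in> hcomp T (fst z2)" using zs by simp_all
  have w: "?w \<in> hcomp T (?L + 1)" by (rule QT_hcomp[OF z])
  have p: "gproj T d x \<in> hcomp T d" "gproj T d x \<in> gcarrier T" if "x \<in> gcarrier D" for d x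
    using T.gproj_hcomp[of x d] T.gproj_carrier[of x d] that by simp_all
  have "insert_tensor T 2 u u' (Omega_bracket V M q act) F (vecs (z1 # z2 # zs))
      = (\<Sum>d\<in>degrees T. \<Sum>d'\<in>degrees T. sg ((d' + tdeg zs) * (d + ?L) + d' * ?L)
          (Omega_bracket V M q act [gproj T d u, snd z1, snd z2] * F (gproj T d' u' # vecs zs)))"
    unfolding insert_tensor_def append_Cons append_Nil T.multihom_Cons[of _ u] T.multihom_Cons[of _ u']
  proof (intro sum.cong refl)
    fix d d'
    let ?\<Phi> = "\<lambda>ds us. sg ((d' + sum_list (drop 2 ds)) * (d + sum_list (take 2 ds)) + d' * sum_list (take 2 ds))
          (Omega_bracket V M q act (gproj T d u # take 2 us) * F (gproj T d' u' # drop 2 us))"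
    have "multihom T ?\<Phi> (vecs (z1 # z2 # zs)) = ?\<Phi> (degs (z1 # z2 # zs)) (vecs (z1 # z2 # zs))"
    proof (rule T.multihom_homog[OF zs(1)])
      fix ys :: "(int \<times> ('k, 'v, 'm) double) list"
      assume ys: "length ys = length (z1 # z2 # zs)" "T.homog ys" "0 \<in> set (vecs ys)"
      then obtain y1 y2 xs where y: "ys = y1 # y2 # xs" by (auto simp: length_Suc_conv)
      have h: "snd y1 \<in> hcomp T (fst y1)" "snd y2 \<in> hcomp T (fst y2)" "T.homog xs"
        using ys(2) by (simp_all add: y)
      have "Omega_bracket V M q act [gproj T d u, snd y1, snd y2] = 0 \<or> F (gproj T d' u' # vecs xs) = 0"
      proof (cases "0 \<in> set (vecs xs)")
        case True
        have "gproj T d' u' # vecs xs \<in> tuples T (Suc k)"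
          using T.homog_tuples[OF h(3), of k] ys(1) zs(2) p[OF u(2)] by (simp add: y tuples_def)
        from T.mlin_zero[OF F this] True show ?thesis by simp
      next
        case False
        then have "snd y1 = 0 \<or> snd y2 = 0" using ys(3) by (auto simp: y)
        then show ?thesis
          using Omega_bracket_homog[OF p(1)[OF u(1)] h(1,2)] QT_zero[OF h(1,2)]
            b_bilinear(4)[OF _ _ p(2)[OF u(1), simplified], of 0 0 d 0] D.carrier_0 by simp
      qed
      then show "?\<Phi> (degs ys) (vecs ys) = 0" by (auto simp: y numeral_2_eq_2)
    qed
    then show "multihom T (\<lambda>ds us. let du = (d # d' # ds) ! 0; du' = (d # d' # ds) ! 1;
             left = sum_list (take 2 (drop 2 (d # d' # ds))); right = sum_list (drop 2 (drop 2 (d # d' # ds)))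
         in sg ((du' + right) * (du + left) + du' * left)
             (Omega_bracket V M q act ((gproj T d u # gproj T d' u' # us) ! 0 # take 2 (drop 2 (gproj T d u # gproj T d' u' # us)))
              * F ((gproj T d u # gproj T d' u' # us) ! 1 # drop 2 (drop 2 (gproj T d u # gproj T d' u' # us))))) (vecs (z1 # z2 # zs))
      = sg ((d' + tdeg zs) * (d + ?L) + d' * ?L)
          (Omega_bracket V M q act [gproj T d u, snd z1, snd z2] * F (gproj T d' u' # vecs zs))"
      by (simp add: Let_def numeral_2_eq_2)
  qed
  \<comment> \<open>On the support of the form \<open>d + ?L\<close> equals \<open>- 3\<close>;
    being odd, it drops out of the product in the exponent.\<close>
  also have "\<dots> = (\<Sum>d\<in>degrees T. \<Sum>d'\<in>degrees T. - sg (d' + tdeg zs + d' * ?L)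
          (b [gproj T d u, ?w] * F (gproj T d' u' # vecs zs)))"
  proof (intro sum.cong refl)
    fix d d'
    show "sg ((d' + tdeg zs) * (d + ?L) + d' * ?L)
          (Omega_bracket V M q act [gproj T d u, snd z1, snd z2] * F (gproj T d' u' # vecs zs))
        = - sg (d' + tdeg zs + d' * ?L) (b [gproj T d u, ?w] * F (gproj T d' u' # vecs zs))"
    proof (cases "?L + 1 + 1 = - (d + 1)")
      case False
      then show ?thesis
        using b_vanish[of "gproj T d u" "d + 1" ?w "?L + 1 + 1"] p(1)[OF u(1), of d] w
        by (simp add: Omega_bracket_homog[OF p(1)[OF u(1)] z])
    next
      case True
      then have "d + ?L = - 3" by simp
      then show ?thesis
        by (simp add: Omega_bracket_homog[OF p(1)[OF u(1)] z] sg_minus) (auto intro: sg_cong)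
    qed
  qed
  also have "\<dots> = - (\<Sum>d'\<in>degrees T. \<Sum>d\<in>degrees T. sg (d' + tdeg zs + d' * ?L)
          (b [gproj T d u, ?w] * F (gproj T d' u' # vecs zs)))"
    by (subst sum.swap) (simp add: sum_negf)
  also have "\<dots> = - (\<Sum>d'\<in>degrees T. sg (d' + tdeg zs + d' * ?L)
          ((\<Sum>d\<in>degrees T. b [gproj T d u, ?w]) * F (gproj T d' u' # vecs zs)))"
    by (simp add: sg_sum sum_distrib_right)
  also have "(\<Sum>d\<in>degrees T. b [gproj T d u, ?w]) = b [u, ?w]"
  proof -
    have "?w \<in> gcarrier D" using T.hcomp_carrier[OF w] by simp
    then have "b [\<Sum>d\<in>degrees T. gproj T d u, ?w] = (\<Sum>d\<in>degrees T. b [gproj T d u, ?w])"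
      by (intro T.additive_sum[where f = "\<lambda>x. b [x, ?w]"]) (use b_bilinear(1) p u in auto)
    then show ?thesis using T.sum_gproj[of u] u by simp
  qed
  finally show ?thesis .
qed

text \<open>By \<open>dual_expansion\<close> the sum over the bases restores
  \<open>QT [snd z1, snd z2]\<close>. This vector is homogeneous of degree \<open>?L + 1\<close>, so
  one component survives, and since \<open>(?L + 1) * ?L\<close> is even the sign that remains is
  the total degree of the arguments.\<close>

lemma insert_tensor_sum:
  assumes e: "dual_bases D b N e e'" and F: "T.mlin (*) (Suc k) F"
    and zs: "T.homog (z1 # z2 # zs)" "length zs = k"
  shows "(\<Sum>i<N. insert_tensor T 2 (e i) (e' i) (Omega_bracket V M q act) F (vecs (z1 # z2 # zs)))
    = sg (tdeg (z1 # z2 # zs)) (F (QT [snd z1, snd z2] # vecs zs))"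
proof -
  let ?L = "fst z1 + fst z2" and ?w = "QT [snd z1, snd z2]"
  note c = dual_bases_carrier[OF e]
  have w: "?w \<in> hcomp T (?L + 1)" by (rule QT_hcomp) (use zs in simp_all)
  then have wc: "?w \<in> gcarrier D" using T.hcomp_carrier by fastforce
  have tup: "x # vecs zs \<in> tuples T (Suc k)" if "x \<in> gcarrier D" for x
    using T.homog_tuples[of zs k] zs that by (simp add: tuples_def)
  have Fsum: "(\<Sum>i<N. b [e i, ?w] * F (gproj T d' (e' i) # vecs zs)) = F (gproj T d' ?w # vecs zs)" for d'
  proof -
    have pc: "gproj T d' x \<in> gcarrier T" if "x \<in> gcarrier D" for x
      using T.gproj_carrier[of x d'] that by simp
    have "gproj T d' ?w = gproj T d' (\<Sum>i<N. smul T (b [e i, ?w]) (e' i))"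
      using dual_expansion[OF e wc] by simp
    also have "\<dots> = (\<Sum>i<N. gproj T d' (smul T (b [e i, ?w]) (e' i)))"
      by (rule T.gproj_sum) (simp add: c D.carrier_scale)
    also have "\<dots> = (\<Sum>i<N. smul T (b [e i, ?w]) (gproj T d' (e' i)))"
      by (rule sum.cong[OF refl T.gproj_scale]) (simp add: c)
    finally have "F (gproj T d' ?w # vecs zs) = F ((0 # vecs zs)[0 := \<Sum>i<N. smul T (b [e i, ?w]) (gproj T d' (e' i))])"
      by simp
    also have "\<dots> = (\<Sum>i<N. F ((0 # vecs zs)[0 := smul T (b [e i, ?w]) (gproj T d' (e' i))]))"
      by (rule T.mlin_sum_slot[OF F tup[OF D.carrier_0]]) (use c pc T.carrier_scale in auto)
    also have "\<dots> = (\<Sum>i<N. b [e i, ?w] * F (gproj T d' (e' i) # vecs zs))"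
      by (rule sum.cong)
        (use T.mlinD(2)[OF F tup[OF D.carrier_0], of 0] c pc in auto)
    finally show ?thesis ..
  qed
  have "(\<Sum>i<N. insert_tensor T 2 (e i) (e' i) (Omega_bracket V M q act) F (vecs (z1 # z2 # zs)))
      = (\<Sum>i<N. - (\<Sum>d'\<in>degrees T. sg (d' + tdeg zs + d' * ?L) (b [e i, ?w] * F (gproj T d' (e' i) # vecs zs))))"
    by (rule sum.cong[OF refl insert_tensor_homog[OF F zs]]) (simp_all add: c)
  also have "\<dots> = - (\<Sum>d'\<in>degrees T. sg (d' + tdeg zs + d' * ?L) (F (gproj T d' ?w # vecs zs)))"
    unfolding sum_negf by (subst sum.swap) (simp add: Fsum flip: sg_sum)
  also have "\<dots> = - (\<Sum>d'\<in>degrees T. if d' = ?L + 1 then sg (?L + 1 + tdeg zs + (?L + 1) * ?L) (F (?w # vecs zs)) else 0)"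
    using T.mlin_zero[OF F tup[OF D.carrier_0]]
    by (intro arg_cong[of _ _ uminus] sum.cong) (simp_all add: T.gproj_homogeneous[OF w])
  also have "\<dots> = - sg (?L + 1 + tdeg zs + (?L + 1) * ?L) (F (?w # vecs zs))"
  proof (cases "?w = 0")
    \<comment> \<open>The nominal degree of a zero vector need not occur in
      \<open>degrees T\<close>, but then both sides are zero.\<close>
    case True
    then show ?thesis
      using T.mlin_zero[OF F tup[OF wc]] T.finite_degrees by (simp add: sum.delta)
  next
    case False
    then show ?thesis
      using T.hcomp_degrees[OF w] T.finite_degrees by (simp add: sum.delta)
  qed
  also have "\<dots> = sg (tdeg (z1 # z2 # zs)) (F (?w # vecs zs))"
    by (auto simp: sg_def)
  finally show ?thesis .
qed

end

section \<open>Products of multilinear maps, and the last slot\<close>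

context graded
begin

text \<open>\<open>H\<close> is any bilinear operation whose two factors consume disjoint blocks of
  arguments; the action terms of the commutator are of this kind.\<close>

lemma mlin_outer:
  assumes F: "mlin s1 a F1" "mlin s2 b F2" and n: "n = a + b"
    and H: "\<And>x x' y. H (x + x') y = H x y + H x' y" "\<And>x y y'. H x (y + y') = H x y + H x y'"
      "\<And>c x y. H (s1 c x) y = s c (H x y)" "\<And>c x y. H x (s2 c y) = s c (H x y)"
  shows "mlin s n (\<lambda>vs. H (F1 (take a vs)) (F2 (drop a vs)))"
proof (rule mlinI)
  fix vs i x y c assume v: "vs \<in> tuples G n" "length vs = n" "i < n" "x \<in> gcarrier G" "y \<in> gcarrier G"
  have t: "take a vs \<in> tuples G a" "drop a vs \<in> tuples G b"
    using v(1) n by (auto simp: tuples_def dest: in_set_takeD in_set_dropD)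
  show "H (F1 (take a (vs[i := x + y]))) (F2 (drop a (vs[i := x + y])))
      = H (F1 (take a (vs[i := x]))) (F2 (drop a (vs[i := x]))) + H (F1 (take a (vs[i := y]))) (F2 (drop a (vs[i := y])))
    \<and> H (F1 (take a (vs[i := smul G c x]))) (F2 (drop a (vs[i := smul G c x])))
      = s c (H (F1 (take a (vs[i := x]))) (F2 (drop a (vs[i := x]))))"
  proof (cases "i < a")
    case True
    then show ?thesis
      using mlinD[OF F(1) t(1) True v(4)] v(5) by (simp add: take_update_swap H)
  next
    case False
    then have i: "i - a < b" "a \<le> i" using v(3) n by auto
    have u: "take a (vs[i := z]) = take a vs" "drop a (vs[i := z]) = (drop a vs)[i - a := z]" for z
      using i v(2) by (simp_all add: take_update_swap drop_update_swap list_update_beyond)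
    show ?thesis
      unfolding u using mlinD[OF F(2) t(2) i(1) v(4)] v(5) by (simp add: H)
  qed
qed

text \<open>The last slot is separated because \<open>tilde\<close> decomposes only the first
  \<open>k\<close> arguments of the form.\<close>

lemma multihom_snoc:
  "multihom G \<Phi> (vs @ [v]) =
    (\<Sum>ds\<in>degree_lists (length vs). \<Sum>d\<in>degrees G. \<Phi> (ds @ [d]) (map2 (gproj G) ds vs @ [gproj G d v]))"
proof -
  have eq: "degree_lists (length (vs @ [v])) = (\<lambda>(ds, d). ds @ [d]) ` (degree_lists (length vs) \<times> degrees G)"
    by (auto simp: length_Suc_conv_rev image_iff)
  have inj: "inj_on (\<lambda>(ds, d). ds @ [d]) (degree_lists (length vs) \<times> degrees G)"
    by (auto simp: inj_on_def)
  show ?thesis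
    unfolding multihom_def eq sum.cartesian_product
    by (subst sum.reindex[OF inj]) (auto intro!: sum.cong)
qed

end

context module_double
begin

section \<open>The form of an extended cochain\<close>

definition xl :: "(int \<times> ('k, 'v, 'm) double) list \<Rightarrow> (int \<times> 'v) list" where
  "xl zs = map (\<lambda>(d, v). (d, fst v)) zs"

lemma xl_simps [simp]:
  "xl [] = []" "xl (z # zs) = (fst z, fst (snd z)) # xl zs" "xl (ys @ zs) = xl ys @ xl zs"
  "length (xl zs) = length zs" "degs (xl zs) = degs zs" "vecs (xl zs) = map fst (vecs zs)"
  by (simp_all add: xl_def case_prod_unfold)

lemma xl_permute: "\<sigma> permutes {..<length zs} \<Longrightarrow> xl (permute_list \<sigma> zs) = permute_list \<sigma> (xl zs)"
  by (simp add: xl_def permute_list_map)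

lemma homog_xl: "T.homog zs \<Longrightarrow> sV.homog (xl zs)"
  by (auto simp: T.homog_def sV.homog_def xl_def hcomp_D_iff)

abbreviation hval :: "('k, 'v, 'm) double \<Rightarrow> 'm \<Rightarrow> 'k" where
  "hval v m \<equiv> ev (fpart v) (0, m)"

lemma hval_eq: "v \<in> gcarrier D \<Longrightarrow> hval v m = snd (fpart v) m"
  by (auto simp: ev_def carrier_D_iff dest: VS_linear_0)

lemma hval_right:
  assumes "v \<in> gcarrier D"
  shows "hval v (m + m') = hval v m + hval v m'" "hval v (smul M c m) = c * hval v m"
    "hval v (sg n m) = sg n (hval v m)" "hval v (m - m') = hval v m - hval v m'" "hval v 0 = 0"
    "hval v (sum f I) = (\<Sum>i\<in>I. hval v (f i))"
proof -
  interpret h: Vector_Spaces.linear "smul M" "(*)" "snd (fpart v)" using assms by (simp add: carrier_D_iff)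
  show "hval v (m + m') = hval v m + hval v m'" "hval v (smul M c m) = c * hval v m"
    "hval v (sg n m) = sg n (hval v m)" "hval v (m - m') = hval v m - hval v m'" "hval v 0 = 0"
    "hval v (sum f I) = (\<Sum>i\<in>I. hval v (f i))"
    by (simp_all add: hval_eq[OF assms] h.add h.scale h.neg h.diff h.zero h.sum sg_def)
qed

text \<open>An element of shifted degree \<open>d\<close> carries a functional of degree
  \<open>d + 1\<close>. This condition later expresses the degree of \<open>C\<close> through the
  degrees of the letters.\<close>

lemma hval_vanish: "v \<in> hcomp T d \<Longrightarrow> m \<in> hcomp M e \<Longrightarrow> d + 1 + e \<noteq> 0 \<Longrightarrow> hval v m = 0"
  by (rule ev_vanish[of v "d + 1" _ e]) (auto simp: V.hcomp_0)

text \<open>The contribution of the \<open>M\<close> component to the form; the minus sign is that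
  of the second term in \<open>B_left\<close>.\<close>

definition pairing :: "('v list \<Rightarrow> 'm) \<Rightarrow> ('k, 'v, 'm) double list \<Rightarrow> 'k" where
  "pairing C us = - hval (last us) (C (map fst (butlast us)))"

lemma pairing_snoc: "pairing C (us @ [v]) = - hval v (C (map fst us))"
  by (simp add: pairing_def)

lemma mlin_map_fst:
  assumes "V.mlin s n C"
  shows "T.mlin s n (\<lambda>us. C (map fst us))"
proof (rule T.mlinI)
  fix vs :: "('k, 'v, 'm) double list" and i x y a
  assume a: "vs \<in> tuples T n" "length vs = n" "i < n"
  have "map fst vs \<in> tuples V n" using a by (simp add: tuples_def)
  from V.mlinD(1)[OF assms this a(3), of "fst x" "fst y"] V.mlinD(2)[OF assms this a(3), of "fst x" a]
  show "C (map fst (vs[i := x + y])) = C (map fst (vs[i := x])) + C (map fst (vs[i := y])) \<and>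
      C (map fst (vs[i := smul T a x])) = s a (C (map fst (vs[i := x])))"
    by (simp add: map_update smul_D)
qed

lemma pairing_mlin:
  assumes C: "V.mlin (smul M) n C"
  shows "T.mlin (*) (Suc n) (pairing C)"
proof (rule T.mlinI)
  fix vs i x y c
  assume a: "vs \<in> tuples T (Suc n)" "length vs = Suc n" "i < Suc n" "x \<in> gcarrier T" "y \<in> gcarrier T"
  obtain us v where vs: "vs = us @ [v]" and l: "length us = n"
    using a(2) by (auto simp: length_Suc_conv_rev)
  have c: "us \<in> tuples T n" "v \<in> gcarrier D" "x \<in> gcarrier D" "y \<in> gcarrier D"
    using a by (auto simp: tuples_def vs)
  show "pairing C (vs[i := x + y]) = pairing C (vs[i := x]) + pairing C (vs[i := y]) \<and>
      pairing C (vs[i := smul T c x]) = c * pairing C (vs[i := x])"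
  proof (cases "i < n")
    case True
    have "C (map fst (us[i := x + y])) = C (map fst (us[i := x])) + C (map fst (us[i := y]))"
      "C (map fst (us[i := smul T c x])) = smul M c (C (map fst (us[i := x])))"
      using T.mlinD[OF mlin_map_fst[OF C] c(1) True a(4)] a(5) by auto
    then show ?thesis
      using True by (simp add: vs list_update_append l pairing_snoc hval_right[OF c(2)])
  next
    case False
    then have i: "i = n" using a(3) by simp
    have "pairing C (vs[i := z]) = - hval z (C (map fst us))" for z
      using l by (simp add: vs i list_update_append pairing_snoc)
    then show ?thesis
      by (simp add: ev_add_left smul_D ev_scale_left del: gsum_simps)
  qed
qed

text \<open>The functional on \<open>V\<close> in the value of \<open>tilde\<close>, at fixed
  degrees of the arguments. The new variable \<open>y\<close> has a degree of its own and is
  decomposed separately.\<close>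

definition tilde_dual :: "('v list \<Rightarrow> 'm) \<Rightarrow> int list \<Rightarrow> ('k, 'v, 'm) double list \<Rightarrow> 'v \<Rightarrow> 'k" where
  "tilde_dual C ds us y = (\<Sum>j<length us. multihom (gshift V) (\<lambda>es ys.
     sg (1 + hd es + (sum_list (take j ds) + ds ! j) * (sum_list (drop (j + 1) ds) + hd es))
       (snd (fpart (us ! j)) (C (drop (j + 1) (map fst us) @ ys @ take j (map fst us))))) [y])"

lemma tilde_eq: "tilde V M C = multihom T (\<lambda>ds us. (0, C (map fst us), tilde_dual C ds us, 0))"
  unfolding tilde_def tilde_dual_def Let_def
  by (intro arg_cong[of _ _ "multihom T"] ext)
    (auto simp: case_prod_unfold intro!: sum.cong arg_cong[of _ _ "\<lambda>f. multihom (gshift V) f _"] ext)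

lemma mlin_slot:
  assumes C: "V.mlin (smul M) (Suc (length A + length B)) C"
  shows "V.mlin (smul M) 1 (\<lambda>ys. C (A @ ys @ B))"
proof (rule V.mlinI)
  fix vs :: "'v list" and x y c and i :: nat assume "length vs = 1" "i < 1"
  then obtain v where "vs = [v]" "i = 0" by (auto simp: length_Suc_conv)
  moreover have "A @ 0 # B \<in> tuples V (Suc (length A + length B))" by (simp add: tuples_def)
  ultimately show "C (A @ vs[i := x + y] @ B) = C (A @ vs[i := x] @ B) + C (A @ vs[i := y] @ B) \<and>
      C (A @ vs[i := smul V c x] @ B) = smul M c (C (A @ vs[i := x] @ B))"
    using V.mlinD[OF C, of "A @ 0 # B" "length A" x] by simp
qed

lemma tilde_dual_term:
  assumes C: "V.mlin (smul M) k C" and us: "us \<in> tuples T k" and j: "j < k"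
  shows "sV.mlin (*) 1 (\<lambda>ys. sg n (snd (fpart (us ! j)) (C (drop (j + 1) (map fst us) @ ys @ take j (map fst us)))))"
proof -
  have l: "length us = k" using us by (simp add: tuples_def)
  have c: "us ! j \<in> gcarrier D" using us j by (auto simp: tuples_def)
  have "sV.mlin (smul M) 1 (\<lambda>ys. C (drop (j + 1) (map fst us) @ ys @ take j (map fst us)))"
    unfolding V.mlin_gshift by (rule mlin_slot) (use C l j in simp)
  note m = sV.mlinD[OF this]
  show ?thesis
    unfolding hval_eq[OF c, symmetric]
  proof (rule sV.mlinI)
    fix vs :: "'v list" and x y a and i :: nat assume "vs \<in> tuples (gshift V) 1" "i < 1"
    note mi = m(1)[OF this, of x y] m(2)[OF this, of x a]
    show "sg n (hval (us ! j) (C (drop (j + 1) (map fst us) @ vs[i := x + y] @ take j (map fst us))))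
        = sg n (hval (us ! j) (C (drop (j + 1) (map fst us) @ vs[i := x] @ take j (map fst us))))
          + sg n (hval (us ! j) (C (drop (j + 1) (map fst us) @ vs[i := y] @ take j (map fst us)))) \<and>
      sg n (hval (us ! j) (C (drop (j + 1) (map fst us) @ vs[i := smul (gshift V) a x] @ take j (map fst us))))
        = a * sg n (hval (us ! j) (C (drop (j + 1) (map fst us) @ vs[i := x] @ take j (map fst us))))"
      using mi by (simp add: hval_right[OF c] sg_add sg_mult_right)
  qed
qed

lemma tilde_dual_homog:
  assumes C: "V.mlin (smul M) k C" and us: "us \<in> tuples T k" and x: "x \<in> hcomp V (d + 1)"
  shows "tilde_dual C ds us x = (\<Sum>j<k.
     sg (1 + d + (sum_list (take j ds) + ds ! j) * (sum_list (drop (j + 1) ds) + d))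
       (hval (us ! j) (C (drop (j + 1) (map fst us) @ [x] @ take j (map fst us)))))"
proof -
  have l: "length us = k" and c: "j < k \<Longrightarrow> us ! j \<in> gcarrier D" for j
    using us by (auto simp: tuples_def)
  show ?thesis
    unfolding tilde_dual_def l
  proof (rule sum.cong[OF refl])
    fix j assume "j \<in> {..<k}"
    then have j: "j < k" by simp
    let ?\<Phi> = "\<lambda>es ys. sg (1 + hd es + (sum_list (take j ds) + ds ! j) * (sum_list (drop (j + 1) ds) + hd es))
       (snd (fpart (us ! j)) (C (drop (j + 1) (map fst us) @ ys @ take j (map fst us))))"
    have "multihom (gshift V) ?\<Phi> (vecs [(d, x)]) = ?\<Phi> (degs [(d, x)]) (vecs [(d, x)])"
    proof (rule sV.multihom_mlin_homog[where s = "(*)"])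
      show "sV.homog [(d, x)]" using x by simp
      show "sV.mlin (*) (length [(d, x)]) (?\<Phi> es)" for es
        using tilde_dual_term[OF C us j] by simp
    qed
    then show "multihom (gshift V) ?\<Phi> [x]
      = sg (1 + d + (sum_list (take j ds) + ds ! j) * (sum_list (drop (j + 1) ds) + d))
         (hval (us ! j) (C (drop (j + 1) (map fst us) @ [x] @ take j (map fst us))))"
      by (simp add: hval_eq[OF c[OF j]])
  qed
qed

text \<open>Linearity puts the value of \<open>tilde\<close> into the carrier of the double, where
  the form is bilinear.\<close>

lemma tilde_dual_linear:
  assumes C: "V.mlin (smul M) k C" and us: "us \<in> tuples T k"
  shows "Vector_Spaces.linear (smul V) (*) (tilde_dual C ds us)"
proof -
  have l: "length us = k" using us by (simp add: tuples_def)
  have "sV.mlin (*) 1 (\<lambda>ys. \<Sum>j<k. multihom (gshift V) (\<lambda>es ys.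
     sg (1 + hd es + (sum_list (take j ds) + ds ! j) * (sum_list (drop (j + 1) ds) + hd es))
       (snd (fpart (us ! j)) (C (drop (j + 1) (map fst us) @ ys @ take j (map fst us))))) ys)"
    by (intro sV.mlin_sum[OF vector_space_field] sV.mlin_multihom[OF vector_space_field] tilde_dual_term[OF C us]) auto
  note m = sV.mlinD[OF this, of "[0]" 0]
  show ?thesis
    unfolding Vector_Spaces.linear_iff tilde_dual_def l
    using m by (simp add: V.vector_space_smul vector_space_field tuples_def)
qed

lemma tilde_value_carrier:
  assumes "V.mlin (smul M) k C" and "us \<in> tuples T k"
  shows "(0, C (map fst us), tilde_dual C ds us, 0) \<in> gcarrier D"
  using tilde_dual_linear[OF assms] M'.carrier_0 by (simp add: carrier_D_iff carrier_M')

text \<open>The trivial rotation pairs the \<open>M\<close> component with the functional of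
  \<open>z\<close>. Rotation by \<open>Suc j\<close> brings letter \<open>j\<close> to the end and
  gives the summand \<open>j\<close> of the functional on \<open>V\<close>; the sign in
  \<open>tilde\<close> is, up to that of the form, the sign of this rotation.\<close>

lemma B_tilde_value:
  assumes C: "V.mlin (smul M) k C" and ys: "T.homog ys" "length ys = k" and z: "snd z \<in> hcomp T (fst z)"
  shows "BT [(0, C (map fst (vecs ys)), tilde_dual C (degs ys) (vecs ys), 0), snd z]
    = Cyc (\<lambda>zs. pairing C (vecs zs)) (ys @ [z])"
proof -
  have us: "vecs ys \<in> tuples T k" by (rule T.homog_tuples[OF ys])
  have zc: "snd z \<in> gcarrier D" using T.hcomp_carrier[OF z] by simp
  have x: "fst (snd z) \<in> hcomp V (fst z + 1)" using z by (simp add: hcomp_D_iff)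
  define t where "t j = sg (tdeg (take (Suc j) ys) * (tdeg (drop (Suc j) ys) + fst z))
      (hval (snd (ys ! j)) (C (drop (j + 1) (map fst (vecs ys)) @ [fst (snd z)] @ take j (map fst (vecs ys)))))" for j
  have "tilde_dual C (degs ys) (vecs ys) (fst (snd z)) = (\<Sum>j<k. sg (1 + fst z) (t j))"
    unfolding tilde_dual_homog[OF C us x]
  proof (rule sum.cong[OF refl])
    fix j assume "j \<in> {..<k}"
    then have j: "j < length ys" using ys(2) by simp
    then have "sum_list (take j (degs ys)) + degs ys ! j = tdeg (take (Suc j) ys)"
      by (simp add: take_Suc_conv_app_nth take_map)
    moreover have "sum_list (drop (j + 1) (degs ys)) = tdeg (drop (Suc j) ys)"
      by (simp add: drop_map)
    ultimately show "sg (1 + fst z + (sum_list (take j (degs ys)) + degs ys ! j) * (sum_list (drop (j + 1) (degs ys)) + fst z))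
       (hval (vecs ys ! j) (C (drop (j + 1) (map fst (vecs ys)) @ [fst (snd z)] @ take j (map fst (vecs ys)))))
      = sg (1 + fst z) (t j)"
      using j by (simp add: t_def sg_sg)
  qed
  \<comment> \<open>The sign \<open>fst z\<close> of the form meets \<open>1 + fst z\<close> from
    \<open>tilde\<close>, which leaves the minus sign of \<open>pairing\<close>.\<close>
  then have dual: "sg (fst z) (tilde_dual C (degs ys) (vecs ys) (fst (snd z))) = - (\<Sum>j<k. t j)"
    by (simp add: sg_sum[symmetric] sg_sg sum_negf[symmetric]) (simp add: sg_def sum_negf)
  have rot: "rotate (Suc j) (ys @ [z]) = (drop (Suc j) ys @ [z] @ take j ys) @ [ys ! j]" if "j < k" for j
  proof -
    have "rotate (Suc j) (ys @ [z]) = drop (Suc j) (ys @ [z]) @ take (Suc j) (ys @ [z])"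
      by (rule rotate_drop_take[THEN trans]) (use that ys(2) in simp)
    then show ?thesis
      using that ys(2) by (simp add: take_Suc_conv_app_nth)
  qed
  have "Cyc (\<lambda>zs. pairing C (vecs zs)) (ys @ [z]) = pairing C (vecs (ys @ [z]))
      + (\<Sum>j<k. sg (tdeg (take (Suc j) (ys @ [z])) * tdeg (drop (Suc j) (ys @ [z]))) (pairing C (vecs (rotate (Suc j) (ys @ [z])))))"
    unfolding Cyc_def by (simp add: ys(2) sum.lessThan_Suc_shift del: sum.lessThan_Suc rotate_Suc)
  also have "(\<Sum>j<k. sg (tdeg (take (Suc j) (ys @ [z])) * tdeg (drop (Suc j) (ys @ [z]))) (pairing C (vecs (rotate (Suc j) (ys @ [z])))))
      = (\<Sum>j<k. - t j)"
  proof (rule sum.cong[OF refl])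
    fix j assume "j \<in> {..<k}"
    then have j: "j < k" by simp
    have "vecs (rotate (Suc j) (ys @ [z])) = vecs (drop (Suc j) ys @ [z] @ take j ys) @ [snd (ys ! j)]"
      unfolding rot[OF j] by simp
    then show "sg (tdeg (take (Suc j) (ys @ [z])) * tdeg (drop (Suc j) (ys @ [z]))) (pairing C (vecs (rotate (Suc j) (ys @ [z])))) = - t j"
      using j ys(2) by (simp only: pairing_snoc) (simp add: t_def sg_minus take_map drop_map)
  qed
  finally have "Cyc (\<lambda>zs. pairing C (vecs zs)) (ys @ [z]) = - hval (snd z) (C (map fst (vecs ys))) - (\<Sum>j<k. t j)"
    by (simp add: pairing_snoc sum_negf)
  moreover have "BT [(0, C (map fst (vecs ys)), tilde_dual C (degs ys) (vecs ys), 0), snd z]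
      = sg (fst z) (tilde_dual C (degs ys) (vecs ys) (fst (snd z))) - hval (snd z) (C (map fst (vecs ys)))"
    using B_left[OF tilde_value_carrier[OF C us, of "degs ys"] z] by (simp add: ev_def del: map_map)
  ultimately show ?thesis
    unfolding dual by simp
qed

text \<open>For arbitrary arguments: \<open>tilde\<close> supplies the decomposition of the first
  \<open>k\<close>, bilinearity of \<open>BT\<close> that of the last, and multilinearity of the
  cyclic sum puts the components together again.\<close>

lemma Omega_tilde:
  assumes C: "V.mlin (smul M) k C" and vs: "vs \<in> tuples T (Suc k)"
  shows "Omega V M (tilde V M C) vs = cyclize T (pairing C) vs"
proof -
  obtain us v where v: "vs = us @ [v]"
    using vs by (auto simp: tuples_def length_Suc_conv_rev)
  have us: "us \<in> tuples T k" "v \<in> gcarrier T" and l: "length us = k"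
    using vs by (auto simp: tuples_def v)
  note P = pairing_mlin[OF C]
  let ?\<Phi> = "\<lambda>ds us. (0, C (map fst us), tilde_dual C ds us, 0)"
  let ?p = "\<lambda>ds. map2 (gproj T) ds us"
  have \<Phi>c: "?\<Phi> ds (?p ds) \<in> gcarrier D" if "ds \<in> T.degree_lists k" for ds
    by (rule tilde_value_carrier[OF C]) (use T.map2_gproj_tuples[OF us(1)] that in auto)
  have pc: "gproj T d v \<in> gcarrier D" for d
    using T.gproj_carrier[OF us(2)] by simp
  have vc: "v \<in> gcarrier D" using us(2) by simp
  have "Omega V M (tilde V M C) vs = BT [\<Sum>ds\<in>T.degree_lists k. ?\<Phi> ds (?p ds), v]"
    by (simp add: Omega_def v tilde_eq multihom_def l)
  also have "\<dots> = (\<Sum>ds\<in>T.degree_lists k. BT [?\<Phi> ds (?p ds), v])"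
    by (rule D.additive_sum[where f = "\<lambda>x. BT [x, v]"]) (use B_bilinear(1) vc \<Phi>c in auto)
  also have "\<dots> = (\<Sum>ds\<in>T.degree_lists k. \<Sum>d\<in>degrees T. BT [?\<Phi> ds (?p ds), gproj T d v])"
  proof (rule sum.cong[OF refl])
    fix ds assume ds: "ds \<in> T.degree_lists k"
    have "BT [?\<Phi> ds (?p ds), \<Sum>d\<in>degrees T. gproj T d v] = (\<Sum>d\<in>degrees T. BT [?\<Phi> ds (?p ds), gproj T d v])"
      by (rule D.additive_sum[where f = "\<lambda>x. BT [?\<Phi> ds (?p ds), x]"]) (use B_bilinear(2) pc \<Phi>c[OF ds] in auto)
    then show "BT [?\<Phi> ds (?p ds), v] = (\<Sum>d\<in>degrees T. BT [?\<Phi> ds (?p ds), gproj T d v])"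
      by (simp add: T.sum_gproj[OF us(2)])
  qed
  also have "\<dots> = (\<Sum>ds\<in>T.degree_lists k. \<Sum>d\<in>degrees T. cyclize T (pairing C) (?p ds @ [gproj T d v]))"
  proof (intro sum.cong refl)
    fix ds d assume ds: "ds \<in> T.degree_lists k"
    let ?ys = "T.projs ds us" and ?z = "(d, gproj T d v)"
    have ys: "T.homog ?ys" "length ?ys = k" "degs ?ys = ds" "vecs ?ys = ?p ds"
      using us(1) ds by (simp_all add: T.homog_projs T.length_projs T.degs_projs T.vecs_projs tuples_def)
    have z: "snd ?z \<in> hcomp T (fst ?z)" using T.gproj_hcomp[OF us(2)] by simp
    have "BT [?\<Phi> ds (?p ds), gproj T d v] = Cyc (\<lambda>zs. pairing C (vecs zs)) (?ys @ [?z])"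
      using B_tilde_value[OF C ys(1,2) z] by (simp add: ys)
    also have "\<dots> = cyclize T (pairing C) (vecs (?ys @ [?z]))"
    proof (rule T.cyclize_homog[symmetric])
      fix zs assume "length zs = length (?ys @ [?z])" "T.homog zs" "0 \<in> set (vecs zs)"
      then show "pairing C (vecs zs) = 0"
        using T.mlin_zero[OF P T.homog_tuples] ys(2) by simp
    qed (use ys z in simp)
    finally show "BT [?\<Phi> ds (?p ds), gproj T d v] = cyclize T (pairing C) (?p ds @ [gproj T d v])"
      by (simp add: ys)
  qed
  also have "\<dots> = multihom T (\<lambda>ds. cyclize T (pairing C)) vs"
    by (simp add: v T.multihom_snoc l)
  also have "\<dots> = cyclize T (pairing C) vs"
    using T.mlin_expand[OF T.mlin_cyclize[OF vector_space_field P] vs] ..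
  finally show ?thesis .
qed

lemma Omega_tilde_mlin:
  assumes C: "V.mlin (smul M) k C"
  shows "T.mlin (*) (Suc k) (Omega V M (tilde V M C))"
  using T.mlin_cyclize[OF vector_space_field pairing_mlin[OF C]]
    T.mlin_cong[OF Omega_tilde[OF C]] by simp

lemma Omega_tilde_homog:
  assumes C: "V.mlin (smul M) k C" and zs: "T.homog zs" "length zs = Suc k"
  shows "Omega V M (tilde V M C) (vecs zs) = Cyc (\<lambda>zs. pairing C (vecs zs)) zs"
proof -
  have "cyclize T (pairing C) (vecs zs) = Cyc (\<lambda>zs. pairing C (vecs zs)) zs"
  proof (rule T.cyclize_homog[OF zs(1)])
    fix ys assume "length ys = length zs" "T.homog ys" "0 \<in> set (vecs ys)"
    then show "pairing C (vecs ys) = 0"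
      using T.mlin_zero[OF pairing_mlin[OF C] T.homog_tuples] zs(2) by simp
  qed
  then show ?thesis
    using Omega_tilde[OF C T.homog_tuples[OF zs]] by simp
qed

text \<open>Prepares the use of \<open>Cyc_Sym_butlast\<close>: a symmetrization in the arguments of
  the cochain is one in the first letters of the pairing, with the last letter held fixed.\<close>

lemma pairing_Sym:
  assumes v: "v \<in> gcarrier D"
  shows "- hval v (Sym (\<lambda>xs. C (vecs xs)) (xl zs)) = Sym (\<lambda>xs. pairing C (vecs (xs @ [(d, v)]))) zs"
proof -
  have "- hval v (Sym (\<lambda>xs. C (vecs xs)) (xl zs))
      = (\<Sum>\<sigma> | \<sigma> permutes {..<length zs}. - sg (koszul \<sigma> (degs zs)) (hval v (C (vecs (permute_list \<sigma> (xl zs))))))"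
    by (simp add: Sym_def hval_right[OF v] sum_negf)
  also have "\<dots> = Sym (\<lambda>xs. pairing C (vecs (xs @ [(d, v)]))) zs"
    unfolding Sym_def
  proof (rule sum.cong[OF refl])
    fix \<sigma> assume "\<sigma> \<in> {\<sigma>. \<sigma> permutes {..<length zs}}"
    then have "permute_list \<sigma> (xl zs) = xl (permute_list \<sigma> zs)"
      by (simp add: xl_permute)
    then show "- sg (koszul \<sigma> (degs zs)) (hval v (C (vecs (permute_list \<sigma> (xl zs)))))
        = sg (koszul \<sigma> (degs zs)) (pairing C (vecs (permute_list \<sigma> zs @ [(d, v)])))"
      by (simp add: pairing_snoc sg_minus)
  qed
  finally show ?thesis .
qed

text \<open>For symmetric \<open>C\<close> the pairing is symmetric in all letters but the last, so
  \<open>k!\<close> times it is a partial symmetrization. The cyclic sum completes this to the full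
  one, which is symmetric, and \<open>k!\<close> can be cancelled.\<close>

lemma Omega_tilde_Symmetric:
  assumes C: "V.mlin (smul M) k C" and sym: "graded_sym (gshift V) k C"
    and zs: "T.homog zs" "length zs = Suc k"
  shows "Symmetric (\<lambda>ys. Omega V M (tilde V M C) (vecs ys)) zs"
proof -
  let ?P = "\<lambda>zs. pairing C (vecs zs)"
  have C': "sV.mlin (smul M) k C" using C by (simp add: V.mlin_gshift)
  have S: "Symmetric (\<lambda>ys. C (vecs ys)) xs" if "sV.homog xs" "length xs = k" for xs
    using sym that sV.graded_sym_iff[OF M.vector_space_smul C'] by blast
  have eq: "of_nat (fact k) * Omega V M (tilde V M C) (vecs ys) = Sym ?P ys" if ys: "mset ys = mset zs" for ys
  proof -
    have h: "T.homog ys" "length ys = Suc k"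
      using T.homog_mset[OF ys] mset_eq_length[OF ys] zs by auto
    have "of_nat (fact k) * Omega V M (tilde V M C) (vecs ys) = Cyc (\<lambda>ws. of_nat (fact k) * ?P ws) ys"
      by (simp add: Omega_tilde_homog[OF C h] Cyc_def sum_distrib_left sg_mult_right)
    also have "\<dots> = Cyc (\<lambda>ws. Sym (\<lambda>xs. ?P (xs @ [last ws])) (butlast ws)) ys"
      unfolding Cyc_def
    proof (intro sum.cong refl arg_cong[of _ _ "sg _"])
      fix r
      let ?ws = "rotate r ys"
      have w: "T.homog ?ws" "length ?ws = Suc k"
        using h by (simp_all add: T.homog_def)
      then obtain xs l where xl: "?ws = xs @ [l]" and k: "length xs = k"
        using w(2) unfolding length_Suc_conv_rev by blast
      have xs: "T.homog xs" "snd l \<in> gcarrier D"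
        using w(1) T.hcomp_carrier[of "snd l"] by (auto simp: xl)
      have "Symmetric (\<lambda>xs. ?P (xs @ [l])) xs"
        unfolding Symmetric_def
      proof (intro allI impI)
        fix \<sigma> assume \<sigma>: "\<sigma> permutes {..<length xs}"
        have "C (vecs (permute_list \<sigma> (xl xs))) = sg (koszul \<sigma> (degs xs)) (C (vecs (xl xs)))"
          using S[OF homog_xl[OF xs(1)]] k \<sigma> by (simp add: Symmetric_def)
        then have "C (map fst (vecs (permute_list \<sigma> xs))) = sg (koszul \<sigma> (degs xs)) (C (map fst (vecs xs)))"
          using \<sigma> by (simp flip: xl_permute)
        then show "?P (permute_list \<sigma> xs @ [l]) = sg (koszul \<sigma> (degs xs)) (?P (xs @ [l]))"
          by (simp add: pairing_snoc hval_right[OF xs(2)] sg_minus)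
      qed
      from Sym_Symmetric[OF this] show "of_nat (fact k) * ?P ?ws = Sym (\<lambda>xs. ?P (xs @ [last ?ws])) (butlast ?ws)"
        by (simp add: xl k)
    qed
    also have "\<dots> = Sym ?P ys"
      by (rule Cyc_Sym_butlast) (use h in auto)
    finally show ?thesis .
  qed
  show ?thesis
    unfolding Symmetric_def
  proof (intro allI impI)
    fix \<sigma> assume \<sigma>: "\<sigma> permutes {..<length zs}"
    have "of_nat (fact k) * Omega V M (tilde V M C) (vecs (permute_list \<sigma> zs)) = Sym ?P (permute_list \<sigma> zs)"
      by (rule eq) (use \<sigma> in simp)
    also have "\<dots> = sg (koszul \<sigma> (degs zs)) (Sym ?P zs)"
      using Symmetric_Sym[of ?P zs] \<sigma> by (simp add: Symmetric_def)
    also have "\<dots> = of_nat (fact k) * sg (koszul \<sigma> (degs zs)) (Omega V M (tilde V M C) (vecs zs))"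
      by (simp add: eq[OF refl, symmetric] sg_mult_right)
    finally show "Omega V M (tilde V M C) (vecs (permute_list \<sigma> zs))
        = sg (koszul \<sigma> (degs zs)) (Omega V M (tilde V M C) (vecs zs))"
      by simp
  qed
qed

end

section \<open>The two coboundaries\<close>

locale module_cochain = module_double V M q act
  for V :: "('k::field_char_0, 'v::ab_group_add) gspace"
    and M :: "('k, 'm::ab_group_add) gspace" and q act +
  fixes k :: nat and \<delta> :: int and c :: "'v list \<Rightarrow> 'm"
  assumes cochain: "c \<in> cochains V M k \<delta>"
begin

abbreviation "Q \<equiv> shift_map V q"
abbreviation "QW \<equiv> shift_map W SB"
abbreviation "C \<equiv> shift_map V c"

text \<open>The degree of the shifted map: lowering \<open>k\<close> arguments by one adds
  \<open>k\<close>, lowering the value by one takes away \<open>1\<close>.\<close>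

definition p :: int where "p = \<delta> + int k - 1"

abbreviation "QC \<equiv> Q_commutator V M q act k p C"
abbreviation "E \<equiv> symmetrize (gshift V) QC"

lemma c_mlin: "V.mlin (smul M) k c"
  and c_skew: "skew_sym V k c" and c_degree: "has_degree V M k \<delta> c"
  using cochain by (auto simp: cochains_def V.multilinear_iff)

lemma C_mlin: "V.mlin (smul M) k C"
  by (rule V.mlin_shift_map[OF M.vector_space_smul c_mlin])

lemma C_sym: "graded_sym (gshift V) k C"
  by (rule V.graded_sym_shift_map[OF M.vector_space_smul c_mlin c_skew])

lemma C_Symmetric: "sV.homog zs \<Longrightarrow> length zs = k \<Longrightarrow> Symmetric (\<lambda>ys. C (vecs ys)) zs"
  using C_sym sV.graded_sym_iff[OF M.vector_space_smul, of k C] C_mlin by (simp add: V.mlin_gshift)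

text \<open>The additional \<open>1\<close> converts the shifted degree of the value into its degree
  in \<open>M\<close>.\<close>

lemma C_hcomp:
  assumes zs: "sV.homog zs" "length zs = k"
  shows "C (vecs zs) \<in> hcomp M (tdeg zs + p + 1)"
proof -
  let ?zs = "map (\<lambda>(d, v). (d + 1, v)) zs"
  have "V.homog ?zs" using zs(1) by (simp add: V.homog_gshift)
  then have "c (vecs ?zs) \<in> hcomp M (tdeg ?zs + \<delta>)"
    using c_degree[unfolded V.has_degree_iff, rule_format, of ?zs] zs(2) by simp
  moreover have v: "vecs ?zs = vecs zs" by (simp add: comp_def case_prod_unfold)
  moreover have t: "tdeg ?zs + \<delta> = tdeg zs + p + 1" unfolding tdeg_unshift p_def by (simp add: zs(2))
  ultimately show ?thesis
    unfolding V.shift_map_mlin_homog[OF c_mlin zs] v t by (intro M.hcomp_sg)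
qed

lemma Q_mlin: "V.mlin (smul V) 2 Q"
  by (rule V.mlin_shift_map[OF V.vector_space_smul q_mlin])

lemmas Q_bilinear = V.mlin_2D[OF Q_mlin, unfolded carrier_V, OF UNIV_I UNIV_I UNIV_I]

lemma Q_homog:
  assumes "x \<in> hcomp V (d + 1)" "y \<in> hcomp V (d' + 1)"
  shows "Q [x, y] = sg d (q [x, y])"
  using V.shift_map_mlin_homog[OF q_mlin, of "[(d, x), (d', y)]"] assms by simp

lemma Q_hcomp:
  assumes "x \<in> hcomp V (d + 1)" "y \<in> hcomp V (d' + 1)"
  shows "Q [x, y] \<in> hcomp V (d + d' + 1 + 1)"
  using q_hcomp[OF assms] by (simp add: Q_homog[OF assms] V.hcomp_sg algebra_simps)

lemma QW_mlin: "W.mlin (smul W) 2 QW"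
  by (rule W.mlin_shift_map[OF W.vector_space_smul SB_mlin])

lemmas QW_bilinear = W.mlin_2D[OF QW_mlin, unfolded carrier_W, OF UNIV_I UNIV_I UNIV_I]

lemma QW_homog:
  assumes "w \<in> hcomp W (d + 1)" "w' \<in> hcomp W (d' + 1)"
  shows "QW [w, w'] = sg d (sb (d + 1) w (d' + 1) w')"
  using W.shift_map_mlin_homog[OF SB_mlin, of "[(d, w), (d', w')]"] SB_homog[OF assms] assms
    W.homog_gshift[of "[(d, w), (d', w')]"] by simp

text \<open>Here the second term of the bracket contributes. Its minus sign, its exchange sign in
  unshifted degrees and the shift sign \<open>e\<close> combine to \<open>e * d + d\<close>.\<close>

lemma QW_left:
  assumes "m \<in> hcomp M (e + 1)" "x \<in> hcomp V (d + 1)"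
  shows "snd (QW [(0, m), (x, 0)]) = sg (e * d + d) (act x m)"
  using QW_homog[of "(0, m)" e "(x, 0)" d] assms
  by (simp add: V.hcomp_0 M.hcomp_0 sb_def act_bilinear sg_Pair sg_sg sg_minus[symmetric]) (auto simp: sg_def)

lemma QW_right:
  assumes "m \<in> hcomp M (e + 1)" "x \<in> hcomp V (d + 1)"
  shows "snd (QW [(x, 0), (0, m)]) = sg d (act x m)"
  using QW_homog[of "(x, 0)" d "(0, m)" e] assms
  by (simp add: V.hcomp_0 M.hcomp_0 sb_def act_bilinear sg_Pair)

lemma head_mlin: "V.mlin (smul V) 1 (\<lambda>ys. ys ! 0)"
  by (rule V.mlinI) (auto simp: length_Suc_conv)

lemma commutator_terms_mlin:
  "V.mlin (smul M) (Suc k) (\<lambda>xs. snd (QW [(0, C (take k xs)), (xs ! k, 0)]))"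
  "V.mlin (smul M) (Suc k) (\<lambda>xs. snd (QW [(xs ! 0, 0), (0, C (drop 1 xs))]))"
  "j < k \<Longrightarrow> V.mlin (smul M) (Suc k) (\<lambda>xs. C (take j xs @ [Q [xs ! j, xs ! (j + 1)]] @ drop (j + 2) xs))"
proof -
  have e: "(0 :: 'v, m + m') = (0, m) + (0, m')" "(x + x', 0 :: 'm) = (x, 0) + (x', 0)"
    "(0, smul M a m) = smul W a (0, m)" "(smul V a x, 0) = smul W a (x, 0)"
    "snd (smul W a w) = smul M a (snd w)" for w and a and x x' :: 'v and m m' :: 'm
    by simp_all
  have "V.mlin (smul M) (Suc k) (\<lambda>xs. snd (QW [(0, C (take k xs)), (drop k xs ! 0, 0)]))"
    by (rule V.mlin_outer[OF C_mlin head_mlin, where H = "\<lambda>m x. snd (QW [(0, m), (x, 0)])"])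
      (simp_all only: e QW_bilinear snd_add snd_conv Suc_eq_plus1 add_0_left)
  then show "V.mlin (smul M) (Suc k) (\<lambda>xs. snd (QW [(0, C (take k xs)), (xs ! k, 0)]))"
    by (subst (asm) V.mlin_cong) (auto simp: tuples_def)
  have "V.mlin (smul M) (Suc k) (\<lambda>xs. snd (QW [(take 1 xs ! 0, 0), (0, C (drop 1 xs))]))"
    by (rule V.mlin_outer[OF head_mlin C_mlin, where H = "\<lambda>x m. snd (QW [(x, 0), (0, m)])"])
      (simp_all only: e QW_bilinear snd_add snd_conv plus_1_eq_Suc add_0_left)
  then show "V.mlin (smul M) (Suc k) (\<lambda>xs. snd (QW [(xs ! 0, 0), (0, C (drop 1 xs))]))"
    by (subst (asm) V.mlin_cong) (auto simp: tuples_def)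
  assume j: "j < k"
  show "V.mlin (smul M) (Suc k) (\<lambda>xs. C (take j xs @ [Q [xs ! j, xs ! (j + 1)]] @ drop (j + 2) xs))"
  proof (rule V.mlinI)
    fix vs :: "'v list" and i x y a assume v: "length vs = Suc k" "i < Suc k"
    define us where "us = take j vs @ [Q [vs ! j, vs ! (j + 1)]] @ drop (j + 2) vs"
    have us: "us \<in> tuples V k" using v j by (simp add: us_def tuples_def)
    let ?F = "\<lambda>xs. C (take j xs @ [Q [xs ! j, xs ! (j + 1)]] @ drop (j + 2) xs)"
    consider "i < j" | "i = j" | "i = j + 1" | "j + 1 < i" by linarith
    \<comment> \<open>A change at place \<open>i\<close> changes one entry of \<open>us\<close>:
      through the identity at an outer place, and through \<open>Q\<close> with its other slot fixed
      at the two places that \<open>Q\<close> merges.\<close>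
    then have "\<exists>i' f. i' < k \<and> (\<forall>z. ?F (vs[i := z]) = C (us[i' := f z])) \<and>
        f (x + y) = f x + f y \<and> f (smul V a x) = smul V a (f x)"
    proof cases
      case 1
      then show ?thesis
        using v j by (intro exI[of _ i] exI[of _ id]) (simp add: us_def list_update_append take_update_swap)
    next
      case 2
      then show ?thesis
        using v j by (intro exI[of _ j] exI[of _ "\<lambda>z. Q [z, vs ! (j + 1)]"])
          (simp add: us_def list_update_append list_update_beyond Q_bilinear)
    next
      case 3
      then show ?thesis
        using v j by (intro exI[of _ j] exI[of _ "\<lambda>z. Q [vs ! j, z]"])
          (simp add: us_def list_update_append list_update_beyond Q_bilinear)
    next
      case 4
      then obtain t where t: "i = j + 2 + t"
        using le_Suc_ex[of "j + 2" i] by auto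
      then show ?thesis
        using v j by (intro exI[of _ "Suc (j + t)"] exI[of _ id])
          (simp add: us_def list_update_append list_update_beyond take_update_swap drop_update_swap)
    qed
    then obtain i' f where i': "i' < k" "\<And>z. ?F (vs[i := z]) = C (us[i' := f z])"
        "f (x + y) = f x + f y" "f (smul V a x) = smul V a (f x)"
      by blast
    show "?F (vs[i := x + y]) = ?F (vs[i := x]) + ?F (vs[i := y]) \<and> ?F (vs[i := smul V a x]) = smul M a (?F (vs[i := x]))"
      unfolding i'(2-4) using V.mlinD[OF C_mlin us i'(1)] by simp
  qed
qed

lemma commutator_body_mlin:
  "V.mlin (smul M) (Suc k) (\<lambda>xs. snd (QW [(0, C (take k xs)), (xs ! k, 0)])
     + sg (p * ds ! 0) (snd (QW [(xs ! 0, 0), (0, C (drop 1 xs))]))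
     - (\<Sum>j<k. sg (p + sum_list (take j ds)) (C (take j xs @ [Q [xs ! j, xs ! (j + 1)]] @ drop (j + 2) xs))))"
  by (intro V.mlin_diff[OF M.vector_space_smul] V.mlin_add[OF M.vector_space_smul] V.mlin_sum[OF M.vector_space_smul]
      V.mlin_sg[OF M.vector_space_smul] commutator_terms_mlin) simp

lemma QC_mlin: "V.mlin (smul M) (Suc k) QC"
  unfolding Q_commutator_def Let_def V.mlin_gshift[symmetric]
  by (rule sV.mlin_multihom[OF M.vector_space_smul]) (use commutator_body_mlin in \<open>simp add: V.mlin_gshift\<close>)

lemma QC_homog:
  assumes zs: "sV.homog zs" "length zs = Suc k"
  shows "QC (vecs zs) = sg ((p + tdeg (take k zs)) * fst (zs ! k) + fst (zs ! k)) (act (snd (zs ! k)) (C (vecs (take k zs))))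
    + sg ((p + 1) * fst (zs ! 0)) (act (snd (zs ! 0)) (C (vecs (drop 1 zs))))
    - (\<Sum>j<k. sg (p + tdeg (take j zs))
        (C (vecs (take j zs) @ [Q [snd (zs ! j), snd (zs ! (j + 1))]] @ vecs (drop (j + 2) zs))))"
proof -
  have "sV.homog (take k zs)" "sV.homog (drop 1 zs)"
    using zs(1) by (auto simp: sV.homog_def dest: in_set_takeD in_set_dropD)
  then have m: "C (vecs (take k zs)) \<in> hcomp M (tdeg (take k zs) + p + 1)" "C (vecs (drop 1 zs)) \<in> hcomp M (tdeg (drop 1 zs) + p + 1)"
    using C_hcomp zs(2) by simp_all
  have x: "snd (zs ! i) \<in> hcomp V (fst (zs ! i) + 1)" if "i \<le> k" for i
    using sV.homog_nth[OF zs(1), of i] that zs(2) by simp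
  have "QC (vecs zs) = snd (QW [(0, C (take k (vecs zs))), (vecs zs ! k, 0)])
     + sg (p * degs zs ! 0) (snd (QW [(vecs zs ! 0, 0), (0, C (drop 1 (vecs zs)))]))
     - (\<Sum>j<k. sg (p + sum_list (take j (degs zs)))
          (C (take j (vecs zs) @ [Q [vecs zs ! j, vecs zs ! (j + 1)]] @ drop (j + 2) (vecs zs))))"
    unfolding Q_commutator_def Let_def
    by (rule sV.multihom_mlin_homog[OF zs(1), where s = "smul M"])
      (use commutator_body_mlin zs(2) in \<open>simp add: V.mlin_gshift\<close>)
  also have "snd (QW [(0, C (take k (vecs zs))), (vecs zs ! k, 0)])
      = sg ((p + tdeg (take k zs)) * fst (zs ! k) + fst (zs ! k)) (act (snd (zs ! k)) (C (vecs (take k zs))))"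
    using QW_left[OF m(1) x[of k]] zs(2) by (simp add: take_map add.commute)
  also have "sg (p * degs zs ! 0) (snd (QW [(vecs zs ! 0, 0), (0, C (drop 1 (vecs zs)))]))
      = sg ((p + 1) * fst (zs ! 0)) (act (snd (zs ! 0)) (C (vecs (drop 1 zs))))"
  proof -
    have "zs \<noteq> []" using zs(2) by auto
    then show ?thesis
      using QW_right[OF m(2) x[of 0]] by (simp add: drop_map sg_sg distrib_right)
  qed
  also have "(\<Sum>j<k. sg (p + sum_list (take j (degs zs)))
          (C (take j (vecs zs) @ [Q [vecs zs ! j, vecs zs ! (j + 1)]] @ drop (j + 2) (vecs zs))))
      = (\<Sum>j<k. sg (p + tdeg (take j zs))
        (C (vecs (take j zs) @ [Q [snd (zs ! j), snd (zs ! (j + 1))]] @ vecs (drop (j + 2) zs))))"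
    by (rule sum.cong) (use zs(2) in \<open>simp_all add: take_map drop_map\<close>)
  finally show ?thesis .
qed

lemma C_insert_hcomp:
  assumes "sV.homog (A @ [y1, y2] @ B)" "length A + length B + 1 = k"
  shows "C (vecs A @ [Q [snd y1, snd y2]] @ vecs B) \<in> hcomp M (tdeg (A @ [y1, y2] @ B) + p + 2)"
    and "sV.homog (A @ [(fst y1 + fst y2 + 1, Q [snd y1, snd y2])] @ B)"
proof -
  show h: "sV.homog (A @ [(fst y1 + fst y2 + 1, Q [snd y1, snd y2])] @ B)"
    using assms(1) Q_hcomp[of "snd y1" "fst y1" "snd y2" "fst y2"] by simp
  from C_hcomp[OF h] show "C (vecs A @ [Q [snd y1, snd y2]] @ vecs B) \<in> hcomp M (tdeg (A @ [y1, y2] @ B) + p + 2)"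
    using assms(2) by (simp add: algebra_simps)
qed

text \<open>All three kinds of terms exceed the degree of \<open>C\<close> by one. The additional
  argument accounts for this, so the coboundary keeps \<open>\<delta>\<close>.\<close>

lemma QC_hcomp:
  assumes zs: "sV.homog zs" "length zs = Suc k"
  shows "QC (vecs zs) \<in> hcomp M (tdeg zs + p + 2)"
proof -
  obtain z ws where z: "zs = z # ws" using zs(2) by (cases zs) auto
  obtain ys y where y: "zs = ys @ [y]" using zs(2) by (auto simp: length_Suc_conv_rev)
  have 1: "act (snd (zs ! k)) (C (vecs (take k zs))) \<in> hcomp M (tdeg zs + p + 2)"
    using act_hcomp[of "snd y" "fst y + 1" "C (vecs ys)" "tdeg ys + p + 1"] C_hcomp[of ys] zs
    by (simp add: y nth_append algebra_simps)
  have 2: "act (snd (zs ! 0)) (C (vecs (drop 1 zs))) \<in> hcomp M (tdeg zs + p + 2)"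
    using act_hcomp[of "snd z" "fst z + 1" "C (vecs ws)" "tdeg ws + p + 1"] C_hcomp[of ws] zs
    by (simp add: z algebra_simps)
  have 3: "C (vecs (take j zs) @ [Q [snd (zs ! j), snd (zs ! (j + 1))]] @ vecs (drop (j + 2) zs)) \<in> hcomp M (tdeg zs + p + 2)"
    if "j < k" for j
  proof -
    have "zs = take j zs @ [zs ! j, zs ! (j + 1)] @ drop (j + 2) zs"
      using that zs(2) by (simp add: Cons_nth_drop_Suc)
    then show ?thesis
      using C_insert_hcomp(1)[of "take j zs" "zs ! j" "zs ! (j + 1)" "drop (j + 2) zs"] zs that by simp
  qed
  show ?thesis
    unfolding QC_homog[OF zs]
    by (intro M.subspace_diff[OF M.subspace_hcomp] M.hcomp_add M.hcomp_sum M.hcomp_sg 1 2 3) simp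
qed

lemma E_mlin: "V.mlin (smul M) (Suc k) E"
  using sV.mlin_symmetrize[OF M.vector_space_smul, of "Suc k" QC] QC_mlin by (simp add: V.mlin_gshift)

lemma E_homog: "sV.homog zs \<Longrightarrow> length zs = Suc k \<Longrightarrow> E (vecs zs) = Sym (\<lambda>ys. QC (vecs ys)) zs"
  by (rule sV.symmetrize_homog[OF M.vector_space_smul]) (simp_all add: V.mlin_gshift QC_mlin)

lemma chevalley_d_eq: "chevalley_d V M q act k \<delta> c = shift_map V E"
  by (simp add: chevalley_d_def p_def)

text \<open>\<open>symmetrize\<close> makes the shifted coboundary graded symmetric, and the shift
  back turns this into skew symmetry.\<close>

lemma chevalley_d_cochain: "chevalley_d V M q act k \<delta> c \<in> cochains V M (Suc k) \<delta>"
proof -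
  have "graded_sym (gshift V) (Suc k) E"
    by (rule sV.graded_sym_symmetrize[OF M.vector_space_smul]) (simp add: V.mlin_gshift QC_mlin)
  then have "skew_sym V (Suc k) (shift_map V E)"
    by (rule V.skew_sym_shift_map[OF M.vector_space_smul E_mlin])
  moreover have "has_degree V M (Suc k) \<delta> (shift_map V E)"
    unfolding V.has_degree_iff
  proof (intro allI impI)
    fix zs assume zs: "V.homog zs" "length zs = Suc k"
    let ?zs = "map (\<lambda>(d, v). (d - 1, v)) zs"
    have z: "sV.homog ?zs" "vecs ?zs = vecs zs" "length ?zs = Suc k"
      using zs by (simp_all add: V.homog_gshift comp_def case_prod_unfold)
    have "tdeg ?zs = tdeg zs - int (length zs)"
      by (induction zs) auto
    \<comment> \<open>The \<open>k + 1\<close> letters lose one degree each by the shift, which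
      \<open>p + 2 = \<delta> + k + 1\<close> restores.\<close>
    then have t: "tdeg ?zs + p + 2 = tdeg zs + \<delta>"
      using zs(2) by (simp add: p_def)
    have "Sym (\<lambda>ys. QC (vecs ys)) ?zs \<in> hcomp M (tdeg ?zs + p + 2)"
      unfolding Sym_def
    proof (intro M.hcomp_sum M.hcomp_sg)
      fix \<sigma> assume "\<sigma> \<in> {\<sigma>. \<sigma> permutes {..<length ?zs}}"
      then have m: "mset (permute_list \<sigma> ?zs) = mset ?zs" by simp
      show "QC (vecs (permute_list \<sigma> ?zs)) \<in> hcomp M (tdeg ?zs + p + 2)"
        using QC_hcomp[of "permute_list \<sigma> ?zs"] sV.homog_mset[OF m] z tdeg_mset[OF m] by simp
    qed
    then have "E (vecs ?zs) \<in> hcomp M (tdeg zs + \<delta>)"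
      unfolding t E_homog[OF z(1,3)] .
    then show "shift_map V E (vecs zs) \<in> hcomp M (tdeg zs + \<delta>)"
      using V.shift_map_mlin_homog[OF E_mlin z(1,3)] unfolding z(2) by (simp only: M.hcomp_sg)
  qed
  ultimately show ?thesis
    using V.mlin_shift_map[OF M.vector_space_smul E_mlin]
    by (simp add: cochains_def chevalley_d_eq V.multilinear_iff)
qed


section \<open>Normal forms of the two kinds of terms\<close>

abbreviation "\<Omega>C \<equiv> Omega V M (tilde V M C)"

text \<open>Normal form with the acting letter first and the functional last. The sign is that of
  the second summand of the commutator, which has this shape from the start.\<close>

definition act_term :: "(int \<times> ('k, 'v, 'm) double) list \<Rightarrow> 'k" where
  "act_term zs = - sg ((p + 1) * fst (hd zs))
     (hval (snd (last zs)) (act (fst (snd (hd zs))) (C (map fst (vecs (tl (butlast zs)))))))"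

text \<open>Normal form with the two bracketed letters first and the functional last; the sign is
  that of the summand \<open>j = 0\<close> of the commutator.\<close>

definition bracket_term :: "(int \<times> ('k, 'v, 'm) double) list \<Rightarrow> 'k" where
  "bracket_term zs = sg p (hval (snd (last zs))
     (C (Q [fst (snd (hd zs)), fst (snd (hd (tl zs)))] # map fst (vecs (tl (tl (butlast zs)))))))"

lemma act_term_eq: "act_term ([z] @ A @ [l])
    = - sg ((p + 1) * fst z) (hval (snd l) (act (fst (snd z)) (C (map fst (vecs A)))))"
  by (simp add: act_term_def butlast_append)

lemma bracket_term_eq: "bracket_term ([y, z] @ A @ [l])
    = sg p (hval (snd l) (C (Q [fst (snd y), fst (snd z)] # map fst (vecs A))))"
  by (simp add: bracket_term_def butlast_append)

lemma C_move:
  assumes "sV.homog (A @ [w] @ B)" "length A + length B + 1 = k"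
  shows "C (vecs A @ [snd w] @ vecs B) = sg (tdeg A * fst w) (C (snd w # vecs A @ vecs B))"
proof -
  have "sV.homog ([] @ [w] @ A @ B)" using assms(1) by simp
  then have "Symmetric (\<lambda>ys. C (vecs ys)) ([] @ [w] @ A @ B)"
    using assms(2) by (intro C_Symmetric) auto
  from Symmetric_block[OF this] show ?thesis by (simp add: mult.commute)
qed

lemma C_rotate:
  assumes "sV.homog ([w] @ A @ B)" "length A + length B + 1 = k"
  shows "C (vecs B @ [snd w] @ vecs A) = sg (tdeg B * (fst w + tdeg A)) (C (snd w # vecs A @ vecs B))"
proof -
  have "Symmetric (\<lambda>ys. C (vecs ys)) ([] @ (w # A) @ B @ [])"
    using assms by (intro C_Symmetric) auto
  from Symmetric_block[OF this] show ?thesis by (simp add: mult.commute)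
qed

text \<open>These are the two components of the inserted vector that the form of \<open>C\<close>
  sees. The functional comes from the two coadjoint actions; at \<open>(0, m)\<close> the bracket of
  \<open>W\<close> reduces to the action on \<open>m\<close>.\<close>

lemma QT_parts:
  assumes z: "snd z1 \<in> hcomp T (fst z1)" "snd z2 \<in> hcomp T (fst z2)"
  shows "fst (QT [snd z1, snd z2]) = Q [fst (snd z1), fst (snd z2)]"
    and "m \<in> hcomp M n \<Longrightarrow> hval (QT [snd z1, snd z2]) m
      = sg (fst z1) (hval (snd z1) (act (fst (snd z2)) m))
        - sg (fst z1 + (fst z1 + 1) * (fst z2 + 1)) (hval (snd z2) (act (fst (snd z1)) m))"
proof -
  have x: "fst (snd z1) \<in> hcomp V (fst z1 + 1)" "fst (snd z2) \<in> hcomp V (fst z2 + 1)"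
    using z by (simp_all add: hcomp_D_iff)
  have w: "wpart (snd z1) \<in> hcomp W (fst z1 + 1)" "wpart (snd z2) \<in> hcomp W (fst z2 + 1)"
    using z by (simp_all only: T_hcomp hcomp_D_iff)
  have c: "snd z1 \<in> gcarrier D" "snd z2 \<in> gcarrier D"
    using z T.hcomp_carrier by (metis gcarrier_gshift)+
  show "fst (QT [snd z1, snd z2]) = Q [fst (snd z1), fst (snd z2)]"
    by (simp add: QT_homog[OF z] Q_homog[OF x] dbr_def Let_def sb_def sg_def)
  assume m: "m \<in> hcomp M n"
  then have m': "(0, m) \<in> hcomp W n" by (simp add: V.hcomp_0)
  have SBm: "SB [wpart (snd z1), (0, m)] = (0, act (fst (snd z1)) m)" "SB [wpart (snd z2), (0, m)] = (0, act (fst (snd z2)) m)"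
    by (simp_all add: SB_homog[OF w(1) m'] SB_homog[OF w(2) m'] sb_def q_zero act_bilinear)
  have "hval (QT [snd z1, snd z2]) m = sg (fst z1) (ev (fpart (dbr (fst z1 + 1) (snd z1) (fst z2 + 1) (snd z2))) (0, m))"
    unfolding QT_homog[OF z] by (simp add: sg_def ev_minus_left)
  also have "fpart (dbr (fst z1 + 1) (snd z1) (fst z2 + 1) (snd z2))
      = da (fst z1 + 1) (wpart (snd z1)) (fst z2 + 1) (fpart (snd z2))
        - sg ((fst z1 + 1) * (fst z2 + 1)) (da (fst z2 + 1) (wpart (snd z2)) (fst z1 + 1) (fpart (snd z1)))"
    by (simp add: dbr_def Let_def)
  finally show "hval (QT [snd z1, snd z2]) m
      = sg (fst z1) (hval (snd z1) (act (fst (snd z2)) m))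
        - sg (fst z1 + (fst z1 + 1) * (fst z2 + 1)) (hval (snd z2) (act (fst (snd z1)) m))"
    by (simp add: ev_diff_left ev_sg_left ev_dual_act c SBm sg_sg) (auto simp: sg_def)
qed

subsection \<open>The Chevalley side\<close>

lemma pairing_QC:
  assumes zs: "T.homog zs" "length zs = k + 2"
  shows "pairing QC (vecs zs)
    = - sg ((p + tdeg (take k zs)) * fst (zs ! k) + fst (zs ! k))
        (hval (snd (last zs)) (act (fst (snd (zs ! k))) (C (map fst (vecs (take k zs))))))
      + act_term zs
      + (\<Sum>j<k. sg (p + tdeg (take j zs)) (hval (snd (last zs))
          (C (map fst (vecs (take j zs)) @ [Q [fst (snd (zs ! j)), fst (snd (zs ! (j + 1)))]]
            @ map fst (vecs (drop (j + 2) (butlast zs)))))))"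
proof -
  obtain xs l where "zs = xs @ [l]" and "length xs = Suc k"
    using zs(2) length_Suc_conv_rev[of zs "Suc k"] by auto
  then obtain z ys where z: "zs = z # ys @ [l]" and ys: "length ys = k"
    by (cases xs) auto
  have l: "snd l \<in> gcarrier D" using zs(1) T.hcomp_carrier[of "snd l" "fst l"] by (simp add: z)
  have h: "sV.homog (xl (z # ys))" "length (xl (z # ys)) = Suc k"
    using homog_xl[of "z # ys"] zs(1) ys by (simp_all add: z)
  have xl_nth: "fst (xl (z # ys) ! i) = fst (zs ! i)" "snd (xl (z # ys) ! i) = fst (snd (zs ! i))" if "i \<le> k" for i
  proof -
    have "xl (z # ys) ! i = (\<lambda>(d, v). (d, fst v)) ((z # ys) ! i)"
      unfolding xl_def by (rule nth_map) (use that ys in simp)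
    moreover have "(z # ys) ! i = zs ! i"
      using that ys by (simp add: z nth_append nth_Cons' flip: append_Cons)
    ultimately show "fst (xl (z # ys) ! i) = fst (zs ! i)" "snd (xl (z # ys) ! i) = fst (snd (zs ! i))"
      by (simp_all add: case_prod_unfold)
  qed
  have t: "take j (xl (z # ys)) = xl (take j zs)" if "j \<le> k" for j
    using that ys by (simp add: z xl_def take_map flip: append_Cons list.map(2))
  have d: "drop j (xl (z # ys)) = xl (drop j (butlast zs))" for j
    by (simp add: z xl_def drop_map butlast_append flip: append_Cons list.map(2))
  have "pairing QC (vecs zs) = - hval (snd l) (QC (vecs (xl (z # ys))))"
    using pairing_snoc[of QC "vecs (z # ys)" "snd l"] by (simp add: z)
  also have "\<dots> = - sg ((p + tdeg (take k zs)) * fst (zs ! k) + fst (zs ! k))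
        (hval (snd l) (act (fst (snd (zs ! k))) (C (map fst (vecs (take k zs))))))
      - sg ((p + 1) * fst (zs ! 0)) (hval (snd l) (act (fst (snd (zs ! 0))) (C (map fst (vecs (drop 1 (butlast zs)))))))
      + (\<Sum>j<k. sg (p + tdeg (take j zs)) (hval (snd l)
          (C (map fst (vecs (take j zs)) @ [Q [fst (snd (zs ! j)), fst (snd (zs ! (j + 1)))]]
            @ map fst (vecs (drop (j + 2) (butlast zs)))))))"
    unfolding QC_homog[OF h] d using t xl_nth by (simp add: hval_right[OF l] del: xl_simps(2))
  finally show ?thesis
    by (simp add: act_term_def z butlast_append)
qed

lemma Sym_pairing_QC:
  assumes zs: "T.homog zs" "length zs = k + 2"
  shows "Sym (\<lambda>ys. pairing QC (vecs ys)) zs = 2 * Sym act_term zs + of_nat k * Sym bracket_term zs"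
proof -
  define A where "A zs = - sg ((p + tdeg (take k zs)) * fst (zs ! k) + fst (zs ! k))
        (hval (snd (last zs)) (act (fst (snd (zs ! k))) (C (map fst (vecs (take k zs))))))" for zs
  define B where "B j zs = sg (p + tdeg (take j zs)) (hval (snd (last zs))
          (C (map fst (vecs (take j zs)) @ [Q [fst (snd (zs ! j)), fst (snd (zs ! (j + 1)))]]
            @ map fst (vecs (drop (j + 2) (butlast zs))))))" for j zs
  have hom: "T.homog ys \<and> length ys = k + 2" if "mset ys = mset zs" for ys
    using T.homog_mset[OF that] mset_eq_length[OF that] zs by simp
  have "Sym (\<lambda>ys. pairing QC (vecs ys)) zs = Sym (\<lambda>ys. A ys + act_term ys + (\<Sum>j<k. B j ys)) zs"
    by (rule Sym_cong) (use hom pairing_QC in \<open>auto simp: A_def B_def\<close>)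
  also have "\<dots> = Sym A zs + Sym act_term zs + (\<Sum>j<k. Sym (B j) zs)"
    by (simp add: Sym_add Sym_sum)
  \<comment> \<open>The acting letter at place \<open>k\<close> is moved in front of the first
    \<open>k\<close> letters.\<close>
  also have "Sym A zs = Sym act_term zs"
  proof (rule Sym_block_swap[where p = 0 and a = k and b = 1 and c = 1])
    fix P A' B' R :: "(int \<times> ('k, 'v, 'm) double) list"
    assume l: "length P = 0" "length A' = k" "length B' = 1" "length R = 1"
    obtain y r where y: "B' = [y]" "R = [r]"
      using l(3,4) length_Suc_0_D by (metis One_nat_def)
    show "A (P @ A' @ B' @ R) = sg (tdeg A' * tdeg B') (act_term (P @ B' @ A' @ R))"
      using l act_term_eq[of y A' r] by (simp add: y A_def nth_append sg_minus sg_sg) (auto simp: sg_def)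
  qed (use zs in simp)
  also have "(\<Sum>j<k. Sym (B j) zs) = (\<Sum>j<k. Sym bracket_term zs)"
  proof (rule sum.cong[OF refl])
    fix j assume "j \<in> {..<k}"
    then have j: "j < k" by simp
    \<comment> \<open>The pair at places \<open>j\<close> and \<open>j + 1\<close> moves to the
      front. \<open>C_move\<close> moves its bracket, which has one degree more than the pair, and
      the surplus \<open>tdeg A'\<close> cancels the one in the commutator.\<close>
    show "Sym (B j) zs = Sym bracket_term zs"
    proof (rule Sym_block_swap[where p = 0 and a = j and b = 2 and c = "k - j"])
      fix P A' B' R :: "(int \<times> ('k, 'v, 'm) double) list"
      assume m: "mset (P @ A' @ B' @ R) = mset zs"
        and l: "length P = 0" "length A' = j" "length B' = 2" "length R = k - j"
      obtain y1 y2 where y: "B' = [y1, y2]"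
        using l(3) by (auto simp: numeral_2_eq_2 length_Suc_conv)
      have "R \<noteq> []" using l(4) j by auto
      then obtain R' r where r: "R = R' @ [r]"
        by (metis append_butlast_last_id)
      have h: "T.homog (A' @ [y1, y2] @ R')" using hom[OF m] by (simp add: y r)
      have len: "length (xl A') + length (xl R') + 1 = k" using l j by (simp add: r)
      have r': "snd r \<in> gcarrier D" using hom[OF m] T.hcomp_carrier[of "snd r" "fst r"] by (simp add: r)
      let ?Q = "Q [fst (snd y1), fst (snd y2)]"
      have "sV.homog (xl A' @ [(fst y1 + fst y2 + 1, ?Q)] @ xl R')"
        using C_insert_hcomp(2)[of "xl A'" "(fst y1, fst (snd y1))" "(fst y2, fst (snd y2))" "xl R'"] homog_xl[OF h] len by simp
      from C_move[OF this len] have "C (map fst (vecs A') @ [?Q] @ map fst (vecs R'))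
          = sg (tdeg A' * (fst y1 + fst y2 + 1)) (C (?Q # map fst (vecs A' @ vecs R')))"
        by simp
      moreover have "B j (P @ A' @ B' @ R) = sg (p + tdeg A') (hval (snd r) (C (map fst (vecs A') @ [?Q] @ map fst (vecs R'))))"
        using l by (simp add: B_def y r nth_append butlast_append)
      moreover have "bracket_term (P @ B' @ A' @ R) = sg p (hval (snd r) (C (?Q # map fst (vecs A' @ vecs R'))))"
        using l bracket_term_eq[of y1 y2 "A' @ R'" r] by (simp add: y r)
      ultimately show "B j (P @ A' @ B' @ R) = sg (tdeg A' * tdeg B') (bracket_term (P @ B' @ A' @ R))"
        by (simp add: hval_right[OF r'] sg_sg y) (auto simp: sg_def)
    qed (use zs j in simp)
  qed
  finally show ?thesis by simp
qed

lemma Omega_chevalley: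
  assumes zs: "T.homog zs" "length zs = k + 2"
  shows "Omega_cochain V M (chevalley_d V M q act k \<delta> c) (vecs zs)
    = 2 * Sym act_term zs + of_nat k * Sym bracket_term zs"
proof -
  \<comment> \<open>The shift inside \<open>Omega_cochain\<close> undoes the one with which
    \<open>chevalley_d\<close> ends.\<close>
  let ?E = "shift_map V (shift_map V E)"
  have E': "V.mlin (smul M) (Suc k) ?E"
    by (intro V.mlin_shift_map[OF M.vector_space_smul] E_mlin)
  have E'_eq: "?E (vecs xs) = Sym (\<lambda>ys. QC (vecs ys)) xs" if "sV.homog xs" "length xs = Suc k" for xs
    using V.shift_map_shift_map[OF M.vector_space_smul E_mlin, of "vecs xs"] E_homog[OF that] that(2) by (simp add: tuples_def)
  have "Omega_cochain V M (chevalley_d V M q act k \<delta> c) (vecs zs) = Cyc (\<lambda>ys. pairing ?E (vecs ys)) zs"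
    unfolding Omega_cochain_def chevalley_d_eq using Omega_tilde_homog[OF E' zs(1)] zs(2) by simp
  also have "\<dots> = Cyc (\<lambda>ws. Sym (\<lambda>xs. pairing QC (vecs (xs @ [last ws]))) (butlast ws)) zs"
    unfolding Cyc_def
  proof (intro sum.cong refl arg_cong[of _ _ "sg _"])
    fix r
    let ?ws = "rotate r zs"
    have w: "T.homog ?ws" "length ?ws = Suc (Suc k)"
      using zs by (simp_all add: T.homog_def)
    then obtain xs l where xl: "?ws = xs @ [l]" and k: "length xs = Suc k"
      unfolding length_Suc_conv_rev[of ?ws] by blast
    have xs: "T.homog xs" "snd l \<in> gcarrier D"
      using w(1) T.hcomp_carrier[of "snd l" "fst l"] by (auto simp: xl)
    have "pairing ?E (vecs ?ws) = - hval (snd l) (Sym (\<lambda>ys. QC (vecs ys)) (xl xs))"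
      using E'_eq[OF homog_xl[OF xs(1)]] k by (simp add: xl pairing_snoc)
    also have "\<dots> = Sym (\<lambda>xs. pairing QC (vecs (xs @ [last ?ws]))) (butlast ?ws)"
      using pairing_Sym[OF xs(2), of QC xs "fst l"] by (simp add: xl)
    finally show "pairing ?E (vecs ?ws) = Sym (\<lambda>xs. pairing QC (vecs (xs @ [last ?ws]))) (butlast ?ws)" .
  qed
  also have "\<dots> = Sym (\<lambda>ys. pairing QC (vecs ys)) zs"
    by (rule Cyc_Sym_butlast) (use zs in auto)
  finally show ?thesis
    by (simp add: Sym_pairing_QC[OF zs])
qed

end

subsection \<open>The Pinczon side\<close>

context module_double
begin

text \<open>What remains of the Pinczon tensor after summation over the dual bases, which no longer
  occur in it.\<close>

definition insert_bracket :: "(('k, 'v, 'm) double list \<Rightarrow> 'k) \<Rightarrow> (int \<times> ('k, 'v, 'm) double) list \<Rightarrow> 'k" where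
  "insert_bracket F zs = sg (tdeg zs) (F (QT [snd (zs ! 0), snd (zs ! 1)] # vecs (drop 2 zs)))"

lemma pinczon_homog:
  assumes e: "dual_bases D b N e e'" and F: "T.mlin (*) (Suc k) F" and zs: "T.homog zs" "length zs = k + 2"
  shows "pinczon T N e e' 2 (Omega_bracket V M q act) F (vecs zs) = Cyc (insert_bracket F) zs"
proof -
  let ?I = "\<lambda>i. insert_tensor T 2 (e i) (e' i) (Omega_bracket V M q act) F"
  note c = dual_bases_carrier[OF e]
  have "pinczon T N e e' 2 (Omega_bracket V M q act) F (vecs zs) = (\<Sum>i<N. Cyc (\<lambda>ys. ?I i (vecs ys)) zs)"
    unfolding pinczon_def
  proof (rule sum.cong[OF refl])
    fix i assume "i \<in> {..<N}"
    then have i: "e i \<in> gcarrier D" "e' i \<in> gcarrier D" using c by auto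
    show "cyclize T (?I i) (vecs zs) = Cyc (\<lambda>ys. ?I i (vecs ys)) zs"
    proof (rule T.cyclize_homog[OF zs(1)])
      fix ys assume ys: "length ys = length zs" "T.homog ys" "0 \<in> set (vecs ys)"
      then obtain y1 y2 xs where y: "ys = y1 # y2 # xs" and k: "length xs = k"
        using zs(2) by (metis length_2E)
      have h: "snd y1 \<in> hcomp T (fst y1)" "snd y2 \<in> hcomp T (fst y2)" "T.homog xs"
        using ys(2) by (simp_all add: y)
      have z: "b [e i, QT [snd y1, snd y2]] * F (gproj T d (e' i) # vecs xs) = 0" for d
      proof (cases "0 \<in> set (vecs xs)")
        case True
        have "gproj T d (e' i) # vecs xs \<in> tuples T (Suc k)"
          using T.homog_tuples[OF h(3) k] T.gproj_carrier[of "e' i" d] i by (simp add: tuples_def)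
        from T.mlin_zero[OF F this] True show ?thesis by simp
      next
        case False
        then have "snd y1 = 0 \<or> snd y2 = 0" using ys(3) by (auto simp: y)
        then show ?thesis
          using QT_zero[OF h(1,2)] b_scale_right[OF i(1) D.carrier_0, of 0] by simp
      qed
      show "?I i (vecs ys) = 0"
        unfolding y insert_tensor_homog[OF F ys(2)[unfolded y] k i] z by simp
    qed
  qed
  also have "\<dots> = Cyc (\<lambda>ys. \<Sum>i<N. ?I i (vecs ys)) zs"
    unfolding Cyc_def sg_sum by (rule sum.swap)
  also have "\<dots> = Cyc (insert_bracket F) zs"
    unfolding Cyc_def
  proof (intro sum.cong refl arg_cong[of _ _ "sg _"])
    fix r
    have "T.homog (rotate r zs)" "length (rotate r zs) = k + 2"
      using zs by (simp_all add: T.homog_def)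
    then obtain y1 y2 xs where y: "rotate r zs = y1 # y2 # xs" and k: "length xs = k" and h: "T.homog (y1 # y2 # xs)"
      by (metis length_2E)
    show "(\<Sum>i<N. ?I i (vecs (rotate r zs))) = insert_bracket F (rotate r zs)"
      unfolding y insert_tensor_sum[OF e F h k] by (simp add: insert_bracket_def)
  qed
  finally show ?thesis .
qed

text \<open>Common frame for both versions of the commutation, with \<open>F\<close> the form of a
  cochain or its symmetrization. The factor \<open>k + 2\<close> is that of
  \<open>Sym_Cyc\<close>.\<close>

lemma pinczon_d_eqI:
  assumes e: "dual_bases D b N e e'" and F: "T.mlin (*) (Suc k) F" and G: "T.mlin (*) (k + 2) G"
    and eq: "\<And>zs. T.homog zs \<Longrightarrow> length zs = k + 2 \<Longrightarrow> of_nat (k + 2) * Sym (insert_bracket F) zs = G (vecs zs)"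
    and vs: "vs \<in> tuples T (k + 2)"
  shows "pinczon_d V M q act N e e' F vs = G vs"
proof -
  let ?P = "pinczon T N e e' 2 (Omega_bracket V M q act) F"
  \<comment> \<open>Unfolding \<open>symmetrize\<close> and comparing at each list of degrees asks
    for no multilinearity of the Pinczon bracket.\<close>
  have "pinczon_d V M q act N e e' F vs
      = multihom T (\<lambda>ds us. \<Sum>\<sigma> | \<sigma> permutes {..<length us}. sg (koszul \<sigma> ds) (?P (permute_list \<sigma> us))) vs"
    by (simp add: pinczon_d_def pinczon_sym_def symmetrize_def)
  also have "\<dots> = multihom T (\<lambda>ds. G) vs"
  proof (rule T.multihom_ext[OF vs])
    fix zs assume zs: "T.homog zs" "length zs = k + 2"
    have "(\<Sum>\<sigma> | \<sigma> permutes {..<length (vecs zs)}. sg (koszul \<sigma> (degs zs)) (?P (permute_list \<sigma> (vecs zs))))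
        = Sym (\<lambda>ys. ?P (vecs ys)) zs"
      unfolding Sym_def by (rule sum.cong) (simp_all add: permute_list_map)
    also have "\<dots> = Sym (Cyc (insert_bracket F)) zs"
    proof (rule Sym_cong)
      fix ys assume ys: "mset ys = mset zs"
      show "?P (vecs ys) = Cyc (insert_bracket F) ys"
        by (rule pinczon_homog[OF e F]) (use zs T.homog_mset[OF ys] mset_eq_length[OF ys] in simp_all)
    qed
    also have "\<dots> = G (vecs zs)"
      using eq[OF zs] zs(2) by (simp add: Sym_Cyc)
    finally show "(\<Sum>\<sigma> | \<sigma> permutes {..<length (vecs zs)}. sg (koszul \<sigma> (degs zs)) (?P (permute_list \<sigma> (vecs zs)))) = G (vecs zs)" .
  qed
  also have "\<dots> = G vs"
    by (rule T.mlin_expand[OF G vs, symmetric])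
  finally show ?thesis .
qed

end

context module_cochain
begin

text \<open>One rotation puts the inserted vector last, where its functional is evaluated at
  \<open>C\<close> and gives the two action terms. In the other \<open>k\<close> rotations its
  \<open>V\<close> component is an argument of \<open>C\<close>.\<close>

lemma insert_bracket_Omega:
  assumes zs: "T.homog (z1 # z2 # zs)" "length zs = k"
  shows "insert_bracket \<Omega>C (z1 # z2 # zs)
    = sg (tdeg (z1 # z2 # zs) + (fst z1 + fst z2 + 1) * tdeg zs + fst z1 + (fst z1 + 1) * (fst z2 + 1))
        (hval (snd z2) (act (fst (snd z1)) (C (map fst (vecs zs)))))
      - sg (tdeg (z1 # z2 # zs) + (fst z1 + fst z2 + 1) * tdeg zs + fst z1)
        (hval (snd z1) (act (fst (snd z2)) (C (map fst (vecs zs)))))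
      + (\<Sum>s<k. - sg (tdeg (z1 # z2 # zs) + fst (zs ! s) * tdeg (drop (Suc s) zs))
          (hval (snd (zs ! s)) (C (Q [fst (snd z1), fst (snd z2)] # map fst (vecs (take s zs @ drop (Suc s) zs))))))"
proof -
  let ?d = "fst z1 + fst z2 + 1" and ?Q = "Q [fst (snd z1), fst (snd z2)]"
  let ?w = "(?d, QT [snd z1, snd z2])"
  have z: "snd z1 \<in> hcomp T (fst z1)" "snd z2 \<in> hcomp T (fst z2)" "T.homog zs" using zs(1) by simp_all
  have w: "T.homog (?w # zs)" using QT_hcomp[OF z(1,2)] z(3) by simp
  have m: "C (map fst (vecs zs)) \<in> hcomp M (tdeg zs + p + 1)"
    using C_hcomp[OF homog_xl[OF z(3)]] zs(2) by simp
  have Q: "?Q \<in> hcomp V (?d + 1)"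
    using Q_hcomp[of "fst (snd z1)" "fst z1" "fst (snd z2)" "fst z2"] zs(1) by (simp add: hcomp_D_iff)
  have "\<Omega>C (QT [snd z1, snd z2] # vecs zs) = Cyc (\<lambda>zs. pairing C (vecs zs)) (?w # zs)"
    using Omega_tilde_homog[OF C_mlin w] zs(2) by simp
  \<comment> \<open>In the indexing of \<open>Cyc_shift\<close> the inserted vector is last in the
    first summand, and \<open>zs ! s\<close> is last in the others.\<close>
  also have "\<dots> = sg (?d * tdeg zs) (pairing C (vecs zs @ [QT [snd z1, snd z2]]))
      + (\<Sum>s<k. sg ((?d + tdeg (take (Suc s) zs)) * tdeg (drop (Suc s) zs))
          (pairing C (vecs (drop (Suc s) zs) @ QT [snd z1, snd z2] # vecs (take (Suc s) zs))))"
    unfolding Cyc_shift by (simp add: zs(2) sum.lessThan_Suc_shift del: sum.lessThan_Suc)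
  also have "(\<Sum>s<k. sg ((?d + tdeg (take (Suc s) zs)) * tdeg (drop (Suc s) zs))
          (pairing C (vecs (drop (Suc s) zs) @ QT [snd z1, snd z2] # vecs (take (Suc s) zs))))
      = (\<Sum>s<k. - sg (fst (zs ! s) * tdeg (drop (Suc s) zs))
          (hval (snd (zs ! s)) (C (?Q # map fst (vecs (take s zs @ drop (Suc s) zs))))))"
  proof (rule sum.cong[OF refl])
    fix s assume "s \<in> {..<k}"
    then have s: "s < length zs" using zs(2) by simp
    let ?A = "take s zs" and ?B = "drop (Suc s) zs"
    have split: "zs = ?A @ [zs ! s] @ ?B" using s by (simp add: Cons_nth_drop_Suc)
    have hAB: "T.homog ?A" "T.homog [zs ! s]" "T.homog ?B"
      using z(3) by (subst (asm) split, simp)+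
    have c: "snd (zs ! s) \<in> gcarrier D" using hAB(2) T.hcomp_carrier[of "snd (zs ! s)" "fst (zs ! s)"] by simp
    have "sV.homog ([(?d, ?Q)] @ xl ?A @ xl ?B)"
      using homog_xl[OF hAB(1)] homog_xl[OF hAB(3)] Q by simp
    from C_rotate[OF this] have "C (map fst (vecs ?B) @ [?Q] @ map fst (vecs ?A))
        = sg (tdeg ?B * (?d + tdeg ?A)) (C (?Q # map fst (vecs (?A @ ?B))))"
      using s zs(2) by simp
    moreover have "pairing C (vecs ?B @ QT [snd z1, snd z2] # vecs (take (Suc s) zs))
        = - hval (snd (zs ! s)) (C (map fst (vecs ?B) @ [?Q] @ map fst (vecs ?A)))"
      using pairing_snoc[of C "vecs ?B @ QT [snd z1, snd z2] # vecs ?A" "snd (zs ! s)"] s QT_parts(1)[OF z(1,2)]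
      by (simp add: take_Suc_conv_app_nth)
    ultimately show "sg ((?d + tdeg (take (Suc s) zs)) * tdeg ?B)
          (pairing C (vecs ?B @ QT [snd z1, snd z2] # vecs (take (Suc s) zs)))
        = - sg (fst (zs ! s) * tdeg ?B) (hval (snd (zs ! s)) (C (?Q # map fst (vecs (?A @ ?B)))))"
      using s by (simp add: hval_right[OF c] sg_minus sg_sg take_Suc_conv_app_nth) (auto simp: sg_def)
  qed
  also have "pairing C (vecs zs @ [QT [snd z1, snd z2]])
      = sg (fst z1 + (fst z1 + 1) * (fst z2 + 1)) (hval (snd z2) (act (fst (snd z1)) (C (map fst (vecs zs)))))
        - sg (fst z1) (hval (snd z1) (act (fst (snd z2)) (C (map fst (vecs zs)))))"
    unfolding pairing_snoc QT_parts(2)[OF z(1,2) m] by simp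
  finally show ?thesis
    by (simp add: insert_bracket_def sg_add sg_sum sg_minus sg_sg diff_conv_add_uminus add.assoc del: add_uminus_conv_diff)
qed

lemma Sym_insert_bracket_Omega:
  assumes zs: "T.homog zs" "length zs = k + 2"
  shows "Sym (insert_bracket \<Omega>C) zs = 2 * Sym act_term zs + of_nat k * Sym bracket_term zs"
proof -
  define X where "X zs = sg (tdeg zs + (fst (zs ! 0) + fst (zs ! 1) + 1) * tdeg (drop 2 zs) + fst (zs ! 0) + (fst (zs ! 0) + 1) * (fst (zs ! 1) + 1))
        (hval (snd (zs ! 1)) (act (fst (snd (zs ! 0))) (C (map fst (vecs (drop 2 zs))))))" for zs
  define Y where "Y zs = - sg (tdeg zs + (fst (zs ! 0) + fst (zs ! 1) + 1) * tdeg (drop 2 zs) + fst (zs ! 0))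
        (hval (snd (zs ! 0)) (act (fst (snd (zs ! 1))) (C (map fst (vecs (drop 2 zs))))))" for zs
  define Z where "Z s zs = - sg (tdeg zs + fst (drop 2 zs ! s) * tdeg (drop (Suc s) (drop 2 zs)))
          (hval (snd (drop 2 zs ! s)) (C (Q [fst (snd (zs ! 0)), fst (snd (zs ! 1))]
            # map fst (vecs (take s (drop 2 zs) @ drop (Suc s) (drop 2 zs))))))" for s zs
  have hom: "T.homog ys \<and> length ys = k + 2" if "mset ys = mset zs" for ys
    using T.homog_mset[OF that] mset_eq_length[OF that] zs by simp
  have "Sym (insert_bracket \<Omega>C) zs = Sym (\<lambda>ys. X ys + Y ys + (\<Sum>s<k. Z s ys)) zs"
  proof (rule Sym_cong)
    fix ys assume "mset ys = mset zs"
    with hom obtain y1 y2 xs where y: "ys = y1 # y2 # xs" and k: "length xs = k" and h: "T.homog (y1 # y2 # xs)"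
      by (metis length_2E)
    show "insert_bracket \<Omega>C ys = X ys + Y ys + (\<Sum>s<k. Z s ys)"
      unfolding y insert_bracket_Omega[OF h k] by (simp add: X_def Y_def Z_def)
  qed
  also have "\<dots> = Sym X zs + Sym Y zs + (\<Sum>s<k. Sym (Z s) zs)"
    by (simp add: Sym_add Sym_sum)
  \<comment> \<open>The functional sits in the second letter, which moves to the end.\<close>
  also have "Sym X zs = Sym act_term zs"
  proof (rule Sym_block_swap[where p = 1 and a = 1 and b = k and c = 0])
    fix P A B R :: "(int \<times> ('k, 'v, 'm) double) list"
    assume m: "mset (P @ A @ B @ R) = mset zs"
      and l: "length P = 1" "length A = 1" "length B = k" "length R = 0"
    obtain y1 y2 where y: "P = [y1]" "A = [y2]"
      using l(1,2) length_Suc_0_D by (metis One_nat_def)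
    have h: "T.homog ([y1, y2] @ B)" using hom[OF m] l by (simp add: y)
    let ?h = "hval (snd y2) (act (fst (snd y1)) (C (map fst (vecs B))))"
    have L: "X (P @ A @ B @ R) = sg (fst y1 + fst y2 + tdeg B + (fst y1 + fst y2 + 1) * tdeg B + fst y1 + (fst y1 + 1) * (fst y2 + 1)) ?h"
      using l by (simp add: X_def y add.assoc)
    have R: "act_term (P @ B @ A @ R) = - sg ((p + 1) * fst y1) ?h"
      using l act_term_eq[of y1 B y2] by (simp add: y)
    have mem: "act (fst (snd y1)) (C (map fst (vecs B))) \<in> hcomp M (fst y1 + 1 + (tdeg B + p + 1))"
      using h C_hcomp[OF homog_xl[of B]] l by (intro act_hcomp) (simp_all add: hcomp_D_iff)
    \<comment> \<open>\<open>p\<close> occurs in the Chevalley sign only. A nonzero value forces the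
      degrees to cancel, and this expresses \<open>p\<close> through the letters; the other kinds of
      terms are settled in the same way.\<close>
    have "snd y2 \<in> hcomp T (fst y2)" using h by simp
      from hval_vanish[OF this mem] consider "?h = 0" | "fst y2 + 1 + (fst y1 + 1 + (tdeg B + p + 1)) = 0"
      by blast
    then show "X (P @ A @ B @ R) = sg (tdeg A * tdeg B) (act_term (P @ B @ A @ R))"
    proof cases
      case 2
      then have "p = - fst y1 - fst y2 - tdeg B - 3" by simp
      then show ?thesis
        unfolding L R by (simp add: y sg_def)
    qed (simp add: L R)
  qed (use zs in simp)
  \<comment> \<open>The functional sits in the first letter, which moves past the other
    \<open>k + 1\<close> letters.\<close>
  also have "Sym Y zs = Sym act_term zs"
  proof (rule Sym_block_swap[where p = 0 and a = 1 and b = "Suc k" and c = 0])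
    fix P A B R :: "(int \<times> ('k, 'v, 'm) double) list"
    assume m: "mset (P @ A @ B @ R) = mset zs"
      and l: "length P = 0" "length A = 1" "length B = Suc k" "length R = 0"
    obtain y1 where y1: "A = [y1]"
      using l(2) length_Suc_0_D by (metis One_nat_def)
    obtain y2 B' where y2: "B = y2 # B'" and l': "length B' = k"
      using l(3) by (auto simp: length_Suc_conv)
    have h: "T.homog ([y1, y2] @ B')" using hom[OF m] l by (simp add: y1 y2)
    let ?h = "hval (snd y1) (act (fst (snd y2)) (C (map fst (vecs B'))))"
    have L: "Y (P @ A @ B @ R) = - sg (fst y1 + fst y2 + tdeg B' + (fst y1 + fst y2 + 1) * tdeg B' + fst y1) ?h"
      using l by (simp add: Y_def y1 y2 add.assoc)
    have R: "act_term (P @ B @ A @ R) = - sg ((p + 1) * fst y2) ?h"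
      using l act_term_eq[of y2 B' y1] by (simp add: y1 y2)
    have mem: "act (fst (snd y2)) (C (map fst (vecs B'))) \<in> hcomp M (fst y2 + 1 + (tdeg B' + p + 1))"
      using h C_hcomp[OF homog_xl[of B']] l' by (intro act_hcomp) (simp_all add: hcomp_D_iff)
    have "snd y1 \<in> hcomp T (fst y1)" using h by simp
      from hval_vanish[OF this mem] consider "?h = 0" | "fst y1 + 1 + (fst y2 + 1 + (tdeg B' + p + 1)) = 0"
      by blast
    then show "Y (P @ A @ B @ R) = sg (tdeg A * tdeg B) (act_term (P @ B @ A @ R))"
    proof cases
      case 2
      then have "p = - fst y1 - fst y2 - tdeg B' - 3" by simp
      then show ?thesis
        unfolding L R by (simp add: y1 y2 sg_def)
    qed (simp add: L R)
  qed (use zs in simp)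
  also have "(\<Sum>s<k. Sym (Z s) zs) = (\<Sum>s<k. Sym bracket_term zs)"
  proof (rule sum.cong[OF refl])
    fix s assume "s \<in> {..<k}"
    then have s: "s < k" by simp
    \<comment> \<open>The letter at place \<open>s + 2\<close> carries the functional and moves past
      the \<open>k - Suc s\<close> letters behind it.\<close>
    show "Sym (Z s) zs = Sym bracket_term zs"
    proof (rule Sym_block_swap[where p = "s + 2" and a = 1 and b = "k - Suc s" and c = 0])
      fix P A B R :: "(int \<times> ('k, 'v, 'm) double) list"
      assume m: "mset (P @ A @ B @ R) = mset zs"
        and l: "length P = s + 2" "length A = 1" "length B = k - Suc s" "length R = 0"
      obtain y where y: "A = [y]"
        using l(2) length_Suc_0_D by (metis One_nat_def)
      obtain y1 y2 P' where P: "P = y1 # y2 # P'" and l': "length P' = s"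
        using l(1) by (rule length_2E)
      have h: "T.homog ([y1, y2] @ P' @ [y] @ B)" using hom[OF m] l by (simp add: P y)
      let ?Q = "Q [fst (snd y1), fst (snd y2)]"
      let ?h = "hval (snd y) (C (?Q # map fst (vecs (P' @ B))))"
      have L: "Z s (P @ A @ B @ R) = - sg (fst y1 + fst y2 + tdeg P' + fst y + tdeg B + fst y * tdeg B) ?h"
        using l l' by (simp add: Z_def P y nth_append add.assoc)
      have R: "bracket_term (P @ B @ A @ R) = sg p ?h"
        using l bracket_term_eq[of y1 y2 "P' @ B" y] by (simp add: P y)
      have mem: "C (?Q # map fst (vecs (P' @ B))) \<in> hcomp M (fst y1 + fst y2 + tdeg (P' @ B) + p + 2)"
        using C_insert_hcomp(1)[of "[]" "(fst y1, fst (snd y1))" "(fst y2, fst (snd y2))" "xl (P' @ B)"]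
          homog_xl[of "[y1, y2] @ P' @ B"] h l l' s by (simp add: add.assoc)
      have "snd y \<in> hcomp T (fst y)" using h by simp
      from hval_vanish[OF this mem] consider "?h = 0" | "fst y + 1 + (fst y1 + fst y2 + tdeg (P' @ B) + p + 2) = 0"
        by blast
      then show "Z s (P @ A @ B @ R) = sg (tdeg A * tdeg B) (bracket_term (P @ B @ A @ R))"
      proof cases
        case 2
        then have "p = - fst y - fst y1 - fst y2 - tdeg P' - tdeg B - 3" by simp
        then show ?thesis
          unfolding L R by (auto simp: y sg_def)
      qed (simp add: L R)
    qed (use zs s in simp)
  qed
  finally show ?thesis by simp
qed

section \<open>The symmetric form attached to a cochain\<close>

lemma \<Omega>C_mlin: "T.mlin (*) (Suc k) \<Omega>C"
  by (rule Omega_tilde_mlin[OF C_mlin])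

lemma \<Omega>C_Symmetric: "T.homog zs \<Longrightarrow> length zs = Suc k \<Longrightarrow> Symmetric (\<lambda>ys. \<Omega>C (vecs ys)) zs"
  by (rule Omega_tilde_Symmetric[OF C_mlin C_sym])

lemma \<Omega>C_graded_sym: "graded_sym T (Suc k) \<Omega>C"
  using T.graded_sym_iff[OF vector_space_field \<Omega>C_mlin] \<Omega>C_Symmetric by blast

lemma symmetrize_\<Omega>C: "T.homog zs \<Longrightarrow> length zs = Suc k \<Longrightarrow>
    symmetrize T \<Omega>C (vecs zs) = of_nat (fact (Suc k)) * \<Omega>C (vecs zs)"
  using T.symmetrize_homog[OF vector_space_field \<Omega>C_mlin] Sym_Symmetric[OF \<Omega>C_Symmetric] by simp


text \<open>Makes all facts about the form of \<open>c\<close> available for the form of its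
  coboundary.\<close>

lemma chevalley_d_module_cochain: "module_cochain V M q act (Suc k) \<delta> (chevalley_d V M q act k \<delta> c)"
  by unfold_locales (rule chevalley_d_cochain)

lemma Omega_cochain_symmetric_forms: "Omega_cochain V M c \<in> symmetric_forms T (k + 1)"
  unfolding Omega_cochain_def symmetric_forms_def T.multilinear_iff
  using \<Omega>C_mlin \<Omega>C_graded_sym by simp

text \<open>A symmetric form is cyclic, so the form of \<open>c\<close> is its own representative in
  the quotient.\<close>

lemma Omega_cochain_restricted_forms: "symmetrize T (Omega_cochain V M c) \<in> restricted_forms T (k + 1)"
proof -
  have "Omega_cochain V M c \<in> cyclic_forms T (k + 1)"
    using Omega_cochain_symmetric_forms T.cyclic_if_graded_sym
    by (auto simp: symmetric_forms_def cyclic_forms_def)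
  then show ?thesis unfolding restricted_forms_def by blast
qed

lemma Omega_cochain_homog:
  "T.homog zs \<Longrightarrow> length zs = Suc k \<Longrightarrow> Omega_cochain V M c (vecs zs) = Cyc (\<lambda>ys. pairing C (vecs ys)) zs"
  unfolding Omega_cochain_def by (rule Omega_tilde_homog[OF C_mlin])

end

section \<open>Linearity of the map\<close>

context module_double
begin

text \<open>The shift sign depends on the degrees only and is common to the three cochains, so the
  pairing, and with it the cyclic sum, is linear in the cochain.\<close>

lemma Omega_cochain_combination:
  assumes c: "c \<in> cochains V M k \<delta>" and c': "c' \<in> cochains V M k \<delta>" and d: "d \<in> cochains V M k \<delta>"
    and eq: "\<And>xs. d xs = smul M a (c xs) + smul M a' (c' xs)"
    and vs: "vs \<in> tuples T (k + 1)"
  shows "Omega_cochain V M d vs = a * Omega_cochain V M c vs + a' * Omega_cochain V M c' vs"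
proof -
  interpret c: module_cochain V M q act k \<delta> c by unfold_locales (rule c)
  interpret c': module_cochain V M q act k \<delta> c' by unfold_locales (rule c')
  interpret d: module_cochain V M q act k \<delta> d by unfold_locales (rule d)
  let ?R = "\<lambda>vs. a * Omega_cochain V M c vs + a' * Omega_cochain V M c' vs"
  interpret K: vector_space "(*) :: 'k \<Rightarrow> 'k \<Rightarrow> 'k" by (rule vector_space_field)
  show ?thesis
  proof (rule T.mlin_ext[where F' = ?R and s = "(*)" and n = "Suc k"])
    show "T.mlin (*) (Suc k) (Omega_cochain V M d)"
      using d.\<Omega>C_mlin by (simp add: Omega_cochain_def)
    show "T.mlin (*) (Suc k) ?R"
    proof (rule T.mlinI)
      fix vs i x y r assume h: "vs \<in> tuples T (Suc k)" "i < Suc k" "x \<in> gcarrier T" "y \<in> gcarrier T"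
      note m = T.mlinD[OF c.\<Omega>C_mlin h(1-3), folded Omega_cochain_def] T.mlinD[OF c'.\<Omega>C_mlin h(1-3), folded Omega_cochain_def]
      show "?R (vs[i := x + y]) = ?R (vs[i := x]) + ?R (vs[i := y]) \<and> ?R (vs[i := smul T r x]) = r * ?R (vs[i := x])"
        unfolding m(1)[OF h(4)] m(3)[OF h(4)] m(2)[of r] m(4)[of r]
        by (simp add: distrib_left mult.left_commute)
    qed
    show "Omega_cochain V M d (vecs zs) = ?R (vecs zs)" if zs: "T.homog zs" "length zs = Suc k" for zs
    proof -
      have "pairing d.C (vecs ys) = a * pairing c.C (vecs ys) + a' * pairing c'.C (vecs ys)"
        if ys: "T.homog ys" "length ys = Suc k" for ys
      proof -
        obtain xs l where xl: "ys = xs @ [l]" and k: "length xs = k"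
          using ys(2) unfolding length_Suc_conv_rev[of ys] by blast
        have l: "snd l \<in> gcarrier D" using ys(1) T.hcomp_carrier[of "snd l" "fst l"] by (simp add: xl)
        have x: "sV.homog (xl xs)" "length (xl xs) = k" using homog_xl[of xs] ys(1) k by (simp_all add: xl)
        show ?thesis
          using V.shift_map_mlin_homog[OF c.c_mlin x] V.shift_map_mlin_homog[OF c'.c_mlin x] V.shift_map_mlin_homog[OF d.c_mlin x]
          by (simp add: xl pairing_snoc eq hval_right[OF l] sg_add sg_mult_right)
      qed
      then have "pairing d.C (vecs (rotate r zs)) = a * pairing c.C (vecs (rotate r zs)) + a' * pairing c'.C (vecs (rotate r zs))" for r
        using zs by (simp add: T.homog_def)
      then show ?thesis
        unfolding c.Omega_cochain_homog[OF zs] c'.Omega_cochain_homog[OF zs] d.Omega_cochain_homog[OF zs] Cyc_def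
        by (simp add: sum_distrib_left sum.distrib sg_add sg_mult_right)
    qed
  qed (use vs in simp)
qed

lemma cochains_combination:
  assumes "c \<in> cochains V M k \<delta>" and "c' \<in> cochains V M k \<delta>"
  shows "(\<lambda>xs. smul M a (c xs) + smul M a' (c' xs)) \<in> cochains V M k \<delta>"
proof -
  interpret c: module_cochain V M q act k \<delta> c by unfold_locales (rule assms)
  interpret c': module_cochain V M q act k \<delta> c' by unfold_locales (rule assms)
  have "V.mlin (smul M) k (\<lambda>xs. smul M a (c xs) + smul M a' (c' xs))"
    by (rule V.mlinI) (simp add: V.mlinD[OF c.c_mlin] V.mlinD[OF c'.c_mlin] M.scale_right_distrib mult.commute)
  moreover have "skew_sym V k (\<lambda>xs. smul M a (c xs) + smul M a' (c' xs))"
    unfolding skew_sym_def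
  proof (intro allI impI)
    fix us ws x y d d'
    assume h: "us @ [x, y] @ ws \<in> tuples V k" "x \<in> hcomp V d" "y \<in> hcomp V d'"
    have "c (us @ [y, x] @ ws) = - sg (d * d') (c (us @ [x, y] @ ws))"
      "c' (us @ [y, x] @ ws) = - sg (d * d') (c' (us @ [x, y] @ ws))"
      using c.c_skew c'.c_skew h unfolding skew_sym_def by blast+
    then show "smul M a (c (us @ [y, x] @ ws)) + smul M a' (c' (us @ [y, x] @ ws))
        = - sg (d * d') (smul M a (c (us @ [x, y] @ ws)) + smul M a' (c' (us @ [x, y] @ ws)))"
      by (simp add: sg_def)
  qed
  moreover have "has_degree V M k \<delta> (\<lambda>xs. smul M a (c xs) + smul M a' (c' xs))"
    using c.c_degree c'.c_degree unfolding V.has_degree_iff by (auto intro!: M.hcomp_add M.hcomp_scale)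
  ultimately show ?thesis
    by (simp add: cochains_def V.multilinear_iff)
qed

end

section \<open>Comparison of the two coboundaries\<close>

context module_cochain
begin

lemma pinczon_d_Omega_cochain:
  assumes e: "dual_bases D b N e e'" and vs: "vs \<in> tuples T (k + 2)"
  shows "pinczon_d V M q act N e e' (Omega_cochain V M c) vs
      = of_nat (k + 2) * Omega_cochain V M (chevalley_d V M q act k \<delta> c) vs"
    and "pinczon_d V M q act N e e' (symmetrize T (Omega_cochain V M c)) vs
      = symmetrize T (Omega_cochain V M (chevalley_d V M q act k \<delta> c)) vs"
proof -
  interpret d: module_cochain V M q act "Suc k" \<delta> "chevalley_d V M q act k \<delta> c"
    by (rule chevalley_d_module_cochain)
  let ?d = "Omega_cochain V M (chevalley_d V M q act k \<delta> c)"
  have d_mlin: "T.mlin (*) (k + 2) ?d"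
    using d.\<Omega>C_mlin by (simp add: Omega_cochain_def)
  have main: "Sym (insert_bracket \<Omega>C) zs = ?d (vecs zs)" if "T.homog zs" "length zs = k + 2" for zs
    using Sym_insert_bracket_Omega[OF that] Omega_chevalley[OF that] by simp
  show "pinczon_d V M q act N e e' (Omega_cochain V M c) vs = of_nat (k + 2) * ?d vs"
    unfolding Omega_cochain_def[of V M c]
  proof (rule pinczon_d_eqI[OF e \<Omega>C_mlin _ _ vs])
    show "T.mlin (*) (k + 2) (\<lambda>vs. of_nat (k + 2) * ?d vs)"
      by (rule T.mlinI) (simp only: T.mlinD[OF d_mlin] distrib_left mult.left_commute conj_absorb simp_thms)
  qed (use main in simp)
  show "pinczon_d V M q act N e e' (symmetrize T (Omega_cochain V M c)) vs = symmetrize T ?d vs"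
    unfolding Omega_cochain_def[of V M c]
  proof (rule pinczon_d_eqI[OF e T.mlin_symmetrize[OF vector_space_field \<Omega>C_mlin] T.mlin_symmetrize[OF vector_space_field d_mlin] _ vs])
    fix zs assume zs: "T.homog zs" "length zs = k + 2"
    have "Sym (insert_bracket (symmetrize T \<Omega>C)) zs = Sym (\<lambda>ys. of_nat (fact (Suc k)) * insert_bracket \<Omega>C ys) zs"
    proof (rule Sym_cong)
      fix ys assume ys: "mset ys = mset zs"
      have h: "T.homog ys" "length ys = k + 2"
        using zs T.homog_mset[OF ys] mset_eq_length[OF ys] by auto
      then obtain y1 y2 xs where y: "ys = y1 # y2 # xs" and k: "length xs = k"
        by (metis length_2E)
      have "T.homog ((fst y1 + fst y2 + 1, QT [snd y1, snd y2]) # xs)"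
        using h(1) QT_hcomp[of "snd y1" "fst y1" "snd y2" "fst y2"] by (simp add: y)
      from symmetrize_\<Omega>C[OF this] k
      show "insert_bracket (symmetrize T \<Omega>C) ys = of_nat (fact (Suc k)) * insert_bracket \<Omega>C ys"
        by (simp add: insert_bracket_def y sg_mult_right del: fact_Suc)
    qed
    also have "\<dots> = of_nat (fact (Suc k)) * Sym (insert_bracket \<Omega>C) zs"
      by (simp add: Sym_def sum_distrib_left sg_mult_right del: fact_Suc)
    also have "\<dots> = of_nat (fact (Suc k)) * ?d (vecs zs)"
      by (simp add: main[OF zs] del: fact_Suc)
    \<comment> \<open>The factor \<open>k + 2\<close> of the cyclic sum turns the
      \<open>(k + 1)!\<close> from restricting the form of \<open>c\<close> into the
      \<open>(k + 2)!\<close> that belongs to the form of its coboundary.\<close>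
    finally have "of_nat (k + 2) * Sym (insert_bracket (symmetrize T \<Omega>C)) zs = of_nat (fact (k + 2)) * ?d (vecs zs)"
      by (simp add: algebra_simps)
    also have "\<dots> = symmetrize T ?d (vecs zs)"
      using d.symmetrize_\<Omega>C[OF zs(1)] zs(2) by (simp add: Omega_cochain_def del: fact_Suc)
    finally show "of_nat (k + 2) * Sym (insert_bracket (symmetrize T \<Omega>C)) zs = symmetrize T ?d (vecs zs)" .
  qed
qed

end

theorem proposition6p4:
  fixes V :: "('k::field_char_0, 'v::ab_group_add) gspace"
    and M :: "('k, 'm::ab_group_add) gspace"
    and q :: "'v list \<Rightarrow> 'v"
    and act :: "'v \<Rightarrow> 'm \<Rightarrow> 'm"
    and N :: nat
    and e e' :: "nat \<Rightarrow> ('k, 'v, 'm) double"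
  assumes "graded_space V" and "graded_space M"
    and "lie_algebra V q" and "lie_module V q M act"
    and "dual_bases (double_space V M) (double_form V M) N e e'"
  shows "\<forall>k \<delta>. \<forall>c \<in> cochains V M k \<delta>.
    (let T = shifted_double V M;
         d = chevalley_d V M q act k \<delta>;
         d_P = pinczon_d V M q act N e e';
         \<Omega> = Omega_cochain V M
     in d c \<in> cochains V M (k + 1) \<delta>
      \<and> \<Omega> c \<in> symmetric_forms T (k + 1)
      \<and> symmetrize T (\<Omega> c) \<in> restricted_forms T (k + 1)
      \<and> (\<forall>vs \<in> tuples T (k + 1).
           (\<forall>c' \<in> cochains V M k \<delta>. \<Omega> (\<lambda>xs. c xs + c' xs) vs = \<Omega> c vs + \<Omega> c' vs)
         \<and> (\<forall>a. \<Omega> (\<lambda>xs. smul M a (c xs)) vs = a * \<Omega> c vs))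
      \<and> (\<forall>vs \<in> tuples T (k + 2).
           d_P (\<Omega> c) vs = of_nat (k + 2) * \<Omega> (d c) vs
         \<and> d_P (symmetrize T (\<Omega> c)) vs = symmetrize T (\<Omega> (d c)) vs))"
proof (intro allI ballI, goal_cases)
  case c: (1 k \<delta> c)
  interpret module_cochain V M q act k \<delta> c
    by unfold_locales (use assms c in auto)
  \<comment> \<open>The sum and the scalar multiple are the combinations with coefficients
    \<open>1\<close>, \<open>1\<close> and \<open>a\<close>, \<open>0\<close>.\<close>
  have add: "Omega_cochain V M (\<lambda>xs. c xs + c' xs) vs = Omega_cochain V M c vs + Omega_cochain V M c' vs"
    if "c' \<in> cochains V M k \<delta>" "vs \<in> tuples T (k + 1)" for c' vs
    using Omega_cochain_combination[OF c that(1) cochains_combination[OF c that(1), of 1 1] refl that(2)]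
    by (simp add: M.scale_one)
  have scale: "Omega_cochain V M (\<lambda>xs. smul M a (c xs)) vs = a * Omega_cochain V M c vs"
    if "vs \<in> tuples T (k + 1)" for a vs
    using Omega_cochain_combination[OF c c cochains_combination[OF c c, of a 0] refl that]
    by (simp add: M.scale_zero_left)
  show ?case
    unfolding Let_def
    using chevalley_d_cochain Omega_cochain_symmetric_forms Omega_cochain_restricted_forms
      add scale pinczon_d_Omega_cochain[OF assms(5)]
    by (simp only: Suc_eq_plus1) blast
qed

end
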